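(* Let $d\in\mathbb{N}$, let $1 \leq p,q \leq \infty$ and $0 < r < \frac{1}{p}$. Then there exists a constant $c > 0$ such that, for any integer $N \geq 2$, there exists a point set $\mathcal{P} \subset [0,1)^d$ with $N$ points such that \[ \left\| D_{\mathcal{P}} \,|\, S_{pq}^r B([0,1)^d) \right\| \leq c \, N^{r-1} \, (\log N)^{\frac{d-1}{q}}. \]
   Context: Conventions: $\frac1\infty=0$. For a point set $\mathcal{P}\subset[0,1)^d$ with $N$ points, the discrepancy function is \[ D_{\mathcal{P}}(x) = \frac{1}{N} \sum_{z \in \mathcal{P}} \chi_{[0,x)}(z) - x_1\cdots x_d,\qquad x=(x_1,\ldots,x_d)\in[0,1)^d, \] where $[0,x)=[0,x_1)\times\cdots\times[0,x_d)$ and $\chi_{[0,x)}$ is its characteristic function. Besov spaces with dominating mixed smoothness. Let $\mathcal{S}(\mathbb{R}^d)$ be the Schwartz space, $\mathcal{S}'(\mathbb{R}^d)$ the space of tempered distributions and $\mathcal{F}$ the Fourier transform. Let $\varphi_0\in\mathcal{S}(\mathbb{R})$ satisfy $\varphi_0(t)=1$ for $|t|\le 1$ and $\varphi_0(t)=0$ for $|t|>\frac32$. For $k\in\mathbb{N}$, $t\in\mathbb{R}$ put $\varphi_k(t)=\varphi_0(2^{-k}t)-\varphi_0(2^{-k+1}t)$, and for $k=(k_1,\ldots,k_d)\in\mathbb{N}_0^d$, $t\in\mathbb{R}^d$ put $\varphi_k(t)=\varphi_{k_1}(t_1)\cdots\varphi_{k_d}(t_d)$. For $0<p,q\le\infty$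 and $r\in\mathbb{R}$, $S_{pq}^rB(\mathbb{R}^d)$ consists of all $f\in\mathcal{S}'(\mathbb{R}^d)$ with finite quasi-norm \[ \left\| f | S_{pq}^r B(\mathbb{R}^d) \right\| = \Big( \sum_{k \in \mathbb{N}_0^d} 2^{r (k_1 + \ldots + k_d) q} \left\| \mathcal{F}^{-1}(\varphi_k \mathcal{F} f) | L_p(\mathbb{R}^d) \right\|^q \Big)^{\frac{1}{q}} \] (supremum if $q=\infty$). Let $\mathcal{D}([0,1)^d)$ be the space of complex-valued infinitely differentiable functions on $\mathbb{R}^d$ with compact support in the interior of $[0,1)^d$ and $\mathcal{D}'([0,1)^d)$ its dual space of distributions. $S_{pq}^rB([0,1)^d)$ consists of all $f\in\mathcal{D}'([0,1)^d)$ with finite quasi-norm \[ \left\| f | S_{pq}^r B([0,1)^d) \right\| = \inf \left\{ \left\| g | S_{pq}^r B(\mathbb{R}^d) \right\| : g \in S_{pq}^r B(\mathbb{R}^d),\ g|_{[0,1)^d} = f \right\}. \] *)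

theory Defs
  imports "HOL-Analysis.Analysis" "HOL-Probability.Essential_Supremum"
begin

section \<open>Smooth functions, Schwartz functions and test functions\<close>

text \<open>The iterated directional derivative along a list of vectors. Multi-indices are rendered
  as lists of basis vectors. For a \<open>smooth\<close> function every derivative below exists,
  so that the arbitrary values of \<^const>\<open>frechet_derivative\<close> do not matter.\<close>

primrec dir_derivs ::
  "'a::euclidean_space list \<Rightarrow> ('a \<Rightarrow> complex) \<Rightarrow> 'a \<Rightarrow> complex" where
  "dir_derivs [] f = f"
| "dir_derivs (v # vs) f = (\<lambda>x. frechet_derivative (dir_derivs vs f) (at x) v)"

definition smooth :: "('a::euclidean_space \<Rightarrow> complex) \<Rightarrow> bool" where
  "smooth f \<longleftrightarrow> (\<forall>vs x. set vs \<subseteq> Basis \<longrightarrow> dir_derivs vs f differentiable (at x))"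

definition schwartz_space :: "('a::euclidean_space \<Rightarrow> complex) set" where
  "schwartz_space = {f. smooth f \<and>
     (\<forall>vs n. set vs \<subseteq> Basis \<longrightarrow> (\<exists>C. \<forall>x. (1 + norm x) ^ n * norm (dir_derivs vs f x) \<le> C))}"

definition test_functions :: "'a::euclidean_space set \<Rightarrow> ('a \<Rightarrow> complex) set" where
  "test_functions U = {f. smooth f \<and>
     compact (closure {x. f x \<noteq> 0}) \<and> closure {x. f x \<noteq> 0} \<subseteq> U}"

text \<open>On Schwartz functions and on test functions the suprema are finite. The seminorms
  with arbitrary \<open>n\<close> and \<open>m\<close> generate the topology of the Schwartz space; those with
  \<open>n = 0\<close> generate the topology of the test functions supported in a fixed compact set.\<close>

definition deriv_seminorm ::
  "nat \<Rightarrow> nat \<Rightarrow> ('a::euclidean_space \<Rightarrow> complex) \<Rightarrow> real" where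
  "deriv_seminorm n m f =
     (\<Sum>vs | set vs \<subseteq> Basis \<and> length vs \<le> m.
        (SUP x. (1 + norm x) ^ n * norm (dir_derivs vs f x)))"

section \<open>Distributions\<close>

definition linear_functional_on ::
  "('a \<Rightarrow> complex) set \<Rightarrow> (('a \<Rightarrow> complex) \<Rightarrow> complex) \<Rightarrow> bool" where
  "linear_functional_on V T \<longleftrightarrow>
     (\<forall>\<phi>\<in>V. \<forall>\<psi>\<in>V. T (\<lambda>x. \<phi> x + \<psi> x) = T \<phi> + T \<psi>) \<and>
     (\<forall>c. \<forall>\<phi>\<in>V. T (\<lambda>x. c * \<phi> x) = c * T \<phi>)"

text \<open>Functionals are total functions in HOL; only their values on Schwartz functions
  (on test functions, respectively) are relevant. Continuity is expressed by seminorm bounds.\<close>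

definition tempered_distributions :: "(('a::euclidean_space \<Rightarrow> complex) \<Rightarrow> complex) set" where
  "tempered_distributions = {T. linear_functional_on schwartz_space T \<and>
     (\<exists>C n m. \<forall>\<phi>\<in>schwartz_space. norm (T \<phi>) \<le> C * deriv_seminorm n m \<phi>)}"

definition distributions ::
  "'a::euclidean_space set \<Rightarrow> (('a \<Rightarrow> complex) \<Rightarrow> complex) set" where
  "distributions U = {T. linear_functional_on (test_functions U) T \<and>
     (\<forall>K. compact K \<and> K \<subseteq> U \<longrightarrow>
       (\<exists>C m. \<forall>\<phi>\<in>test_functions U. closure {x. \<phi> x \<noteq> 0} \<subseteq> K \<longrightarrow>
          norm (T \<phi>) \<le> C * deriv_seminorm 0 m \<phi>))}"

definition regular_distribution ::
  "'a::euclidean_space set \<Rightarrow> ('a \<Rightarrow> complex) \<Rightarrow> ('a \<Rightarrow> complex) \<Rightarrow> complex" where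
  "regular_distribution U h = (\<lambda>\<phi>. (LINT x:U|lborel. h x * \<phi> x))"

section \<open>Fourier transform\<close>

definition fourier :: "('a::euclidean_space \<Rightarrow> complex) \<Rightarrow> 'a \<Rightarrow> complex" where
  "fourier f \<xi> =
     complex_of_real ((2 * pi) powr (- real DIM('a) / 2)) * (LINT x|lborel. cis (- (x \<bullet> \<xi>)) * f x)"

definition inv_fourier :: "('a::euclidean_space \<Rightarrow> complex) \<Rightarrow> 'a \<Rightarrow> complex" where
  "inv_fourier f \<xi> =
     complex_of_real ((2 * pi) powr (- real DIM('a) / 2)) * (LINT x|lborel. cis (x \<bullet> \<xi>) * f x)"

definition dist_fourier ::
  "(('a::euclidean_space \<Rightarrow> complex) \<Rightarrow> complex) \<Rightarrow> ('a \<Rightarrow> complex) \<Rightarrow> complex" where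
  "dist_fourier T = (\<lambda>\<eta>. T (fourier \<eta>))"

definition dist_inv_fourier ::
  "(('a::euclidean_space \<Rightarrow> complex) \<Rightarrow> complex) \<Rightarrow> ('a \<Rightarrow> complex) \<Rightarrow> complex" where
  "dist_inv_fourier T = (\<lambda>\<eta>. T (inv_fourier \<eta>))"

definition dist_mult ::
  "('a \<Rightarrow> complex) \<Rightarrow> (('a \<Rightarrow> complex) \<Rightarrow> complex) \<Rightarrow> ('a \<Rightarrow> complex) \<Rightarrow> complex" where
  "dist_mult \<psi> T = (\<lambda>\<eta>. T (\<lambda>x. \<psi> x * \<eta> x))"

section \<open>Lebesgue quasi-norms\<close>

text \<open>Power with a positive real exponent on the extended half-line.\<close>

definition ennpowr :: "ennreal \<Rightarrow> real \<Rightarrow> ennreal" where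
  "ennpowr x a = (if x = \<infinity> then \<infinity> else ennreal (enn2real x powr a))"

definition Lp_norm :: "ennreal \<Rightarrow> ('a::euclidean_space \<Rightarrow> complex) \<Rightarrow> ennreal" where
  "Lp_norm p h =
     (if p = \<infinity> then esssup lborel (\<lambda>x. ennreal (norm (h x)))
      else ennpowr (\<integral>\<^sup>+x. ennreal (norm (h x) powr enn2real p) \<partial>lborel) (1 / enn2real p))"

text \<open>The quasi-norm of a tempered distribution is that of the function representing it,
  which is unique almost everywhere, and \<open>\<infinity>\<close> (the infimum of the empty set) if there is none.
  The distributions to which this is applied below have compactly supported Fourier transforms,
  hence are represented by smooth functions of polynomial growth.\<close>

definition dist_Lp_norm ::
  "ennreal \<Rightarrow> (('a::euclidean_space \<Rightarrow> complex) \<Rightarrow> complex) \<Rightarrow> ennreal" where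
  "dist_Lp_norm p T = Inf {Lp_norm p h | h. h \<in> borel_measurable lborel \<and>
     (\<forall>\<eta>\<in>schwartz_space. integrable lborel (\<lambda>x. h x * \<eta> x) \<and>
        T \<eta> = regular_distribution UNIV h \<eta>)}"

section \<open>Besov spaces with dominating mixed smoothness\<close>

definition dyadic_generator :: "(real \<Rightarrow> complex) \<Rightarrow> bool" where
  "dyadic_generator \<phi>0 \<longleftrightarrow> \<phi>0 \<in> schwartz_space \<and>
     (\<forall>t. \<bar>t\<bar> \<le> 1 \<longrightarrow> \<phi>0 t = 1) \<and> (\<forall>t. \<bar>t\<bar> > 3/2 \<longrightarrow> \<phi>0 t = 0)"

primrec dyadic :: "(real \<Rightarrow> complex) \<Rightarrow> nat \<Rightarrow> real \<Rightarrow> complex" where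
  "dyadic \<phi>0 0 = \<phi>0"
| "dyadic \<phi>0 (Suc k) = (\<lambda>t. \<phi>0 (t / 2 ^ Suc k) - \<phi>0 (t / 2 ^ k))"

definition dyadic_prod :: "(real \<Rightarrow> complex) \<Rightarrow> nat ^ 'd \<Rightarrow> real ^ 'd \<Rightarrow> complex" where
  "dyadic_prod \<phi>0 k t = (\<Prod>i\<in>UNIV. dyadic \<phi>0 (k $ i) (t $ i))"

definition dyadic_block ::
  "(real \<Rightarrow> complex) \<Rightarrow> nat ^ 'd \<Rightarrow> ((real ^ 'd \<Rightarrow> complex) \<Rightarrow> complex)
     \<Rightarrow> (real ^ 'd \<Rightarrow> complex) \<Rightarrow> complex" where
  "dyadic_block \<phi>0 k f = dist_inv_fourier (dist_mult (dyadic_prod \<phi>0 k) (dist_fourier f))"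

text \<open>The quasi-norms take values in \<open>[0, \<infinity>]\<close>. They depend on \<open>\<phi>0\<close>, the spaces do not.\<close>

definition besov_norm ::
  "(real \<Rightarrow> complex) \<Rightarrow> ennreal \<Rightarrow> ennreal \<Rightarrow> real
     \<Rightarrow> ((real ^ 'd \<Rightarrow> complex) \<Rightarrow> complex) \<Rightarrow> ennreal" where
  "besov_norm \<phi>0 p q r f =
     (if q = \<infinity>
      then (SUP k :: nat ^ 'd. ennreal (2 powr (r * real (\<Sum>i\<in>UNIV. k $ i)))
              * dist_Lp_norm p (dyadic_block \<phi>0 k f))
      else ennpowr
             (\<Sum>\<^sub>\<infinity>k :: nat ^ 'd. ennreal (2 powr (r * real (\<Sum>i\<in>UNIV. k $ i) * enn2real q))
                * ennpowr (dist_Lp_norm p (dyadic_block \<phi>0 k f)) (enn2real q))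
             (1 / enn2real q))"

definition besov_space ::
  "(real \<Rightarrow> complex) \<Rightarrow> ennreal \<Rightarrow> ennreal \<Rightarrow> real
     \<Rightarrow> ((real ^ 'd \<Rightarrow> complex) \<Rightarrow> complex) set" where
  "besov_space \<phi>0 p q r = {f \<in> tempered_distributions. besov_norm \<phi>0 p q r f < \<infinity>}"

definition unit_cube :: "(real ^ 'd) set" where
  "unit_cube = {x. \<forall>i. 0 \<le> x $ i \<and> x $ i < 1}"

definition besov_norm_cube ::
  "(real \<Rightarrow> complex) \<Rightarrow> ennreal \<Rightarrow> ennreal \<Rightarrow> real
     \<Rightarrow> ((real ^ 'd \<Rightarrow> complex) \<Rightarrow> complex) \<Rightarrow> ennreal" where
  "besov_norm_cube \<phi>0 p q r f =
     Inf {besov_norm \<phi>0 p q r g | g. g \<in> besov_space \<phi>0 p q r \<and>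
            (\<forall>\<phi>\<in>test_functions (interior unit_cube). g \<phi> = f \<phi>)}"

definition besov_space_cube ::
  "(real \<Rightarrow> complex) \<Rightarrow> ennreal \<Rightarrow> ennreal \<Rightarrow> real
     \<Rightarrow> ((real ^ 'd \<Rightarrow> complex) \<Rightarrow> complex) set" where
  "besov_space_cube \<phi>0 p q r =
     {f \<in> distributions (interior unit_cube). besov_norm_cube \<phi>0 p q r f < \<infinity>}"

section \<open>Discrepancy function\<close>

definition discrepancy :: "(real ^ 'd) set \<Rightarrow> real ^ 'd \<Rightarrow> real" where
  "discrepancy P x =
     1 / real (card P) * (\<Sum>z\<in>P. indicator {y. \<forall>i. 0 \<le> y $ i \<and> y $ i < x $ i} z)
       - (\<Prod>i\<in>UNIV. x $ i)"

definition discrepancy_distribution ::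
  "(real ^ 'd) set \<Rightarrow> (real ^ 'd \<Rightarrow> complex) \<Rightarrow> complex" where
  "discrepancy_distribution P =
     regular_distribution unit_cube (\<lambda>x. complex_of_real (discrepancy P x))"

end

theory Submission
  imports Defs "HOL-Number_Theory.Cong"
begin

text \<open>Write \<open>e z x = [z < x] \<psi>(x)\<close> with a Lipschitz cutoff \<open>\<psi>\<close> that equals 1 up to 1 and
  vanishes from 2 on. The function
  \<open>f x = 1/N \<Sum>\<^sub>z \<Prod>\<^sub>i e z\<^sub>i x\<^sub>i - \<Prod>\<^sub>i \<integral>\<^sub>0\<^sup>1 e s x\<^sub>i ds\<close> extends the discrepancy function to the whole
  space, and its dyadic block with index \<open>k\<close> is the convolution of \<open>f\<close> with a tensor product of
  kernels. At a point \<open>y\<close> this convolution is therefore the quadrature error of the point set for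
  a product function \<open>z \<mapsto> \<Prod>\<^sub>i A\<^sub>i z\<^sub>i\<close>, where, with \<open>K\<^sub>i\<close> the \<open>k\<^sub>i\<close>-th power of 2, \<open>A\<^sub>i\<close> is a bump of
  width \<open>1 / K\<^sub>i\<close> around \<open>y\<^sub>i\<close> plus a constant of size \<open>1 / K\<^sub>i\<close>.

  The points are the first \<open>N\<close> Halton points to coprime bases \<open>b\<^sub>i\<close>: by the Chinese remainder
  theorem the number of points in a box of side lengths \<open>1 / \<lambda>\<^sub>i\<close>, \<open>\<lambda>\<^sub>i = b\<^sub>i ^ l\<^sub>i\<close>, differs from
  \<open>N / \<Lambda>\<close>, \<open>\<Lambda> = \<Prod>\<^sub>i \<lambda>\<^sub>i\<close>, by at most 1. Each \<open>A\<^sub>i\<close> is split into \<open>b\<^sub>i\<close>-adic martingale differences.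
  If \<open>\<Lambda> \<le> N\<close>, the contribution of the scales \<open>l\<close> to \<open>N\<close> times the error is bounded through the
  deviations of the box counts, otherwise in absolute value. Both ways its \<open>L\<^sub>1\<close> norm in \<open>y\<close> is
  \<open>O(min \<Lambda> N / \<Prod>\<^sub>i max \<lambda>\<^sub>i K\<^sub>i)\<close>, and its supremum is so up to a summable term. As
  \<open>min \<Lambda> N \<le> \<Lambda> powr (1 - \<epsilon>) * N powr \<epsilon>\<close>, the sum over all \<open>l\<close> is a product of geometric sums and at
  most \<open>O((N / \<Prod>\<^sub>i K\<^sub>i) powr \<epsilon>)\<close> for every \<open>\<epsilon>\<close> between 0 and 1. Interpolation between \<open>L\<^sub>1\<close> and \<open>L\<^sub>\<infinity>\<close>
  shows that for \<open>0 < r < 1/p\<close> the weighted \<open>L\<^sub>p\<close> norms of the blocks decay geometrically in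
  \<open>\<bar>k\<^sub>1 + \<dots> + k\<^sub>d - log 2 N\<bar>\<close> from the maximal value \<open>O(N powr (r - 1))\<close>, and about
  \<open>(log N) ^ (d - 1)\<close> blocks lie near the maximum.\<close>

section \<open>Halton points\<close>

text \<open>Van der Corput's radical inverse: the base \<open>b\<close> digits of \<open>t\<close>,
  mirrored at the radix point. The test \<open>b < 2\<close> makes the recursion terminate for every
  \<open>b\<close>.\<close>

fun radical_inverse :: "nat \<Rightarrow> nat \<Rightarrow> real" where
  "radical_inverse b t =
     (if b < 2 \<or> t = 0 then 0 else (real (t mod b) + radical_inverse b (t div b)) / real b)"

declare radical_inverse.simps [simp del]

lemma radical_inverse_rec:
  assumes "2 \<le> b"
  shows "real b * radical_inverse b t = real (t mod b) + radical_inverse b (t div b)"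
  using assms by (cases "t = 0") (simp_all add: radical_inverse.simps[of b t] radical_inverse.simps[of b 0])

lemma radical_inverse_bounds:
  assumes b: "2 \<le> b"
  shows "0 \<le> radical_inverse b t \<and> radical_inverse b t < 1"
proof (induction t rule: less_induct)
  case (less t)
  show ?case
  proof (cases "t = 0")
    case True
    then show ?thesis by (simp add: radical_inverse.simps)
  next
    case False
    then have IH: "0 \<le> radical_inverse b (t div b)" "radical_inverse b (t div b) < 1"
      using less[of "t div b"] b by auto
    have "t mod b < b" using b by simp
    then have "real (t mod b) \<le> real b - 1" by linarith
    then have "real b * radical_inverse b t < real b * 1" "0 \<le> real b * radical_inverse b t"
      using IH radical_inverse_rec[OF b, of t] by auto
    then show ?thesis
      using b by (auto simp: zero_le_mult_iff)
  qed
qed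

abbreviation radical_cell :: "nat \<Rightarrow> nat \<Rightarrow> nat \<Rightarrow> int" where
  "radical_cell b l t \<equiv> \<lfloor>real b ^ l * radical_inverse b t\<rfloor>"

lemma floor_radical_inverse_Suc:
  assumes b: "2 \<le> b"
  shows "radical_cell b (Suc l) t
           = int (t mod b) * int b ^ l + radical_cell b l (t div b)"
proof -
  have "real b ^ Suc l * radical_inverse b t = real b ^ l * (real b * radical_inverse b t)"
    by simp
  also have "\<dots> = real_of_int (int (t mod b) * int b ^ l) + real b ^ l * radical_inverse b (t div b)"
    unfolding radical_inverse_rec[OF b] by (simp add: algebra_simps)
  finally show ?thesis
    by (metis floor_add_int add.commute)
qed

lemma floor_scaled_bounds:
  fixes z :: real
  assumes "0 \<le> z" "z < 1" "0 < b"
  shows "0 \<le> \<lfloor>real b ^ l * z\<rfloor>" "\<lfloor>real b ^ l * z\<rfloor> < int b ^ l"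
proof -
  have "real b ^ l * z < real b ^ l * 1"
    using assms by (intro mult_strict_left_mono) auto
  then show "\<lfloor>real b ^ l * z\<rfloor> < int b ^ l"
    by (simp add: floor_less_iff)
qed (use assms in auto)

text \<open>The lowest \<open>l\<close> digits of \<open>t\<close> are the leading \<open>l\<close>
  digits of its radical inverse, and these determine the cell. The induction peels off the lowest
  digit of \<open>t\<close>, which becomes the leading digit of the cell index.\<close>

lemma radical_inverse_cell_eq_iff:
  assumes b: "2 \<le> b"
  shows "radical_cell b l t = radical_cell b l s
           \<longleftrightarrow> [t = s] (mod b ^ l)"
proof (induction l arbitrary: t s)
  case 0
  have "\<lfloor>radical_inverse b u\<rfloor> = 0" for u
    using radical_inverse_bounds[OF b, of u] by (simp add: floor_eq_iff)
  then show ?case by simp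
next
  case (Suc l)
  let ?v = "\<lambda>t. radical_cell b l (t div b)"
  have bd: "0 \<le> ?v t" "?v t < int b ^ l" for t
    using floor_scaled_bounds radical_inverse_bounds[OF b] b by auto
  have pos: "0 < int b ^ l" using b by simp
  have div: "(int (t mod b) * int b ^ l + ?v t) div int b ^ l = int (t mod b)" for t
    using bd[of t] pos by (simp add: div_pos_pos_trivial)
  have "radical_cell b (Suc l) t = radical_cell b (Suc l) s
      \<longleftrightarrow> t mod b = s mod b \<and> ?v t = ?v s"
    unfolding floor_radical_inverse_Suc[OF b]
  proof
    assume eq: "int (t mod b) * int b ^ l + ?v t = int (s mod b) * int b ^ l + ?v s"
    then have "t mod b = s mod b"
      using div[of t] div[of s] by simp
    then show "t mod b = s mod b \<and> ?v t = ?v s"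
      using eq by simp
  qed simp
  also have "\<dots> \<longleftrightarrow> t mod b = s mod b \<and> [t div b = s div b] (mod b ^ l)"
    unfolding Suc.IH ..
  also have "\<dots> \<longleftrightarrow> [t = s] (mod b ^ Suc l)"
  proof -
    have "u mod b ^ Suc l = b * (u div b mod b ^ l) + u mod b" for u
      by (simp add: mod_mult2_eq)
    moreover have "(b * x + u = b * y + v) \<longleftrightarrow> (x = y \<and> u = v)" if "u < b" "v < b" for x y u v :: nat
    proof
      assume eq: "b * x + u = b * y + v"
      have "(b * x + u) mod b = u" "(b * x + u) div b = x" "(b * y + v) mod b = v" "(b * y + v) div b = y"
        using that by auto
      then show "x = y \<and> u = v" using eq by metis
    qed auto
    ultimately show ?thesis
      using b by (auto simp: cong_def)
  qed
  finally show ?case .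
qed

text \<open>A pigeonhole argument: the \<open>b ^ l\<close> numbers below \<open>b ^ l\<close>
  occupy pairwise distinct cells, and there are only \<open>b ^ l\<close> cells.\<close>

lemma radical_inverse_cell_nonempty:
  assumes b: "2 \<le> b" and j: "j < b ^ l"
  shows "\<exists>t. radical_cell b l t = int j"
proof -
  let ?g = "\<lambda>t. nat (radical_cell b l t)"
  have bd: "0 \<le> radical_cell b l t" "radical_cell b l t < int b ^ l" for t
    using floor_scaled_bounds radical_inverse_bounds[OF b] b by auto
  have inj: "inj_on ?g {..<b ^ l}"
  proof (rule inj_onI)
    fix t s assume ts: "t \<in> {..<b ^ l}" "s \<in> {..<b ^ l}" "?g t = ?g s"
    then have "radical_cell b l t = radical_cell b l s"
      using bd(1) by (metis nat_eq_iff2 nat_0_le)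
    then show "t = s"
      using ts unfolding radical_inverse_cell_eq_iff[OF b] by (simp add: cong_less_modulus_unique_nat)
  qed
  have sub: "?g ` {..<b ^ l} \<subseteq> {..<b ^ l}"
  proof clarsimp
    fix t :: nat
    show "nat (radical_cell b l t) < b ^ l"
      using bd[of t] by (simp add: nat_less_iff)
  qed
  have "?g ` {..<b ^ l} = {..<b ^ l}"
    using endo_inj_surj[OF _ sub inj] by simp
  then have "j \<in> ?g ` {..<b ^ l}" using j by simp
  then obtain t where "j = ?g t" by (rule imageE)
  then show ?thesis using bd(1)[of t] by (intro exI[of _ t]) auto
qed

text \<open>The class consists of the numbers \<open>c mod M + s * M\<close>; at least
  \<open>N div M\<close> and at most \<open>N div M + 1\<close> of them lie below
  \<open>N\<close>.\<close>

lemma card_cong_class_bounds: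
  fixes M N c :: nat
  assumes M: "0 < M"
  shows "\<bar>real (card {t. t < N \<and> [t = c] (mod M)}) - real N / real M\<bar> \<le> 1"
proof -
  define r where "r = c mod M"
  have r: "r < M" using M by (simp add: r_def)
  let ?S = "{s. r + s * M < N}"
  have eq: "{t. t < N \<and> [t = c] (mod M)} = (\<lambda>s. r + s * M) ` ?S"
  proof (intro equalityI subsetI)
    fix t assume t: "t \<in> {t. t < N \<and> [t = c] (mod M)}"
    then have "t = r + (t div M) * M"
      by (auto simp: cong_def r_def) (metis mod_div_mult_eq)
    then show "t \<in> (\<lambda>s. r + s * M) ` ?S"
      using t by (intro image_eqI[of _ _ "t div M"]) auto
  qed (auto simp: cong_def r_def)
  have inj: "inj_on (\<lambda>s. r + s * M) ?S"
    using M by (auto intro: inj_onI)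
  have up: "?S \<subseteq> {..N div M}"
  proof clarsimp
    fix s assume "r + s * M < N"
    then have "s * M div M \<le> N div M" by (intro div_le_mono) auto
    then show "s \<le> N div M" using M by simp
  qed
  have lo: "{..<N div M} \<subseteq> ?S"
  proof clarsimp
    fix s assume "s < N div M"
    then have "Suc s * M \<le> N div M * M" by (intro mult_right_mono) auto
    also have "\<dots> \<le> N" by simp
    finally show "r + s * M < N" using r by simp
  qed
  have fin: "finite ?S" using up finite_subset by blast
  have c1: "card ?S \<le> N div M + 1" using card_mono[OF _ up] by simp
  have c2: "N div M \<le> card ?S" using card_mono[OF fin lo] by simp
  have d1: "real (N div M) \<le> real N / real M"
    by (rule of_nat_div_le_of_nat)
  have d2: "real N / real M \<le> real (N div M) + 1"
  proof -
    have "N = M * (N div M) + N mod M" by simp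
    then have "N \<le> M * (N div M + 1)" using M mod_less_divisor[OF M, of N] by (simp only: distrib_left mult_1_right)
    then have "real N \<le> real M * (real (N div M) + 1)"
      by (metis of_nat_1 of_nat_add of_nat_le_iff of_nat_mult)
    then show ?thesis using M by (simp add: field_simps)
  qed
  show ?thesis
    unfolding eq card_image[OF inj] using c1 c2 d1 d2 by linarith
qed

lemma exists_coprime_bases:
  "\<exists>b :: 'd::finite \<Rightarrow> nat. (\<forall>i. 2 \<le> b i) \<and> (\<forall>i j. i \<noteq> j \<longrightarrow> coprime (b i) (b j))"
proof -
  \<comment> \<open>Distinct primes are pairwise coprime, and there are enough of them for any
    finite index type.\<close>
  obtain B :: "nat set" where B: "finite B" "card B = CARD('d)" "B \<subseteq> {p. prime p}"
    using infinite_arbitrarily_large[OF primes_infinite] by blast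
  then obtain b where b: "bij_betw b (UNIV :: 'd set) B"
    by (metis finite finite_same_card_bij)
  have pr: "prime (b i)" for i using b B(3) by (auto simp: bij_betw_def)
  have "coprime (b i) (b j)" if "i \<noteq> j" for i j
    using pr that b by (auto intro!: primes_coprime simp: bij_betw_def inj_on_def)
  moreover have "2 \<le> b i" for i using pr prime_ge_2_nat by blast
  ultimately show ?thesis by blast
qed

definition halton :: "('d \<Rightarrow> nat) \<Rightarrow> nat \<Rightarrow> real ^ 'd" where
  "halton b t = (\<chi> i. radical_inverse (b i) t)"

lemma inj_halton:
  assumes b: "\<And>i::'d::finite. 2 \<le> b i"
  shows "inj (halton b)"
proof (rule injI)
  fix t s assume "halton b t = halton b s"
  then have eq: "radical_inverse (b i) t = radical_inverse (b i) s" for i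
    by (metis halton_def vec_lambda_beta)
  fix i :: 'd
  \<comment> \<open>At this level the modulus \<open>b i ^ l\<close> exceeds both \<open>t\<close>
    and \<open>s\<close>, so that congruence forces equality.\<close>
  define l where "l = max t s"
  have "l < b i ^ l"
    using b[of i] by (intro power_gt_expt) auto
  moreover have "[t = s] (mod b i ^ l)"
    using eq[of i] radical_inverse_cell_eq_iff[OF b[of i], of l t s] by simp
  ultimately show "t = s"
    by (simp add: cong_less_modulus_unique_nat l_def)
qed

text \<open>In each coordinate the cell prescribes a residue class modulo \<open>b i ^ l i\<close>.
  As the moduli are coprime, the Chinese remainder theorem merges these classes into a single one
  modulo their product.\<close>

lemma card_halton_box:
  fixes b :: "'d::finite \<Rightarrow> nat"
  assumes b: "\<And>i. 2 \<le> b i" and cop: "\<And>i j. i \<noteq> j \<Longrightarrow> coprime (b i) (b j)"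
    and j: "\<And>i. j i < b i ^ l i"
  shows "\<bar>real (card {z \<in> halton b ` {..<N}. \<forall>i. \<lfloor>real (b i) ^ l i * z $ i\<rfloor> = int (j i)})
            - real N / (\<Prod>i\<in>UNIV. real (b i) ^ l i)\<bar> \<le> 1"
proof -
  have "\<forall>i. \<exists>t. radical_cell (b i) (l i) t = int (j i)"
    using radical_inverse_cell_nonempty[OF b j] by blast
  then obtain u where u: "\<And>i. radical_cell (b i) (l i) (u i) = int (j i)"
    by metis
  have cop': "coprime (b i ^ l i) (b k ^ l k)" if "i \<noteq> k" for i k
    using cop[OF that] by simp
  obtain c where c: "\<And>i. [c = u i] (mod b i ^ l i)"
    using chinese_remainder_nat[of UNIV "\<lambda>i. b i ^ l i" u] cop' by auto
  have iff: "radical_cell (b i) (l i) t = int (j i) \<longleftrightarrow> [t = c] (mod b i ^ l i)" for i t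
    using radical_inverse_cell_eq_iff[OF b, of i "l i" t c]
      radical_inverse_cell_eq_iff[OF b, of i "l i" c "u i"] u[of i] c[of i] by simp
  have all: "(\<forall>i. [t = c] (mod b i ^ l i)) \<longleftrightarrow> [t = c] (mod (\<Prod>i\<in>UNIV. b i ^ l i))" for t
  proof
    assume "\<forall>i. [t = c] (mod b i ^ l i)"
    then show "[t = c] (mod (\<Prod>i\<in>UNIV. b i ^ l i))"
      using cop' by (intro coprime_cong_prod_nat) auto
  next
    assume "[t = c] (mod (\<Prod>i\<in>UNIV. b i ^ l i))"
    then show "\<forall>i. [t = c] (mod b i ^ l i)"
      by (meson UNIV_I cong_dvd_modulus_nat dvd_prodI finite)
  qed
  have "{z \<in> halton b ` {..<N}. \<forall>i. \<lfloor>real (b i) ^ l i * z $ i\<rfloor> = int (j i)}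
      = halton b ` {t. t < N \<and> [t = c] (mod (\<Prod>i\<in>UNIV. b i ^ l i))}"
    unfolding all[symmetric] iff[symmetric] by (auto simp: halton_def)
  moreover have "card (halton b ` T) = card T" for T
    using inj_halton[of b] b by (intro card_image) (auto intro: inj_on_subset)
  moreover have "0 < (\<Prod>i\<in>UNIV. b i ^ l i)"
    using b by (intro prod_pos) (metis less_le_trans pos2 zero_less_power)
  ultimately show ?thesis
    using card_cong_class_bounds[of "\<Prod>i\<in>UNIV. b i ^ l i" N c] by simp
qed

section \<open>Averages over cells in one variable\<close>

text \<open>The integral of \<open>1 / (1 + (K * (y - s))\<^sup>2)\<close> over \<open>s\<close> in
  \<open>{a..b}\<close>: the mass that a Cauchy bump of width \<open>1 / K\<close> around
  \<open>y\<close> puts on the interval. The closed form makes additivity in the interval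
  immediate.\<close>

definition theta :: "real \<Rightarrow> real \<Rightarrow> real \<Rightarrow> real \<Rightarrow> real" where
  "theta K a b y = (arctan (K * (y - a)) - arctan (K * (y - b))) / K"

lemma theta_has_integral:
  assumes "0 < K" "a \<le> b"
  shows "((\<lambda>s. 1 / (1 + (K * (y - s))\<^sup>2)) has_integral theta K a b y) {a..b}"
proof -
  have "((\<lambda>s. 1 / (1 + (K * (y - s))\<^sup>2)) has_integral
      (- arctan (K * (y - b)) / K) - (- arctan (K * (y - a)) / K)) {a..b}"
  proof (intro fundamental_theorem_of_calculus)
    fix s assume "s \<in> {a..b}"
    have "((\<lambda>s. - arctan (K * (y - s)) / K) has_real_derivative
        - (inverse (1 + (K * (y - s))\<^sup>2) * (K * (0 - 1))) / K) (at s within {a..b})"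
      by (rule derivative_eq_intros refl | use assms in simp)+
    then show "((\<lambda>s. - arctan (K * (y - s)) / K) has_vector_derivative
        1 / (1 + (K * (y - s))\<^sup>2)) (at s within {a..b})"
      using assms by (simp add: has_real_derivative_iff_has_vector_derivative[symmetric] inverse_eq_divide)
  qed (use assms in auto)
  then show ?thesis
    by (simp add: theta_def diff_divide_distrib)
qed

lemma theta_add: "theta K a b y + theta K b c y = theta K a c y"
  by (simp add: theta_def diff_divide_distrib)

lemma theta_nonneg:
  assumes "0 < K" "a \<le> b"
  shows "0 \<le> theta K a b y"
  using assms by (simp add: theta_def arctan_le_iff mult_left_mono)

lemma theta_le:
  assumes "0 < K"
  shows "theta K a b y \<le> 4 / K"
proof -
  have "arctan (K * (y - a)) \<le> pi / 2" "- (pi / 2) \<le> arctan (K * (y - b))"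
    using arctan_bounded[of "K * (y - a)"] arctan_bounded[of "K * (y - b)"] by linarith+
  then have "arctan (K * (y - a)) - arctan (K * (y - b)) \<le> 4"
    using pi_less_4 by linarith
  then show ?thesis
    using assms by (simp add: theta_def divide_right_mono)
qed

lemma theta_mono:
  assumes "0 < K" "a' \<le> a" "a \<le> b" "b \<le> b'"
  shows "theta K a b y \<le> theta K a' b' y"
  using theta_nonneg[of K a' a y] theta_nonneg[of K b b' y] theta_add[of K a' a y b]
    theta_add[of K a' b y b'] assms by simp

lemma theta_le_sup:
  assumes "0 < K" "a \<le> b" "\<And>s. s \<in> {a..b} \<Longrightarrow> 1 / (1 + (K * (y - s))\<^sup>2) \<le> B"
  shows "theta K a b y \<le> (b - a) * B"
  using has_integral_le[OF theta_has_integral[OF assms(1,2)] has_integral_const_real[of B a b]] assms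
  by simp

lemma theta_ge_inf:
  assumes "0 < K" "a \<le> b" "\<And>s. s \<in> {a..b} \<Longrightarrow> B \<le> 1 / (1 + (K * (y - s))\<^sup>2)"
  shows "(b - a) * B \<le> theta K a b y"
  using has_integral_le[OF has_integral_const_real[of B a b] theta_has_integral[OF assms(1,2)]] assms
  by simp

lemma theta_measurable [measurable]: "theta K a b \<in> borel_measurable borel"
  unfolding theta_def by measurable

lemma sum_theta_cells:
  "(\<Sum>j<n. theta K (real j / M) ((real j + 1) / M) y) = theta K 0 (real n / M) y"
  by (induction n) (simp_all add: theta_add add.commute, simp add: theta_def)

lemma nn_integral_cauchy_kernel:
  assumes "0 < K"
  shows "(\<integral>\<^sup>+y. ennreal (1 / (1 + (K * (y - s))\<^sup>2)) \<partial>lborel) \<le> ennreal (4 / K)"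
proof -
  let ?f = "\<lambda>x::real. 1 / (1 + x\<^sup>2)"
  have half: "(\<integral>\<^sup>+x. ennreal (?f x) * indicator {0..} x \<partial>lborel) = ennreal (pi / 2)"
    using nn_integral_FTC_atLeast[of ?f 0 arctan "pi / 2"] tendsto_arctan_at_top DERIV_arctan
    by (auto simp: inverse_eq_divide)
  have half': "(\<integral>\<^sup>+x. ennreal (?f x) * indicator {..0} x \<partial>lborel) = ennreal (pi / 2)"
  proof -
    have "(\<integral>\<^sup>+x. ennreal (?f x) * indicator {..0} x \<partial>lborel)
        = (\<integral>\<^sup>+x. ennreal (?f (0 + (-1) * x)) * indicator {..0} (0 + (-1) * x) \<partial>lborel)"
      using nn_integral_real_affine[of "\<lambda>x. ennreal (?f x) * indicator {..0} x" "-1" 0] by simp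
    also have "\<dots> = (\<integral>\<^sup>+x. ennreal (?f x) * indicator {0..} x \<partial>lborel)"
      by (intro nn_integral_cong) (auto simp: indicator_def)
    finally show ?thesis using half by simp
  qed
  \<comment> \<open>Both half-lines contain 0, so the split is an inequality.\<close>
  have "(\<integral>\<^sup>+x. ennreal (?f x) \<partial>lborel)
      \<le> (\<integral>\<^sup>+x. ennreal (?f x) * indicator {0..} x + ennreal (?f x) * indicator {..0} x \<partial>lborel)"
    by (intro nn_integral_mono) (auto simp: indicator_def)
  also have "\<dots> = ennreal (pi / 2) + ennreal (pi / 2)"
    by (subst nn_integral_add) (auto simp: half half')
  also have "\<dots> = ennreal pi"
    by (simp flip: ennreal_plus)
  finally have le: "(\<integral>\<^sup>+x. ennreal (?f x) \<partial>lborel) \<le> ennreal pi" .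
  have "(\<integral>\<^sup>+x. ennreal (?f x) \<partial>lborel)
      = ennreal K * (\<integral>\<^sup>+y. ennreal (?f (K * (y - s))) \<partial>lborel)"
    using nn_integral_real_affine[of "\<lambda>x. ennreal (?f x)" K "- K * s"] assms
    by (simp add: algebra_simps)
  then have "ennreal K * (\<integral>\<^sup>+y. ennreal (?f (K * (y - s))) \<partial>lborel) \<le> ennreal 4"
    using le order_trans[OF _ ennreal_leI[of pi 4]] pi_less_4 by simp
  then have "ennreal (1 / K) * (ennreal K * (\<integral>\<^sup>+y. ennreal (?f (K * (y - s))) \<partial>lborel))
      \<le> ennreal (1 / K) * ennreal 4"
    by (rule mult_left_mono) simp
  moreover have "ennreal (1 / K) * ennreal 4 = ennreal (4 / K)"
    using assms by (subst ennreal_mult[symmetric]) auto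
  ultimately show ?thesis
    using assms by (simp add: mult.assoc[symmetric] flip: ennreal_mult)
qed

text \<open>By Tonelli's theorem the integral in \<open>y\<close> may be taken first, and then every
  \<open>s\<close> in the interval contributes at most \<open>4 / K\<close>.\<close>

lemma nn_integral_theta:
  assumes "0 < K" "a \<le> b"
  shows "(\<integral>\<^sup>+y. ennreal (theta K a b y) \<partial>lborel) \<le> ennreal (4 * (b - a) / K)"
proof -
  let ?w = "\<lambda>y s. ennreal (1 / (1 + (K * (y - s))\<^sup>2))"
  have eq: "ennreal (theta K a b y) = (\<integral>\<^sup>+s. ?w y s * indicator {a..b} s \<partial>lborel)" for y
  proof -
    have "(\<integral>\<^sup>+s. ennreal (1 / (1 + (K * (y - s))\<^sup>2)) * indicator {a..b} s \<partial>lborel) = ennreal (theta K a b y)"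
      by (rule nn_integral_has_integral_lebesgue'[OF _ theta_has_integral[OF assms]]) auto
    then show ?thesis ..
  qed
  have "(\<integral>\<^sup>+y. ennreal (theta K a b y) \<partial>lborel)
      = (\<integral>\<^sup>+s. (\<integral>\<^sup>+y. ?w y s * indicator {a..b} s \<partial>lborel) \<partial>lborel)"
    unfolding eq by (rule lborel_pair.Fubini') measurable
  also have "\<dots> = (\<integral>\<^sup>+s. (\<integral>\<^sup>+y. ?w y s \<partial>lborel) * indicator {a..b} s \<partial>lborel)"
    by (simp add: nn_integral_multc)
  also have "\<dots> \<le> (\<integral>\<^sup>+s. ennreal (4 / K) * indicator {a..b} s \<partial>lborel)"
    using nn_integral_cauchy_kernel[OF assms(1)] by (intro nn_integral_mono mult_right_mono) auto
  also have "\<dots> = ennreal (4 * (b - a) / K)"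
    using assms by (simp add: nn_integral_cmult_indicator flip: ennreal_mult)
  finally show ?thesis .
qed

section \<open>Cells, cell means and martingale differences\<close>

definition cell :: "nat \<Rightarrow> nat \<Rightarrow> nat \<Rightarrow> real set" where
  "cell b l j = {real j / real b ^ l..(real j + 1) / real b ^ l}"

text \<open>Cells are closed and neighbours share an endpoint; the floor assigns a shared endpoint
  to the cell on its right.\<close>

definition cell_index :: "nat \<Rightarrow> nat \<Rightarrow> real \<Rightarrow> nat" where
  "cell_index b l z = nat \<lfloor>real b ^ l * z\<rfloor>"

definition cell_mean :: "nat \<Rightarrow> (real \<Rightarrow> complex) \<Rightarrow> nat \<Rightarrow> nat \<Rightarrow> complex" where
  "cell_mean b h l j = real b ^ l *\<^sub>R integral (cell b l j) h"

text \<open>The martingale difference between the levels \<open>l - 1\<close> and \<open>l\<close>,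
  where \<open>j div b\<close> is the parent of the cell \<open>j\<close>. At level 0 it is the mean
  itself, so that the differences telescope.\<close>

definition mean_diff :: "nat \<Rightarrow> (real \<Rightarrow> complex) \<Rightarrow> nat \<Rightarrow> nat \<Rightarrow> complex" where
  "mean_diff b h l j = cell_mean b h l j - (if l = 0 then 0 else cell_mean b h (l - 1) (j div b))"

text \<open>The level \<open>L\<close> collects everything finer than the means of level \<open>L - 1\<close>.\<close>

definition detail :: "nat \<Rightarrow> nat \<Rightarrow> (real \<Rightarrow> complex) \<Rightarrow> nat \<Rightarrow> real \<Rightarrow> complex" where
  "detail b L h l z =
     (if l < L then mean_diff b h l (cell_index b l z)
      else h z - cell_mean b h (l - 1) (cell_index b (l - 1) z))"

lemma cell_index_less:
  assumes "0 < b" "0 \<le> z" "z < 1"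
  shows "cell_index b l z < b ^ l"
proof -
  have "real b ^ l * z < real b ^ l * 1"
    using assms by (intro mult_strict_left_mono) auto
  then have "\<lfloor>real b ^ l * z\<rfloor> < int (b ^ l)"
    by (simp add: floor_less_iff)
  then show ?thesis
    using assms unfolding cell_index_def by (subst nat_less_iff) auto
qed

lemma mem_cell_index:
  assumes "0 < b" "0 \<le> z"
  shows "z \<in> cell b l (cell_index b l z)"
proof -
  have "real (cell_index b l z) = real_of_int \<lfloor>real b ^ l * z\<rfloor>"
    using assms by (simp add: cell_index_def)
  then have "real (cell_index b l z) \<le> real b ^ l * z" "real b ^ l * z \<le> real (cell_index b l z) + 1"
    by linarith+
  then show ?thesis
    using assms by (simp add: cell_def field_simps)
qed

text \<open>Passing to the ancestor of level \<open>m\<close> drops the last \<open>l - m\<close>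
  digits of the index, because the floor of a quotient by a positive integer is the
  \<open>div\<close> of the floor.\<close>

lemma cell_index_div:
  assumes "0 < b" "0 \<le> z" "m \<le> l"
  shows "cell_index b l z div b ^ (l - m) = cell_index b m z"
proof -
  have "real b ^ l = real b ^ m * real (b ^ (l - m))"
    using assms by (simp flip: power_add)
  then have "real b ^ l * z / real (b ^ (l - m)) = real b ^ m * z"
    using assms by simp
  then have "\<lfloor>real b ^ m * z\<rfloor> = \<lfloor>real b ^ l * z\<rfloor> div int (b ^ (l - m))"
    by (metis floor_divide_real_eq_div of_int_of_nat_eq of_nat_0_le_iff)
  then show ?thesis
    using assms by (simp add: cell_index_def nat_div_distrib nat_power_eq)
qed

lemma cell_subset_parent:
  assumes "0 < b" "m \<le> l"
  shows "cell b l j \<subseteq> cell b m (j div b ^ (l - m))"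
proof -
  define q where "q = b ^ (l - m)"
  have q: "0 < q" using assms by (simp add: q_def)
  have eq: "real b ^ l = real b ^ m * real q"
    using assms by (simp add: q_def flip: power_add)
  have "j = q * (j div q) + j mod q" by simp
  moreover have "j mod q < q" using q by simp
  ultimately have "q * (j div q) \<le> j" "j + 1 \<le> q * (j div q) + q" by linarith+
  then have "real (q * (j div q)) \<le> real j" "real (j + 1) \<le> real (q * (j div q) + q)"
    by (simp_all only: of_nat_le_iff)
  then have le: "real q * real (j div q) \<le> real j" "real j + 1 \<le> real q * (real (j div q) + 1)"
    by (simp_all add: algebra_simps)
  have pos: "0 < real b ^ m" "0 < real q" using assms q by auto
  have "real (j div q) / real b ^ m = real q * real (j div q) / (real b ^ m * real q)"
    using pos by simp
  also have "\<dots> \<le> real j / (real b ^ m * real q)"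
    using le pos by (intro divide_right_mono) auto
  finally have 1: "real (j div q) / real b ^ m \<le> real j / real b ^ l"
    unfolding eq .
  have "(real j + 1) / (real b ^ m * real q) \<le> real q * (real (j div q) + 1) / (real b ^ m * real q)"
    using le pos by (intro divide_right_mono) auto
  also have "\<dots> = (real (j div q) + 1) / real b ^ m"
    using pos by simp
  finally show ?thesis
    using 1 unfolding cell_def q_def[symmetric] eq[symmetric] by auto
qed

lemma cell_subset_unit:
  assumes "0 < b" "j < b ^ l"
  shows "cell b l j \<subseteq> {0..1}"
proof -
  have "j div b ^ l = 0" using assms by simp
  then show ?thesis
    using cell_subset_parent[of b 0 l j] assms by (simp add: cell_def)
qed

lemma sum_div_group:
  fixes g :: "nat \<Rightarrow> 'a::comm_semiring_1"
  assumes "0 < (b::nat)"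
  shows "(\<Sum>j<n * b. g (j div b)) = of_nat b * (\<Sum>j<n. g j)"
proof -
  have "(\<Sum>j<n * b. g (j div b)) = (\<Sum>m<n. \<Sum>j\<in>{m * b..<m * b + b}. g (j div b))"
    by (rule sum.nat_group[symmetric])
  also have "\<dots> = (\<Sum>m<n. \<Sum>j\<in>{m * b..<m * b + b}. g m)"
  proof (intro sum.cong refl)
    fix m j assume "j \<in> {m * b..<m * b + b}"
    then have "j div b = m"
      using assms by (intro div_nat_eqI) (auto simp: algebra_simps)
    then show "g (j div b) = g m" by simp
  qed
  finally show ?thesis
    by (simp add: sum_distrib_left)
qed

lemma sum_cell_integral:
  fixes h :: "real \<Rightarrow> complex"
  assumes b: "0 < b" and cont: "continuous_on {0..1} h"
  shows "(\<Sum>j<b ^ l. integral (cell b l j) h) = integral {0..1} h"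
proof -
  have pos: "0 < real b ^ l" using b by simp
  have "(\<Sum>j<n. integral (cell b l j) h) = integral {0..real n / real b ^ l} h" if "n \<le> b ^ l" for n
    using that
  proof (induction n)
    case (Suc n)
    have "real (Suc n) \<le> real (b ^ l)" using Suc.prems by (simp only: of_nat_le_iff)
    then have le: "(real n + 1) / real b ^ l \<le> 1" using pos by (simp add: field_simps)
    have "integral {0..real n / real b ^ l} h + integral {real n / real b ^ l..(real n + 1) / real b ^ l} h
        = integral {0..(real n + 1) / real b ^ l} h"
    proof (rule Henstock_Kurzweil_Integration.integral_combine)
      show "h integrable_on {0..(real n + 1) / real b ^ l}"
        using le by (intro integrable_continuous_real continuous_on_subset[OF cont]) auto
    qed (use pos in \<open>auto simp: divide_right_mono\<close>)
    then show ?case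
      using Suc by (simp add: cell_def add.commute)
  qed simp
  from this[of "b ^ l"] show ?thesis
    using b by simp
qed

lemma sum_cell_mean:
  assumes "0 < b" "continuous_on {0..1} h"
  shows "(\<Sum>j<b ^ l. cell_mean b h l j) = real b ^ l *\<^sub>R integral {0..1} h"
  unfolding cell_mean_def scaleR_sum_right[symmetric] sum_cell_integral[OF assms] ..

text \<open>Every parent has \<open>b\<close> children, so both sums of means equal
  \<open>b ^ l\<close> times the integral. This cancellation later allows the expected box count to
  be subtracted from the true one.\<close>

lemma sum_mean_diff:
  assumes "0 < b" "continuous_on {0..1} h" "0 < l"
  shows "(\<Sum>j<b ^ l. mean_diff b h l j) = 0"
proof -
  obtain m where l: "l = Suc m" using assms(3) gr0_implies_Suc by blast
  have "(\<Sum>j<b ^ l. cell_mean b h m (j div b)) = of_nat b * (\<Sum>j<b ^ m. cell_mean b h m j)"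
    using sum_div_group[OF assms(1), of "cell_mean b h m" "b ^ m"] by (simp add: l mult.commute)
  then show ?thesis
    using sum_cell_mean[OF assms(1,2), of l] sum_cell_mean[OF assms(1,2), of m]
    by (simp add: mean_diff_def l sum_subtractf scaleR_conv_of_real)
qed

lemma mean_diff_0: "mean_diff b h 0 0 = integral {0..1} h"
  by (simp add: mean_diff_def cell_mean_def cell_def)

text \<open>The martingale differences below level \<open>L\<close> telescope to the mean of level
  \<open>L - 1\<close>, and level \<open>L\<close> adds the remainder.\<close>

lemma sum_detail:
  assumes "0 < L" "0 < b" "0 \<le> z"
  shows "(\<Sum>l\<le>L. detail b L h l z) = h z"
proof -
  have par: "cell_index b (Suc m) z div b = cell_index b m z" for m
    using cell_index_div[of b z m "Suc m"] assms by simp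
  have "(\<Sum>l<n. mean_diff b h l (cell_index b l z)) = cell_mean b h (n - 1) (cell_index b (n - 1) z)"
    if "0 < n" for n
    using that
  proof (induction n)
    case (Suc n)
    show ?case
      by (cases n) (use Suc in \<open>auto simp: mean_diff_def par\<close>)
  qed simp
  from this[OF assms(1)] show ?thesis
    by (simp add: lessThan_Suc_atMost[symmetric] detail_def)
qed

lemma norm_cell_mean_diff_le:
  fixes h :: "real \<Rightarrow> complex"
  assumes "0 < b" "h integrable_on cell b l j" "\<And>x. x \<in> cell b l j \<Longrightarrow> norm (h x - c) \<le> B"
  shows "norm (cell_mean b h l j - c) \<le> B"
proof -
  have pos: "0 < real b ^ l" using assms by simp
  have le: "real j / real b ^ l \<le> (real j + 1) / real b ^ l"
    using pos by (simp add: divide_right_mono)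
  have int: "(h has_integral integral (cell b l j) h) (cell b l j)"
    using assms(2) by (rule integrable_integral)
  have "((\<lambda>x. h x - c) has_integral
      integral (cell b l j) h - ((real j + 1) / real b ^ l - real j / real b ^ l) *\<^sub>R c) (cell b l j)"
    using has_integral_diff[OF int has_integral_const_real[of c "real j / real b ^ l" "(real j + 1) / real b ^ l",
      folded cell_def]] le by (simp add: cell_def)
  moreover have "norm (h (real j / real b ^ l) - c) \<le> B"
    using le by (intro assms(3)) (simp add: cell_def)
  then have "0 \<le> B" using norm_ge_zero order_trans by blast
  ultimately have "norm (integral (cell b l j) h - ((real j + 1) / real b ^ l - real j / real b ^ l) *\<^sub>R c)
      \<le> B * ((real j + 1) / real b ^ l - real j / real b ^ l)"
    using has_integral_bound_real[of B "{}", OF _ finite.emptyI] assms(3) le unfolding cell_def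
    by (metis content_real Diff_empty)
  then have "norm (integral (cell b l j) h - (1 / real b ^ l) *\<^sub>R c) \<le> B * (1 / real b ^ l)"
    by (simp add: add_divide_distrib)
  then have "real b ^ l * norm (integral (cell b l j) h - (1 / real b ^ l) *\<^sub>R c) \<le> B"
    using pos by (simp add: field_simps)
  moreover have "cell_mean b h l j - c = real b ^ l *\<^sub>R (integral (cell b l j) h - (1 / real b ^ l) *\<^sub>R c)"
    using assms(1) by (simp add: cell_mean_def scaleR_diff_right)
  ultimately show ?thesis
    using pos by simp
qed

section \<open>Majorants of the martingale differences\<close>

definition cell_theta :: "nat \<Rightarrow> real \<Rightarrow> nat \<Rightarrow> nat \<Rightarrow> real \<Rightarrow> real" where
  "cell_theta b K l j = theta K (real j / real b ^ l) ((real j + 1) / real b ^ l)"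

text \<open>A bound for the martingale differences: by their size at scales coarser than \<open>1 / K\<close>, by the
  oscillation on the parent cell at finer scales. At \<open>l = 0\<close>, \<open>j = 0\<close> the truncated subtraction
  makes the parent the cell itself, which only adds a nonnegative term.\<close>

definition majorant :: "nat \<Rightarrow> real \<Rightarrow> real \<Rightarrow> nat \<Rightarrow> nat \<Rightarrow> real \<Rightarrow> real" where
  "majorant b K C l j y =
     (if real b ^ l \<le> K
      then C * (real b ^ l * cell_theta b K l j y + theta K 0 2 y
             + (real b ^ (l - 1) * cell_theta b K (l - 1) (j div b) y + theta K 0 2 y))
      else C * K * cell_theta b K (l - 1) (j div b) y)"

lemma cell_theta_nonneg: "0 < K \<Longrightarrow> 0 \<le> cell_theta b K l j y"
  unfolding cell_theta_def by (intro theta_nonneg) (auto simp: divide_right_mono)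

lemma cell_theta_measurable [measurable]: "cell_theta b K l j \<in> borel_measurable borel"
  unfolding cell_theta_def by measurable

lemma majorant_measurable [measurable]: "majorant b K C l j \<in> borel_measurable borel"
  unfolding majorant_def by measurable

lemma majorant_nonneg: "\<lbrakk>0 < K; 0 \<le> C\<rbrakk> \<Longrightarrow> 0 \<le> majorant b K C l j y"
  unfolding majorant_def by (auto intro!: mult_nonneg_nonneg add_nonneg_nonneg cell_theta_nonneg theta_nonneg)

lemma sum_cell_theta:
  assumes "0 < b"
  shows "(\<Sum>j<b ^ l. cell_theta b K l j y) = theta K 0 1 y"
  using sum_theta_cells[where n = "b ^ l" and M = "real b ^ l"] assms by (simp add: cell_theta_def)

lemma sum_cell_theta_parent:
  assumes "0 < b" "0 < l"
  shows "(\<Sum>j<b ^ l. cell_theta b K (l - 1) (j div b) y) = real b * theta K 0 1 y"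
proof -
  obtain m where l: "l = Suc m" using assms(2) gr0_implies_Suc by blast
  show ?thesis
    using sum_div_group[OF assms(1), of "\<lambda>j. cell_theta b K m j y" "b ^ m"] sum_cell_theta[OF assms(1), of K m y]
    by (simp add: l mult.commute)
qed

text \<open>The masses of the cells of one level add up to \<open>theta K 0 1 y\<close>, at most
  \<open>4 / K\<close>. Coarse levels thus give \<open>16 * C * b ^ l / K\<close>, and fine levels,
  where each parent is counted \<open>b\<close> times, give \<open>4 * b * C\<close>. The constant
  24 is shared with the bound of the integral in \<open>y\<close>.\<close>

lemma sum_majorant_le:
  assumes b: "2 \<le> b" and K: "1 \<le> K" and C: "0 \<le> C"
  shows "(\<Sum>j<b ^ l. majorant b K C l j y) \<le> 24 * real b * C * min 1 (real b ^ l / K)"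
proof (cases "real b ^ l \<le> K")
  case True
  have b0: "0 < b" using b by simp
  have th: "theta K 0 1 y \<le> 4 / K" "theta K 0 2 y \<le> 4 / K"
    using theta_le K by auto
  have par: "(\<Sum>j<b ^ l. real b ^ (l - 1) * cell_theta b K (l - 1) (j div b) y) \<le> real b ^ l * theta K 0 1 y"
  proof (cases "l = 0")
    case True
    then show ?thesis by (simp add: cell_theta_def)
  next
    case False
    then obtain m where "l = Suc m" using not0_implies_Suc by blast
    then show ?thesis
      using sum_cell_theta_parent[OF b0, of l K y] by (simp flip: sum_distrib_left)
  qed
  have "(\<Sum>j<b ^ l. majorant b K C l j y) =
      C * (real b ^ l * theta K 0 1 y + real b ^ l * theta K 0 2 y
        + ((\<Sum>j<b ^ l. real b ^ (l - 1) * cell_theta b K (l - 1) (j div b) y) + real b ^ l * theta K 0 2 y))"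
    using True sum_cell_theta[OF b0, of K l y]
    by (simp add: majorant_def sum.distrib flip: sum_distrib_left)
  also have "\<dots> \<le> C * (real b ^ l * (4 / K) + real b ^ l * (4 / K) + (real b ^ l * (4 / K) + real b ^ l * (4 / K)))"
    using th par C by (intro mult_left_mono add_mono order_trans[OF par] mult_left_mono) auto
  also have "\<dots> = C * (real b ^ l / K) * 16" by simp
  also have "\<dots> \<le> C * (real b ^ l / K) * (24 * real b)"
    using b C K by (intro mult_left_mono) auto
  also have "\<dots> = 24 * real b * C * min 1 (real b ^ l / K)"
    using True K by (subst min_absorb2) (auto simp: mult_ac)
  finally show ?thesis .
next
  case False
  then have l: "0 < l" using K by (cases l) auto
  have b0: "0 < b" using b by simp
  have "(\<Sum>j<b ^ l. majorant b K C l j y) = C * K * (real b * theta K 0 1 y)"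
    using False sum_cell_theta_parent[OF b0 l, of K y] by (simp add: majorant_def flip: sum_distrib_left)
  also have "\<dots> \<le> C * K * (real b * (4 / K))"
    using theta_le K C by (intro mult_left_mono) auto
  also have "\<dots> = C * real b * 4" using K by simp
  also have "\<dots> \<le> C * real b * 24" using C by (intro mult_left_mono) auto
  finally show ?thesis
    using False K by (simp add: min_def mult_ac field_simps)
qed

lemma nn_integral_cell_theta:
  assumes "0 < b" "0 < K"
  shows "(\<integral>\<^sup>+y. ennreal (cell_theta b K l j y) \<partial>lborel) \<le> ennreal (4 / (real b ^ l * K))"
proof -
  have le: "real j / real b ^ l \<le> (real j + 1) / real b ^ l" by (simp add: divide_right_mono)
  have "4 * ((real j + 1) / real b ^ l - real j / real b ^ l) / K = 4 / (real b ^ l * K)"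
    by (simp add: add_divide_distrib)
  then show ?thesis
    using nn_integral_theta[OF assms(2) le] by (simp add: cell_theta_def)
qed

text \<open>At coarse levels each scaled cell mass integrates to at most \<open>4 / K\<close> and
  each constant part to at most \<open>8 / K\<close>, altogether \<open>24 / K\<close>. At fine
  levels the factor \<open>C * K\<close> meets a parent cell of length
  \<open>b / b ^ l\<close>.\<close>

lemma nn_integral_majorant_le:
  assumes b: "2 \<le> b" and K: "1 \<le> K" and C: "0 \<le> C"
  shows "(\<integral>\<^sup>+y. ennreal (majorant b K C l j y) \<partial>lborel) \<le> ennreal (24 * real b * C / max (real b ^ l) K)"
proof (cases "real b ^ l \<le> K")
  case True
  have b0: "0 < b" "0 < K" using b K by simp_all
  note nn = cell_theta_nonneg[OF b0(2)] theta_nonneg[OF b0(2)]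
  have ct: "(\<integral>\<^sup>+y. ennreal (real b ^ m * cell_theta b K m i y) \<partial>lborel) \<le> ennreal (4 / K)" for m i
  proof -
    have "(\<integral>\<^sup>+y. ennreal (real b ^ m * cell_theta b K m i y) \<partial>lborel)
        = ennreal (real b ^ m) * (\<integral>\<^sup>+y. ennreal (cell_theta b K m i y) \<partial>lborel)"
      by (simp add: ennreal_mult' nn_integral_cmult)
    also have "\<dots> \<le> ennreal (real b ^ m) * ennreal (4 / (real b ^ m * K))"
      by (intro mult_left_mono nn_integral_cell_theta b0) simp
    also have "\<dots> = ennreal (4 / K)"
      using b0 by (simp flip: ennreal_mult)
    finally show ?thesis .
  qed
  have t2: "(\<integral>\<^sup>+y. ennreal (theta K 0 2 y) \<partial>lborel) \<le> ennreal (8 / K)"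
    using nn_integral_theta[OF b0(2), of 0 2] by simp
  have "(\<integral>\<^sup>+y. ennreal (majorant b K C l j y) \<partial>lborel)
      = ennreal C * ((\<integral>\<^sup>+y. ennreal (real b ^ l * cell_theta b K l j y) \<partial>lborel) + (\<integral>\<^sup>+y. ennreal (theta K 0 2 y) \<partial>lborel)
        + ((\<integral>\<^sup>+y. ennreal (real b ^ (l - 1) * cell_theta b K (l - 1) (j div b) y) \<partial>lborel) + (\<integral>\<^sup>+y. ennreal (theta K 0 2 y) \<partial>lborel)))"
    using True nn C by (simp add: majorant_def ennreal_mult' nn_integral_cmult nn_integral_add)
      (simp only: mult_2 add_ac)
  also have "\<dots> \<le> ennreal C * (ennreal (4 / K) + ennreal (8 / K) + (ennreal (4 / K) + ennreal (8 / K)))"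
    by (intro mult_left_mono add_mono ct t2) simp
  also have "\<dots> = ennreal (24 * C / K)"
    using C b0 by (simp flip: ennreal_plus ennreal_mult)
  also have "\<dots> \<le> ennreal (24 * real b * C / K)"
    using b C b0 by (intro ennreal_leI divide_right_mono mult_right_mono) auto
  finally show ?thesis
    using True by (simp add: max_def)
next
  case False
  then have l: "0 < l" using K by (cases l) auto
  have b0: "0 < b" "0 < K" using b K by simp_all
  have pw: "real b ^ l = real b * real b ^ (l - 1)"
    using l by (simp add: power_eq_if)
  have "(\<integral>\<^sup>+y. ennreal (majorant b K C l j y) \<partial>lborel)
      = ennreal (C * K) * (\<integral>\<^sup>+y. ennreal (cell_theta b K (l - 1) (j div b) y) \<partial>lborel)"
    using False C b0 by (simp add: majorant_def ennreal_mult' nn_integral_cmult)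
  also have "\<dots> \<le> ennreal (C * K) * ennreal (4 / (real b ^ (l - 1) * K))"
    by (intro mult_left_mono nn_integral_cell_theta b0) simp
  also have "\<dots> = ennreal (4 * real b * C / real b ^ l)"
    using C b0 by (subst ennreal_mult[symmetric]) (auto simp: pw field_simps)
  also have "\<dots> \<le> ennreal (24 * real b * C / real b ^ l)"
    using C b0 by (intro ennreal_leI divide_right_mono mult_right_mono) auto
  finally show ?thesis
    using False by (simp add: max_def)
qed

text \<open>Cells much finer than \<open>1 / K\<close> may contain no point at all, so that points are counted in the
  cells of a coarser level \<open>m\<close> with side length about \<open>1 / min (b ^ l) K\<close>.\<close>

lemma majorant_coarse:
  assumes b: "2 \<le> b" and K: "1 \<le> K" and C: "0 \<le> C"
  obtains m S where "m \<le> l" "min (real b ^ l) K \<le> b * real b ^ m" "\<And>i. 0 \<le> S i"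
    "\<And>j. majorant b K C l j y \<le> S (j div b ^ (l - m))"
    "(\<Sum>i<b ^ m. S i) \<le> 24 * real b * C * (min (real b ^ l) K / max (real b ^ l) K)"
proof (cases "real b ^ l \<le> K")
  case True
  have mm: "min 1 (real b ^ l / K) = min (real b ^ l) K / max (real b ^ l) K"
    using True K by (simp add: min_absorb1 min_absorb2 max_absorb2)
  show thesis
  proof (rule that[of l "\<lambda>j. majorant b K C l j y"])
    show "min (real b ^ l) K \<le> b * real b ^ l"
      using True b by (simp add: mult_le_cancel_right1)
    show "(\<Sum>i<b ^ l. majorant b K C l i y) \<le> 24 * real b * C * (min (real b ^ l) K / max (real b ^ l) K)"
      using sum_majorant_le[OF b K C, of l y] unfolding mm .
  qed (use majorant_nonneg K C in auto)
next
  case False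
  then have l: "0 < l" using K by (cases l) auto
  have b0: "0 < b" "0 < K" using b K by simp_all
  have pw: "real b ^ l = real b * real b ^ (l - 1)"
    using l by (simp add: power_eq_if)
  \<comment> \<open>The finest level whose cells are not shorter than \<open>1 / K\<close>, so that
    \<open>b ^ m \<le> K < b * b ^ m\<close>.\<close>
  define m where "m = nat \<lfloor>log b K\<rfloor>"
  have lg: "0 \<le> log b K" using b K by simp
  have m1: "real b ^ m \<le> K"
  proof -
    have "real m \<le> log b K" using lg by (simp add: m_def)
    then have "b powr m \<le> b powr log b K" using b by simp
    then show ?thesis using b K by (simp add: powr_realpow)
  qed
  have m2: "K < real b * real b ^ m"
  proof -
    have "log b K < real (Suc m)" using lg by (simp add: m_def) linarith
    then have "b powr log b K < b powr Suc m" using b by (intro powr_less_mono) auto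
    then show ?thesis using b K by (simp add: powr_realpow powr_add)
  qed
  have "real b ^ m < real b ^ l" using m1 False by simp
  then have ml: "m < l" using b power_less_imp_less_exp[of "real b" m l] by simp
  define M where "M = real b ^ m"
  have M: "0 < M" using b0 by (simp add: M_def)
  \<comment> \<open>The mass of a fine cell is at most its length times the maximum of the kernel on
    the ancestor of level \<open>m\<close>. That maximum is controlled by the mean
    \<open>M * cell_theta b M m i y\<close> of a kernel of width \<open>1 / M\<close>, at the cost
    of a factor 3.\<close>
  define S where "S i = C * K * (1 / real b ^ (l - 1)) * (3 * M * cell_theta b M m i y)" for i
  show thesis
  proof (rule that[of m S])
    show "m \<le> l" using ml by simp
    show "min (real b ^ l) K \<le> b * real b ^ m" using m2 by simp
    show "0 \<le> S i" for i
      unfolding S_def using C b0 M by (intro mult_nonneg_nonneg cell_theta_nonneg) auto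
    show "majorant b K C l j y \<le> S (j div b ^ (l - m))" for j
    proof -
      define i where "i = j div b ^ (l - m)"
      define p q where "p = real i / M" and "q = (real i + 1) / M"
      have pq: "q - p = 1 / M" "p \<le> q" using M by (simp_all add: p_def q_def add_divide_distrib)
      have "j div b div b ^ (l - 1 - m) = i"
        using ml by (simp add: i_def div_mult2_eq[symmetric] Suc_diff_Suc flip: power_Suc)
      then have sub: "cell b (l - 1) (j div b) \<subseteq> {p..q}"
        using cell_subset_parent[of b m "l - 1" "j div b"] ml b0 by (simp add: cell_def p_def q_def M_def)
      have scale: "1 / v = 3 * M * (1 / M * (1 / (3 * v)))" for v
        using M by simp
      \<comment> \<open>Since \<open>M \<le> K\<close>, the kernel of parameter \<open>K\<close>
        lies below that of parameter \<open>M\<close>, and on an interval of length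
        \<open>1 / M\<close> the values of the latter differ at most by the factor 3.\<close>
      have le: "1 / (1 + (K * (y - s))\<^sup>2) \<le> 3 * M * theta M p q y" if s: "s \<in> {p..q}" for s
      proof -
        have "1 / (1 + (K * (y - s))\<^sup>2) \<le> 1 / (1 + (M * (y - s))\<^sup>2)"
          using m1 M by (intro divide_left_mono add_left_mono)
            (auto simp: M_def power_mult_distrib add_pos_nonneg intro!: mult_right_mono power_mono)
        also have "\<dots> = 3 * M * ((q - p) * (1 / (3 * (1 + (M * (y - s))\<^sup>2))))"
          unfolding pq(1) by (rule scale)
        also have "\<dots> \<le> 3 * M * theta M p q y"
        proof (intro mult_left_mono theta_ge_inf[OF M pq(2)])
          fix t assume t: "t \<in> {p..q}"
          have "\<bar>s - t\<bar> \<le> 1 / M" using s t pq by auto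
          then have "M * \<bar>s - t\<bar> \<le> 1" using M by (simp add: field_simps)
          then have "\<bar>M * (s - t)\<bar> \<le> 1" using M by (simp add: abs_mult)
          then have sq: "(M * (s - t))\<^sup>2 \<le> 1" by (simp add: abs_square_le_1)
          have "(M * (y - t))\<^sup>2 \<le> 2 * (M * (y - s))\<^sup>2 + 2 * (M * (s - t))\<^sup>2"
            using sum_squares_bound[of "M * (y - s)" "M * (s - t)"]
            by (simp add: power2_eq_square algebra_simps)
          then have "1 + (M * (y - t))\<^sup>2 \<le> 3 * (1 + (M * (y - s))\<^sup>2)"
            using sq zero_le_power2[of "M * (y - s)"] unfolding distrib_left by linarith
          then show "1 / (3 * (1 + (M * (y - s))\<^sup>2)) \<le> 1 / (1 + (M * (y - t))\<^sup>2)"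
            by (intro divide_left_mono) (auto simp: add_pos_nonneg)
        qed (use M in auto)
        finally show ?thesis .
      qed
      have "cell_theta b K (l - 1) (j div b) y \<le>
          ((real (j div b) + 1) / real b ^ (l - 1) - real (j div b) / real b ^ (l - 1)) * (3 * M * theta M p q y)"
        unfolding cell_theta_def
        using sub le by (intro theta_le_sup) (auto simp: b0 divide_right_mono cell_def)
      also have "\<dots> = 1 / real b ^ (l - 1) * (3 * M * theta M p q y)"
        by (simp add: add_divide_distrib)
      finally have "C * K * cell_theta b K (l - 1) (j div b) y
          \<le> C * K * (1 / real b ^ (l - 1) * (3 * M * theta M p q y))"
        using C b0 by (intro mult_left_mono) auto
      then show ?thesis
        using False by (simp add: majorant_def S_def i_def[symmetric] cell_theta_def p_def q_def M_def mult.assoc)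
    qed
    have "(\<Sum>i<b ^ m. S i) = C * K * (1 / real b ^ (l - 1)) * (3 * M * theta M 0 1 y)"
      unfolding S_def sum_distrib_left[symmetric] sum_cell_theta[OF b0(1)] ..
    also have "\<dots> \<le> C * K * (1 / real b ^ (l - 1)) * (3 * M * (4 / M))"
      using C b0 M theta_le[OF M] by (intro mult_left_mono) auto
    also have "\<dots> = 12 * (real b * C * (K / real b ^ l))"
      using M b0 by (simp add: pw)
    also have "\<dots> \<le> 24 * (real b * C * (K / real b ^ l))"
      using C b0 by (intro mult_right_mono) auto
    finally show "(\<Sum>i<b ^ m. S i) \<le> 24 * real b * C * (min (real b ^ l) K / max (real b ^ l) K)"
      using False by (simp add: min_def max_def mult.assoc)
  qed
qed

text \<open>The hypotheses on \<open>h\<close> are met by \<open>z \<mapsto> A z\<close> for the one-dimensional factors \<open>A\<close> at a fixed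
  point \<open>y\<close>. The term \<open>theta K 0 2 y\<close> dominates the constant part.\<close>

locale kernel_slice =
  fixes b :: nat and K C y :: real and h :: "real \<Rightarrow> complex"
  assumes b: "2 \<le> b" and K: "1 \<le> K" and C: "0 \<le> C"
    and cont: "continuous_on {0..1} h"
    and size: "\<And>z. z \<in> {0..1} \<Longrightarrow> norm (h z) \<le> C * (1 / (1 + (K * (y - z))\<^sup>2) + theta K 0 2 y)"
    and osc: "\<And>z z'. \<lbrakk>0 \<le> z; z \<le> z'; z' \<le> 1\<rbrakk> \<Longrightarrow> norm (h z' - h z) \<le> C * K * theta K z z' y"
begin

lemma pos: "0 < b" "0 < K"
  using b K by simp_all

lemma integrable_cell:
  assumes "j < b ^ l"
  shows "h integrable_on cell b l j"
  using continuous_on_subset[OF cont cell_subset_unit[OF pos(1) assms]]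
  unfolding cell_def by (rule integrable_continuous_real)

lemma norm_cell_mean_le:
  assumes j: "j < b ^ l"
  shows "norm (cell_mean b h l j) \<le> C * (real b ^ l * cell_theta b K l j y + theta K 0 2 y)"
proof -
  let ?p = "real j / real b ^ l" and ?q = "(real j + 1) / real b ^ l"
  have le: "?p \<le> ?q" by (simp add: divide_right_mono)
  have len: "?q - ?p = 1 / real b ^ l" by (simp add: add_divide_distrib)
  have I: "((\<lambda>s. C * (1 / (1 + (K * (y - s))\<^sup>2) + theta K 0 2 y)) has_integral
      C * (cell_theta b K l j y + (?q - ?p) *\<^sub>R theta K 0 2 y)) {?p..?q}"
    using has_integral_mult_right[OF has_integral_add[OF theta_has_integral[OF pos(2) le]
        has_integral_const_real[of "theta K 0 2 y" ?p ?q]], of C y] le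
    by (simp add: cell_theta_def)
  have "norm (integral {?p..?q} h) \<le> integral {?p..?q} (\<lambda>s. C * (1 / (1 + (K * (y - s))\<^sup>2) + theta K 0 2 y))"
  proof (intro integral_norm_bound_integral size)
    show "h integrable_on {?p..?q}"
      using integrable_cell[OF j] by (simp add: cell_def)
    show "(\<lambda>s. C * (1 / (1 + (K * (y - s))\<^sup>2) + theta K 0 2 y)) integrable_on {?p..?q}"
      using I by (rule has_integral_integrable)
    show "s \<in> {0..1}" if "s \<in> {?p..?q}" for s
      using that cell_subset_unit[OF pos(1) j] unfolding cell_def by blast
  qed
  also have "\<dots> = C * (cell_theta b K l j y + 1 / real b ^ l * theta K 0 2 y)"
    using integral_unique[OF I] len by simp
  finally have "real b ^ l * norm (integral {?p..?q} h)
      \<le> real b ^ l * (C * (cell_theta b K l j y + 1 / real b ^ l * theta K 0 2 y))"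
    by (rule mult_left_mono) simp
  also have "\<dots> = C * (real b ^ l * cell_theta b K l j y + theta K 0 2 y)"
    using pos by (simp add: algebra_simps)
  finally show ?thesis
    by (simp add: cell_mean_def cell_def)
qed

lemma cell_oscillation:
  assumes j: "j < b ^ l" and x: "x \<in> cell b l j" "x' \<in> cell b l j"
  shows "norm (h x - h x') \<le> C * K * cell_theta b K l j y"
proof -
  have main: "norm (h v - h u) \<le> C * K * cell_theta b K l j y"
    if uv: "u \<in> cell b l j" "v \<in> cell b l j" "u \<le> v" for u v
  proof -
    have "u \<in> {0..1}" "v \<in> {0..1}"
      using uv cell_subset_unit[OF pos(1) j] by auto
    then have "norm (h v - h u) \<le> C * K * theta K u v y"
      using uv by (intro osc) auto
    also have "\<dots> \<le> C * K * cell_theta b K l j y"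
      unfolding cell_theta_def using uv C pos
      by (intro mult_left_mono theta_mono) (auto simp: cell_def)
    finally show ?thesis .
  qed
  show ?thesis
    using main[of x x'] main[of x' x] x by (cases "x \<le> x'") (auto simp: norm_minus_commute)
qed

lemma norm_value_diff_cell_mean_le:
  assumes j: "j < b ^ l" and x: "x \<in> cell b l j"
  shows "norm (h x - cell_mean b h l j) \<le> C * K * cell_theta b K l j y"
proof -
  have "norm (cell_mean b h l j - h x) \<le> C * K * cell_theta b K l j y"
    by (intro norm_cell_mean_diff_le pos integrable_cell j cell_oscillation x)
  then show ?thesis by (simp add: norm_minus_commute)
qed

lemma norm_mean_diff_le:
  assumes j: "j < b ^ l"
  shows "norm (mean_diff b h l j) \<le> majorant b K C l j y"
proof (cases "real b ^ l \<le> K")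
  case True
  show ?thesis
  proof (cases "l = 0")
    case True
    then have "norm (mean_diff b h l j) \<le> C * (real b ^ l * cell_theta b K l j y + theta K 0 2 y)"
      using norm_cell_mean_le[OF j] by (simp add: mean_diff_def)
    also have "\<dots> \<le> C * (real b ^ l * cell_theta b K l j y + theta K 0 2 y
        + (real b ^ (l - 1) * cell_theta b K (l - 1) (j div b) y + theta K 0 2 y))"
      using C pos by (intro mult_left_mono)
        (auto intro!: add_nonneg_nonneg mult_nonneg_nonneg cell_theta_nonneg theta_nonneg)
    finally show ?thesis
      using \<open>real b ^ l \<le> K\<close> by (simp add: majorant_def)
  next
    case False
    then have "j div b < b ^ (l - 1)"
      using j by (simp add: less_mult_imp_div_less power_eq_if mult.commute)
    from norm_cell_mean_le[OF this] norm_cell_mean_le[OF j] show ?thesis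
      using norm_triangle_ineq4[of "cell_mean b h l j" "cell_mean b h (l - 1) (j div b)"] False \<open>real b ^ l \<le> K\<close>
      by (simp add: mean_diff_def majorant_def algebra_simps)
  qed
next
  case False
  then have l: "0 < l" using K by (cases l) auto
  have par: "j div b < b ^ (l - 1)"
    using j l by (simp add: less_mult_imp_div_less power_eq_if mult.commute)
  have sub: "cell b l j \<subseteq> cell b (l - 1) (j div b)"
    using cell_subset_parent[OF pos(1), of "l - 1" l j] l by simp
  \<comment> \<open>The child lies inside its parent, so the oscillation on the parent bounds the
    distance of every value on the child from the parent's mean, hence also that of the child's
    mean.\<close>
  have "norm (cell_mean b h l j - cell_mean b h (l - 1) (j div b)) \<le> C * K * cell_theta b K (l - 1) (j div b) y"
    using sub by (intro norm_cell_mean_diff_le pos integrable_cell j norm_value_diff_cell_mean_le par) auto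
  then show ?thesis
    using False l by (simp add: mean_diff_def majorant_def)
qed

text \<open>At the last level the detail is a value of \<open>h\<close> minus the mean over the
  parent cell, which the oscillation bounds. The hypothesis \<open>K < b ^ L\<close> puts this level
  into the oscillation branch of \<open>majorant\<close>.\<close>

lemma norm_detail_le:
  assumes z: "0 \<le> z" "z < 1" and L: "K < real b ^ L" and l: "l \<le> L"
  shows "norm (detail b L h l z) \<le> majorant b K C l (cell_index b l z) y"
proof (cases "l < L")
  case True
  then show ?thesis
    using norm_mean_diff_le cell_index_less[OF pos(1) z] by (simp add: detail_def)
next
  case False
  then have [simp]: "l = L" using l by simp
  have "0 < L" using K L by (cases L) auto
  then have par: "cell_index b L z div b = cell_index b (L - 1) z"
    using cell_index_div[OF pos(1) z(1), of "L - 1" L] by simp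
  have "norm (h z - cell_mean b h (L - 1) (cell_index b (L - 1) z))
      \<le> C * K * cell_theta b K (L - 1) (cell_index b (L - 1) z) y"
    by (intro norm_value_diff_cell_mean_le cell_index_less mem_cell_index pos z)
  then show ?thesis
    using L by (simp add: detail_def majorant_def par)
qed

end

section \<open>Littlewood-Paley kernels\<close>

lemma lborel_integral_eq_integral_Icc:
  fixes f :: "real \<Rightarrow> complex"
  assumes "continuous_on {a..b} f"
  shows "(LINT x|lborel. indicator {a..b} x *\<^sub>R f x) = integral {a..b} f"
    and "integrable lborel (\<lambda>x. indicator {a..b} x *\<^sub>R f x)"
proof -
  have int: "set_integrable lborel {a..b} f"
    unfolding set_integrable_def using assms by (intro borel_integrable_compact) auto
  show "(LINT x|lborel. indicator {a..b} x *\<^sub>R f x) = integral {a..b} f"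
    using set_borel_integral_eq_integral(2)[OF int] by (simp add: set_lebesgue_integral_def)
  show "integrable lborel (\<lambda>x. indicator {a..b} x *\<^sub>R f x)"
    using int by (simp add: set_integrable_def)
qed

text \<open>The convolution kernel of the Fourier multiplier \<open>\<phi>\<close>. The factor
  \<open>1 / (2 * pi)\<close> is the product of the normalisations of the two Fourier transforms
  that a multiplier involves.\<close>

definition kern :: "(real \<Rightarrow> complex) \<Rightarrow> real \<Rightarrow> complex" where
  "kern \<phi> u = of_real (1 / (2 * pi)) * (LINT \<xi>|lborel. cis (u * \<xi>) * \<phi> \<xi>)"

lemma cis_has_vector_derivative:
  "((\<lambda>\<xi>. cis (u * \<xi>)) has_vector_derivative \<i> * of_real u * cis (u * \<xi>)) (at \<xi> within S)"
proof -
  have "((\<lambda>\<xi>. exp (\<i> * of_real u * of_real \<xi>)) has_vector_derivative \<i> * of_real u * cis (u * \<xi>)) (at \<xi> within S)"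
    by (auto intro!: derivative_eq_intros has_vector_derivative_real_field simp: cis_conv_exp mult_ac)
  then show ?thesis by (simp add: cis_conv_exp mult.assoc)
qed

locale lp_generator =
  fixes \<phi>0 :: "real \<Rightarrow> complex"
  assumes generator: "dyadic_generator \<phi>0"
begin

section \<open>Decay of the kernel by repeated integration by parts\<close>

definition nth_deriv :: "nat \<Rightarrow> real \<Rightarrow> complex" where
  "nth_deriv n = dir_derivs (replicate n 1) \<phi>0"

lemma nth_deriv_0: "nth_deriv 0 = \<phi>0"
  by (simp add: nth_deriv_def)

lemma nth_deriv_has_derivative: "(nth_deriv n has_vector_derivative nth_deriv (Suc n) x) (at x)"
proof -
  have "smooth \<phi>0"
    using generator by (simp add: dyadic_generator_def schwartz_space_def)
  then have "nth_deriv n differentiable (at x)"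
    unfolding smooth_def nth_deriv_def by (auto simp: set_replicate_conv_if)
  then have "(nth_deriv n has_vector_derivative vector_derivative (nth_deriv n) (at x)) (at x)"
    by (simp add: vector_derivative_works)
  moreover have "vector_derivative (nth_deriv n) (at x) = nth_deriv (Suc n) x"
    using \<open>nth_deriv n differentiable (at x)\<close> frechet_derivative_eq_vector_derivative[of "nth_deriv n" x]
    by (simp add: nth_deriv_def)
  ultimately show ?thesis by simp
qed

lemma nth_deriv_continuous: "continuous_on S (nth_deriv n)"
  using nth_deriv_has_derivative has_vector_derivative_continuous
  by (blast intro: continuous_at_imp_continuous_on)

lemma nth_deriv_support: "\<bar>t\<bar> > 3/2 \<Longrightarrow> nth_deriv n t = 0"
proof (induction n arbitrary: t)
  case 0
  then show ?case using generator by (simp add: nth_deriv_0 dyadic_generator_def)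
next
  case (Suc n)
  \<comment> \<open>The strict inequality makes the region open, so the derivative vanishes there
    along with the function.\<close>
  have "open ((\<lambda>t::real. \<bar>t\<bar>) -` {3/2<..})"
    by (intro open_vimage) (auto intro!: continuous_intros)
  then have op: "open {t::real. 3/2 < \<bar>t\<bar>}"
    by (simp add: vimage_def)
  have "((\<lambda>_. 0::complex) has_vector_derivative nth_deriv (Suc n) t) (at t)"
    using has_vector_derivative_transform_within_open[OF nth_deriv_has_derivative op, of t n "\<lambda>_. 0"] Suc
    by simp
  then show ?case
    using vector_derivative_unique_at has_vector_derivative_const by blast
qed

text \<open>The Fourier integral of the \<open>n\<close>-th derivative. The interval exceeds the
  support, which lies in \<open>{-3/2..3/2}\<close>, so all derivatives vanish at its
  endpoints.\<close>

definition osc_int :: "nat \<Rightarrow> real \<Rightarrow> complex" where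
  "osc_int n u = integral {-2..2} (\<lambda>\<xi>. cis (u * \<xi>) * nth_deriv n \<xi>)"

text \<open>Integration by parts without boundary terms: each derivative contributes one factor
  \<open>u\<close>.\<close>

lemma osc_int_Suc: "osc_int (Suc n) u = - (\<i> * of_real u) * osc_int n u"
proof -
  have "((\<lambda>\<xi>. \<i> * of_real u * cis (u * \<xi>) * nth_deriv n \<xi> + cis (u * \<xi>) * nth_deriv (Suc n) \<xi>) has_integral
      cis (u * 2) * nth_deriv n 2 - cis (u * (-2)) * nth_deriv n (-2)) {-2..2}"
    by (intro fundamental_theorem_of_calculus)
       (auto intro!: derivative_eq_intros cis_has_vector_derivative has_vector_derivative_at_within[OF nth_deriv_has_derivative])
  then have "integral {-2..2} (\<lambda>\<xi>. \<i> * of_real u * (cis (u * \<xi>) * nth_deriv n \<xi>) + cis (u * \<xi>) * nth_deriv (Suc n) \<xi>) = 0"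
    using nth_deriv_support[of 2 n] nth_deriv_support[of "-2" n] by (simp add: integral_unique mult.assoc)
  moreover have "integral {-2..2} (\<lambda>\<xi>. \<i> * of_real u * (cis (u * \<xi>) * nth_deriv n \<xi>) + cis (u * \<xi>) * nth_deriv (Suc n) \<xi>)
      = \<i> * of_real u * osc_int n u + osc_int (Suc n) u"
    unfolding osc_int_def
    by (subst Henstock_Kurzweil_Integration.integral_add)
       (auto intro!: integrable_continuous_real continuous_intros nth_deriv_continuous)
  ultimately show ?thesis
    by (simp add: add_eq_0_iff)
qed

lemma osc_int_bounded: "\<exists>B\<ge>0. \<forall>u. norm (osc_int n u) \<le> B"
proof -
  have "compact (nth_deriv n ` {-2..2})"
    by (intro compact_continuous_image nth_deriv_continuous) auto
  then obtain B where B: "\<forall>x\<in>nth_deriv n ` {-2..2}. norm x \<le> B"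
    using compact_imp_bounded bounded_iff by metis
  have "norm (osc_int n u) \<le> B * (2 - (-2))" for u
    unfolding osc_int_def using B
    by (intro integral_bound) (auto intro!: continuous_intros nth_deriv_continuous simp: norm_mult)
  moreover have "0 \<le> B" using B by (metis (no_types, lifting) atLeastAtMost_iff image_eqI norm_ge_zero order.trans neg_le_0_iff_le zero_le_numeral)
  ultimately show ?thesis by (intro exI[of _ "B * 4"]) auto
qed

lemma kern_eq: "kern \<phi>0 u = of_real (1 / (2 * pi)) * osc_int 0 u"
proof -
  have "(LINT \<xi>|lborel. cis (u * \<xi>) * \<phi>0 \<xi>) = (LINT \<xi>|lborel. indicator {-2..2} \<xi> *\<^sub>R (cis (u * \<xi>) * nth_deriv 0 \<xi>))"
    using nth_deriv_support[where n = 0] by (intro Bochner_Integration.integral_cong) (auto simp: indicator_def nth_deriv_0)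
  also have "\<dots> = osc_int 0 u"
    unfolding osc_int_def by (intro lborel_integral_eq_integral_Icc continuous_intros nth_deriv_continuous)
  finally show ?thesis by (simp add: kern_def)
qed

text \<open>As \<open>(1 + u\<^sup>2)\<^sup>2 = 1 + 2 * u\<^sup>2 + u ^ 4\<close>, the bounds for
  the derivatives of orders 0, 2 and 4 combine. One of the two factors \<open>1 + u\<^sup>2\<close>
  is spent later on the length of an interval of integration.\<close>

lemma kern_decay: "\<exists>C\<ge>0. \<forall>u. norm (kern \<phi>0 u) \<le> C / (1 + u\<^sup>2)\<^sup>2"
proof -
  obtain B where B: "\<And>n. 0 \<le> B n" "\<And>n u. norm (osc_int n u) \<le> B n"
    using osc_int_bounded by metis
  have pw: "osc_int n u = (- (\<i> * of_real u)) ^ n * osc_int 0 u" for n u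
    by (induction n) (simp_all add: osc_int_Suc)
  have le: "\<bar>u\<bar> ^ n * norm (osc_int 0 u) \<le> B n" for n u
    using B(2)[of n u] by (simp add: pw[of n] norm_mult norm_power)
  have "norm (kern \<phi>0 u) \<le> (B 0 + 2 * B 2 + B 4) / (1 + u\<^sup>2)\<^sup>2" for u
  proof -
    have "0 < 1 + u\<^sup>2" by (simp add: add_pos_nonneg)
    then have pos: "0 < (1 + u\<^sup>2)\<^sup>2" by (rule zero_less_power)
    have "(1 + u\<^sup>2)\<^sup>2 = 1 + 2 * \<bar>u\<bar> ^ 2 + \<bar>u\<bar> ^ 4"
      by (simp add: power2_eq_square power4_eq_xxxx algebra_simps)
    then have "(1 + u\<^sup>2)\<^sup>2 * norm (osc_int 0 u) \<le> B 0 + 2 * B 2 + B 4"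
      using le[of u 0] le[of u 2] le[of u 4] by (simp add: distrib_right del: power2_abs)
    then have "norm (osc_int 0 u) \<le> (B 0 + 2 * B 2 + B 4) / (1 + u\<^sup>2)\<^sup>2"
      using pos by (simp add: pos_le_divide_eq mult.commute)
    moreover have "norm (kern \<phi>0 u) \<le> norm (osc_int 0 u)"
    proof -
      have "norm (osc_int 0 u) * 1 \<le> norm (osc_int 0 u) * (2 * pi)"
        using pi_gt3 by (intro mult_left_mono) auto
      then show ?thesis
        by (simp add: kern_eq norm_mult norm_divide divide_le_eq)
    qed
    ultimately show ?thesis by linarith
  qed
  then show ?thesis using B(1) by (intro exI[of _ "B 0 + 2 * B 2 + B 4"]) auto
qed

lemma kern_continuous: "continuous_on S (kern \<phi>0)"
proof -
  have "continuous_on UNIV (\<lambda>u. integral (cbox (-2) 2) (\<lambda>\<xi>. cis (u * \<xi>) * nth_deriv 0 \<xi>))"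
    by (intro integral_continuous_on_param)
       (auto intro!: continuous_intros continuous_on_compose2[OF nth_deriv_continuous[of UNIV]] simp: split_def)
  then have "continuous_on UNIV (kern \<phi>0)"
    by (auto simp: kern_eq[abs_def] osc_int_def intro!: continuous_intros)
  then show ?thesis by (rule continuous_on_subset) simp
qed

lemma kern_scaled:
  assumes "0 < c"
  shows "kern (\<lambda>t. \<phi>0 (t / c)) u = of_real c * kern \<phi>0 (c * u)"
proof -
  have "(LINT \<xi>|lborel. cis (u * \<xi>) * \<phi>0 (\<xi> / c)) = \<bar>c\<bar> *\<^sub>R (LINT \<xi>|lborel. cis (u * (0 + c * \<xi>)) * \<phi>0 ((0 + c * \<xi>) / c))"
    using assms by (intro lborel_integral_real_affine) auto
  then show ?thesis
    using assms by (simp add: kern_def scaleR_conv_of_real mult_ac)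
qed

lemma integrable_cis_mult:
  assumes "0 < c"
  shows "integrable lborel (\<lambda>\<xi>. cis (u * \<xi>) * \<phi>0 (\<xi> / c))"
proof -
  have "integrable lborel (\<lambda>\<xi>. indicator {-2*c..2*c} \<xi> *\<^sub>R (cis (u * \<xi>) * nth_deriv 0 (\<xi> / c)))"
    using assms by (intro lborel_integral_eq_integral_Icc continuous_intros continuous_on_compose2[OF nth_deriv_continuous[of UNIV]]) auto
  moreover have "indicator {-2*c..2*c} \<xi> *\<^sub>R (cis (u * \<xi>) * nth_deriv 0 (\<xi> / c)) = cis (u * \<xi>) * \<phi>0 (\<xi> / c)" for \<xi>
    using nth_deriv_support[of "\<xi> / c" 0] assms by (auto simp: indicator_def nth_deriv_0 field_simps abs_if split: if_splits)
  ultimately show ?thesis by simp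
qed

lemma kern_dyadic_Suc:
  "kern (dyadic \<phi>0 (Suc k)) u = of_real (2 ^ Suc k) * kern \<phi>0 (2 ^ Suc k * u) - of_real (2 ^ k) * kern \<phi>0 (2 ^ k * u)"
proof -
  have "kern (dyadic \<phi>0 (Suc k)) u = kern (\<lambda>t. \<phi>0 (t / 2 ^ Suc k)) u - kern (\<lambda>t. \<phi>0 (t / 2 ^ k)) u"
    using integrable_cis_mult[of "2 ^ Suc k" u] integrable_cis_mult[of "2 ^ k" u]
    by (simp add: kern_def right_diff_distrib)
  then show ?thesis
    by (simp only: kern_scaled zero_less_power zero_less_numeral)
qed

lemma kern_dyadic_continuous: "continuous_on S (kern (dyadic \<phi>0 k))"
proof (cases k)
  case (Suc n)
  then show ?thesis
    by (auto simp: kern_dyadic_Suc[abs_def] simp del: dyadic.simps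
        intro!: continuous_intros continuous_on_compose2[OF kern_continuous[of UNIV]])
qed (simp add: kern_continuous)

end

section \<open>Convolution of truncated step functions with the kernels\<close>

definition cutoff :: "real \<Rightarrow> real" where
  "cutoff x = max 0 (min 1 (2 - x))"

text \<open>The function called \<open>e z x\<close> in the introduction.\<close>

definition step :: "real \<Rightarrow> real \<Rightarrow> real" where
  "step z x = (if z < x then cutoff x else 0)"

definition conv_step :: "(real \<Rightarrow> complex) \<Rightarrow> real \<Rightarrow> real \<Rightarrow> complex" where
  "conv_step g z y = (LINT x|lborel. of_real (step z x) * g (y - x))"

lemma cutoff_continuous: "continuous_on S cutoff"
  unfolding cutoff_def by (intro continuous_intros)

lemma cutoff_bounds: "0 \<le> cutoff x" "cutoff x \<le> 1"
  by (auto simp: cutoff_def)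

lemma norm_cutoff_mult_le: "norm (of_real (cutoff x) * v) \<le> norm (v :: complex)"
  using mult_right_mono[OF cutoff_bounds(2)[of x] norm_ge_zero[of v]] cutoff_bounds(1)[of x] by (simp add: norm_mult)

lemma has_integral_conv_step:
  fixes g :: "real \<Rightarrow> complex"
  assumes g: "continuous_on UNIV g" and z: "z \<le> 2"
  shows "((\<lambda>x. of_real (cutoff x) * g (y - x)) has_integral conv_step g z y) {z..2}"
proof -
  let ?f = "\<lambda>x. of_real (cutoff x) * g (y - x)"
  have cont: "continuous_on {z..2} ?f"
    by (intro continuous_intros continuous_on_compose2[OF g] continuous_on_compose2[OF cutoff_continuous[of UNIV]]) auto
  \<comment> \<open>At \<open>x = z\<close> the strict inequality in \<open>step\<close> disagrees
    with the closed interval.\<close>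
  have "AE x in lborel. x \<noteq> z" by (rule AE_lborel_singleton)
  then have "conv_step g z y = (LINT x|lborel. indicator {z..2} x *\<^sub>R ?f x)"
    unfolding conv_step_def
  proof (intro integral_cong_AE)
    show "(\<lambda>x. of_real (step z x) * g (y - x)) \<in> borel_measurable lborel"
      using borel_measurable_continuous_onI[OF g] unfolding step_def cutoff_def by measurable
    show "(\<lambda>x. indicator {z..2} x *\<^sub>R ?f x) \<in> borel_measurable lborel"
      using borel_measurable_continuous_onI[OF g] unfolding cutoff_def by measurable
  next
    assume "AE x in lborel. x \<noteq> z"
    then show "AE x in lborel. of_real (step z x) * g (y - x) = indicator {z..2} x *\<^sub>R ?f x"
      by eventually_elim (auto simp: step_def cutoff_def indicator_def)
  qed
  also have "\<dots> = integral {z..2} ?f"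
    by (rule lborel_integral_eq_integral_Icc[OF cont])
  finally show ?thesis
    using integrable_continuous_real[OF cont] by (simp add: has_integral_iff)
qed

lemma conv_step_diff:
  fixes g :: "real \<Rightarrow> complex"
  assumes g: "continuous_on UNIV g" and z: "z \<le> z'" "z' \<le> 2"
  shows "((\<lambda>x. of_real (cutoff x) * g (y - x)) has_integral conv_step g z y - conv_step g z' y) {z..z'}"
proof -
  let ?f = "\<lambda>x. of_real (cutoff x) * g (y - x)"
  have "continuous_on {z..z'} ?f"
    by (intro continuous_intros continuous_on_compose2[OF g] continuous_on_compose2[OF cutoff_continuous[of UNIV]]) auto
  then obtain I where I: "(?f has_integral I) {z..z'}"
    using integrable_continuous_real by (blast dest: integrable_integral)
  have "(?f has_integral (I + conv_step g z' y)) {z..2}"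
    using z by (intro has_integral_combine[OF _ _ I has_integral_conv_step[OF g]]) auto
  from has_integral_unique[OF this has_integral_conv_step[OF g, of z y]] z
  have "I + conv_step g z' y = conv_step g z y" by simp
  then have "I = conv_step g z y - conv_step g z' y" by (simp add: eq_diff_eq)
  then show ?thesis using I by simp
qed

text \<open>A sharp cutoff at 1 would leave \<open>G (y - 1)\<close> in place of its mean over the cutoff zone; only the
  mean is as small as the width of \<open>G\<close>.\<close>

lemma conv_step_antiderivative:
  fixes g G :: "real \<Rightarrow> complex"
  assumes g: "continuous_on UNIV g" and G: "\<And>u. (G has_vector_derivative g u) (at u)" and z: "z \<le> 1"
  shows "conv_step g z y = G (y - z) - integral {1..2} (\<lambda>s. G (y - s))"
proof -
  let ?f = "\<lambda>x. of_real (cutoff x) * g (y - x)"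
  have dG: "((\<lambda>x. G (y - x)) has_vector_derivative - g (y - x)) (at x within S)" for x S
  proof -
    have "((\<lambda>x. y - x) has_vector_derivative - 1) (at x)"
      by (auto intro!: derivative_eq_intros simp flip: has_real_derivative_iff_has_vector_derivative)
    from vector_diff_chain_at[OF this G]
    have "((\<lambda>x. G (y - x)) has_vector_derivative - g (y - x)) (at x)"
      by (simp add: o_def)
    then show ?thesis by (rule has_vector_derivative_at_within)
  qed
  have cG: "continuous_on S (\<lambda>s. G (y - s))" for S
    by (intro continuous_at_imp_continuous_on ballI has_vector_derivative_continuous[OF dG])
  have "((\<lambda>x. g (y - x)) has_integral (- G (y - 1)) - (- G (y - z))) {z..1}"
    using z dG by (intro fundamental_theorem_of_calculus) (auto intro!: derivative_eq_intros)
  then have "((\<lambda>x. g (y - x)) has_integral G (y - z) - G (y - 1)) {z..1}"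
    by simp
  then have 1: "(?f has_integral G (y - z) - G (y - 1)) {z..1}"
    by (rule has_integral_eq[rotated]) (auto simp: cutoff_def)
  \<comment> \<open>Integration by parts on the cutoff zone: the integrand is the derivative of
    \<open>- (2 - x) * G (y - x)\<close>, and the boundary term at 2 vanishes.\<close>
  have "((\<lambda>x. G (y - x) + of_real (2 - x) * g (y - x)) has_integral
      (- of_real (2 - 2) * G (y - 2)) - (- of_real (2 - 1) * G (y - 1))) {1..2}"
  proof (intro fundamental_theorem_of_calculus)
    fix x :: real
    have "((\<lambda>x. 2 - x) has_real_derivative - 1) (at x within {1..2})"
      by (auto intro!: derivative_eq_intros)
    from has_vector_derivative_minus[OF has_vector_derivative_of_real[OF this]]
    have "((\<lambda>x. - of_real (2 - x)) has_vector_derivative (1 :: complex)) (at x within {1..2})"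
      by simp
    from has_vector_derivative_mult[OF this dG]
    show "((\<lambda>x. - of_real (2 - x) * G (y - x)) has_vector_derivative G (y - x) + of_real (2 - x) * g (y - x)) (at x within {1..2})"
      by (simp add: algebra_simps)
  qed simp
  moreover have "((\<lambda>x. G (y - x)) has_integral integral {1..2} (\<lambda>s. G (y - s))) {1..2}"
    by (intro integrable_integral integrable_continuous_real cG)
  ultimately have "((\<lambda>x. G (y - x) + of_real (2 - x) * g (y - x) - G (y - x)) has_integral
      (- of_real (2 - 2) * G (y - 2)) - (- of_real (2 - 1) * G (y - 1)) - integral {1..2} (\<lambda>s. G (y - s))) {1..2}"
    by (rule has_integral_diff)
  then have "((\<lambda>x. of_real (2 - x) * g (y - x)) has_integral
      G (y - 1) - integral {1..2} (\<lambda>s. G (y - s))) {1..2}"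
    by simp
  then have 2: "(?f has_integral G (y - 1) - integral {1..2} (\<lambda>s. G (y - s))) {1..2}"
    by (rule has_integral_eq[rotated]) (auto simp: cutoff_def)
  have "(?f has_integral (G (y - z) - G (y - 1)) + (G (y - 1) - integral {1..2} (\<lambda>s. G (y - s)))) {z..2}"
    using z by (intro has_integral_combine[OF _ _ 1 2]) auto
  from has_integral_unique[OF this has_integral_conv_step[OF g, of z y]] z
  show ?thesis by simp
qed

lemma norm_has_integral_le:
  fixes f :: "real \<Rightarrow> complex"
  assumes "(f has_integral I) S" "(g has_integral J) S" "\<And>x. x \<in> S \<Longrightarrow> norm (f x) \<le> g x"
  shows "norm I \<le> J"
  using integral_norm_bound_integral[of f S g] assms by (auto simp: has_integral_iff)

text \<open>Between \<open>z\<close> and \<open>z'\<close> the convolution changes by the integral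
  of the kernel over this interval, so the pointwise bound of \<open>g\<close> yields the
  oscillation bound, and that one yields Lipschitz continuity. Only the size bound needs
  cancellation in \<open>g\<close>.\<close>

lemma kernel_slice_conv_step:
  fixes g :: "real \<Rightarrow> complex"
  assumes b: "2 \<le> b" and K: "1 \<le> K" and C: "0 \<le> C" and g: "continuous_on UNIV g"
    and g_le: "\<And>u. norm (g u) \<le> C * K * (1 / (1 + (K * u)\<^sup>2))"
    and size: "\<And>z. z \<in> {0..1} \<Longrightarrow> norm (conv_step g z y) \<le> C * (1 / (1 + (K * (y - z))\<^sup>2) + theta K 0 2 y)"
  shows "kernel_slice b K C y (\<lambda>z. conv_step g z y)"
proof
  have K0: "0 < K" using K by simp
  show osc: "norm (conv_step g z' y - conv_step g z y) \<le> C * K * theta K z z' y"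
    if "0 \<le> z" "z \<le> z'" "z' \<le> 1" for z z'
  proof -
    have "norm (conv_step g z y - conv_step g z' y) \<le> C * K * theta K z z' y"
    proof (rule norm_has_integral_le)
      show "((\<lambda>x. of_real (cutoff x) * g (y - x)) has_integral conv_step g z y - conv_step g z' y) {z..z'}"
        using that by (intro conv_step_diff g) auto
      show "((\<lambda>x. C * K * (1 / (1 + (K * (y - x))\<^sup>2))) has_integral C * K * theta K z z' y) {z..z'}"
        using that by (intro has_integral_mult_right theta_has_integral K0)
      fix x
      show "norm (of_real (cutoff x) * g (y - x)) \<le> C * K * (1 / (1 + (K * (y - x))\<^sup>2))"
        using g_le[of "y - x"] norm_cutoff_mult_le order_trans by blast
    qed
    then show ?thesis by (simp add: norm_minus_commute)
  qed
  show "continuous_on {0..1} (\<lambda>z. conv_step g z y)"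
  proof -
    have th: "theta K z z' y \<le> z' - z" if "z \<le> z'" for z z'
      using theta_le_sup[OF K0 that, of y 1] by (simp add: divide_le_eq add_pos_nonneg)
    have lip: "norm (conv_step g z' y - conv_step g z y) \<le> C * K * (z' - z)"
      if "0 \<le> z" "z \<le> z'" "z' \<le> 1" for z z'
      using osc[OF that] mult_left_mono[OF th[OF that(2)], of "C * K"] C K0 by simp
    have "(C * K)-lipschitz_on {0..1} (\<lambda>z. conv_step g z y)"
    proof (rule lipschitz_onI)
      fix u v :: real assume "u \<in> {0..1}" "v \<in> {0..1}"
      then show "dist (conv_step g u y) (conv_step g v y) \<le> C * K * dist u v"
        using lip[of u v] lip[of v u] by (cases "u \<le> v") (auto simp: dist_norm norm_minus_commute dist_real_def)
    qed (use C K0 in auto)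
    then show ?thesis by (rule lipschitz_on_continuous_on)
  qed
qed (use assms in auto)

context lp_generator
begin

text \<open>For \<open>k > 0\<close> the kernel is a difference of two dilates of one kernel and
  therefore has an antiderivative that decays like the kernel times its width. For
  \<open>k = 0\<close> the width is 1, and the term \<open>theta K 0 2 y\<close> alone dominates the
  convolution.\<close>

lemma kernel_slices:
  obtains C where "0 \<le> C"
    "\<And>b k y. 2 \<le> b \<Longrightarrow> kernel_slice b (2 ^ k) C y (\<lambda>z. conv_step (kern (dyadic \<phi>0 k)) z y)"
proof -
  obtain B where B: "0 \<le> B" "\<And>u. norm (kern \<phi>0 u) \<le> B / (1 + u\<^sup>2)\<^sup>2"
    using kern_decay by blast
  have pos: "0 < 1 + u\<^sup>2" for u :: real by (simp add: add_pos_nonneg)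
  have B1: "norm (kern \<phi>0 u) \<le> B * (1 / (1 + u\<^sup>2))" for u
  proof -
    have "B / (1 + u\<^sup>2)\<^sup>2 \<le> B / (1 + u\<^sup>2) ^ 1"
      using B(1) pos[of u] by (intro divide_left_mono power_increasing) auto
    then show ?thesis using B(2)[of u] by simp
  qed
  have half: "1 / (1 + (v / 2)\<^sup>2) \<le> 4 * (1 / (1 + v\<^sup>2))" for v :: real
  proof -
    have "1 + v\<^sup>2 \<le> 4 * (1 + (v / 2)\<^sup>2)" by (simp add: power_divide)
    then show ?thesis using pos[of v] pos[of "v / 2"] by (simp add: divide_le_eq le_divide_eq)
  qed
  \<comment> \<open>With \<open>k = Suc n\<close> the two dilates contribute
    \<open>2 ^ k * B\<close> and \<open>2 ^ n * 4 * B\<close>, together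
    \<open>3 * B * 2 ^ k\<close>.\<close>
  define C where "C = 3 * B"
  have C: "0 \<le> C" using B by (simp add: C_def)
  have kb: "norm (kern (dyadic \<phi>0 k) u) \<le> C * 2 ^ k * (1 / (1 + (2 ^ k * u)\<^sup>2))" for k u
  proof (cases k)
    case 0
    have "B * (1 / (1 + u\<^sup>2)) \<le> C * (1 / (1 + u\<^sup>2))"
      using B pos[of u] by (intro mult_right_mono) (auto simp: C_def)
    then show ?thesis using B1[of u] 0 by simp
  next
    case (Suc n)
    let ?v = "2 ^ Suc n * u"
    have "norm (kern (dyadic \<phi>0 k) u) \<le> 2 ^ Suc n * norm (kern \<phi>0 ?v) + 2 ^ n * norm (kern \<phi>0 (?v / 2))"
      unfolding Suc kern_dyadic_Suc by (rule order_trans[OF norm_triangle_ineq4]) (simp add: norm_mult norm_power)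
    also have "\<dots> \<le> 2 ^ Suc n * (B * (1 / (1 + ?v\<^sup>2))) + 2 ^ n * (B * (4 * (1 / (1 + ?v\<^sup>2))))"
      using B(1) by (intro add_mono mult_left_mono B1 order_trans[OF B1[of "?v / 2"] mult_left_mono[OF half]]) auto
    also have "\<dots> = C * 2 ^ k * (1 / (1 + ?v\<^sup>2))"
      by (simp add: Suc C_def algebra_simps add_divide_distrib)
    finally show ?thesis by (simp only: Suc)
  qed
  have size: "norm (conv_step (kern (dyadic \<phi>0 k)) z y) \<le> C * (1 / (1 + (2 ^ k * (y - z))\<^sup>2) + theta (2 ^ k) 0 2 y)"
    if z: "z \<in> {0..1}" for k y z
  proof (cases k)
    case 0
    have "norm (conv_step (kern \<phi>0) z y) \<le> C * theta 1 z 2 y"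
    proof (rule norm_has_integral_le)
      show "((\<lambda>x. of_real (cutoff x) * kern \<phi>0 (y - x)) has_integral conv_step (kern \<phi>0) z y) {z..2}"
        using z by (intro has_integral_conv_step kern_continuous) auto
      show "((\<lambda>x. C * (1 / (1 + (1 * (y - x))\<^sup>2))) has_integral C * theta 1 z 2 y) {z..2}"
        using z by (intro has_integral_mult_right theta_has_integral) auto
      fix x
      show "norm (of_real (cutoff x) * kern \<phi>0 (y - x)) \<le> C * (1 / (1 + (1 * (y - x))\<^sup>2))"
        using kb[of 0 "y - x"] norm_cutoff_mult_le[of x "kern \<phi>0 (y - x)"] by simp
    qed
    also have "\<dots> \<le> C * theta 1 0 2 y"
      using z C by (intro mult_left_mono theta_mono) auto
    also have "\<dots> \<le> C * (1 / (1 + (1 * (y - z))\<^sup>2) + theta 1 0 2 y)"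
      using C by (intro mult_left_mono) auto
    finally show ?thesis using 0 by simp
  next
    case (Suc n)
    define K :: real where "K = 2 ^ k"
    have K: "0 < K" "K = 2 * 2 ^ n" by (simp_all add: K_def Suc)
    have "\<exists>H. \<forall>x::real. -\<infinity> < ereal x \<longrightarrow> ereal x < \<infinity> \<longrightarrow> (H has_vector_derivative kern \<phi>0 x) (at x)"
      using kern_continuous[of UNIV] by (intro einterval_antiderivative) (auto simp: continuous_on_eq_continuous_at)
    then obtain H where H: "\<And>x. (H has_vector_derivative kern \<phi>0 x) (at x)" by auto
    \<comment> \<open>Up to sign, \<open>G u\<close> is the integral of \<open>kern \<phi>0\<close>
      between \<open>t = 2 ^ n * u\<close> and \<open>2 * t\<close>. This interval has length
      \<open>\<bar>t\<bar>\<close> and keeps the distance \<open>\<bar>t\<bar>\<close> from 0, so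
      one factor of the decay absorbs its length and the other one remains.\<close>
    define G where "G u = H (K * u) - H (2 ^ n * u)" for u
    have scaled: "((\<lambda>u. H (c * u)) has_vector_derivative of_real c * kern \<phi>0 (c * u)) (at u)" for c u
    proof -
      have "((\<lambda>u. c * u) has_vector_derivative c) (at u)"
        by (auto intro!: derivative_eq_intros simp flip: has_real_derivative_iff_has_vector_derivative)
      from vector_diff_chain_at[OF this H] show ?thesis
        by (simp add: o_def scaleR_conv_of_real)
    qed
    have G: "(G has_vector_derivative kern (dyadic \<phi>0 k) u) (at u)" for u
      using has_vector_derivative_diff[OF scaled[of K u] scaled[of "2 ^ n" u]]
      by (simp add: G_def[abs_def] Suc kern_dyadic_Suc K_def del: dyadic.simps)
    have G_le: "norm (G u) \<le> C * (1 / (1 + (K * u)\<^sup>2))" for u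
    proof -
      define t where "t = 2 ^ n * u"
      have Ku: "K * u = 2 * t" by (simp add: t_def K)
      have HI: "norm (H q - H p) \<le> B / (1 + t\<^sup>2)\<^sup>2 * (q - p)"
        if "p \<le> q" "\<And>x. x \<in> {p..q} \<Longrightarrow> \<bar>t\<bar> \<le> \<bar>x\<bar>" for p q
      proof (rule norm_has_integral_le)
        show "(kern \<phi>0 has_integral H q - H p) {p..q}"
          using that H by (intro fundamental_theorem_of_calculus) (auto intro: has_vector_derivative_at_within)
        show "((\<lambda>_. B / (1 + t\<^sup>2)\<^sup>2) has_integral B / (1 + t\<^sup>2)\<^sup>2 * (q - p)) {p..q}"
          using has_integral_const_real[of "B / (1 + t\<^sup>2)\<^sup>2" p q] that by (simp add: mult.commute)
        fix x assume "x \<in> {p..q}"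
        then have "t\<^sup>2 \<le> x\<^sup>2" using that(2) by (simp add: abs_le_square_iff)
        then have "B / (1 + x\<^sup>2)\<^sup>2 \<le> B / (1 + t\<^sup>2)\<^sup>2"
          using B pos[of t] pos[of x] by (intro divide_left_mono power_mono mult_pos_pos zero_less_power) auto
        then show "norm (kern \<phi>0 x) \<le> B / (1 + t\<^sup>2)\<^sup>2"
          using B(2)[of x] by linarith
      qed
      have "norm (G u) \<le> B / (1 + t\<^sup>2)\<^sup>2 * \<bar>t\<bar>"
      proof (cases "0 \<le> t")
        case True
        then show ?thesis
          using HI[of t "2 * t"] unfolding G_def Ku t_def[symmetric] by auto
      next
        case False
        then have "norm (H t - H (2 * t)) \<le> B / (1 + t\<^sup>2)\<^sup>2 * (t - 2 * t)"
          by (intro HI) auto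
        then show ?thesis
          using False unfolding G_def Ku t_def[symmetric] by (simp add: norm_minus_commute)
      qed
      also have "\<dots> = B * (\<bar>t\<bar> / (1 + t\<^sup>2)) * (1 / (1 + t\<^sup>2))"
        by (simp add: power2_eq_square)
      also have "\<dots> \<le> B * (1 / 2) * (4 * (1 / (1 + (2 * t)\<^sup>2)))"
      proof (intro mult_mono)
        have "2 * \<bar>t\<bar> \<le> 1 + t\<^sup>2"
          using sum_squares_bound[of 1 "\<bar>t\<bar>"] by simp
        then show "\<bar>t\<bar> / (1 + t\<^sup>2) \<le> 1 / 2"
          using pos[of t] by (simp add: divide_le_eq)
        show "1 / (1 + t\<^sup>2) \<le> 4 * (1 / (1 + (2 * t)\<^sup>2))"
          using half[of "2 * t"] by simp
      qed (use B pos[of t] in \<open>auto intro!: mult_nonneg_nonneg divide_nonneg_nonneg\<close>)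
      also have "\<dots> = 2 * B * (1 / (1 + (K * u)\<^sup>2))"
        by (simp add: Ku)
      also have "\<dots> \<le> C * (1 / (1 + (K * u)\<^sup>2))"
        using B pos[of "K * u"] by (intro mult_right_mono) (auto simp: C_def)
      finally show ?thesis .
    qed
    have cG: "continuous_on S (\<lambda>s. G (y - s))" for S
    proof (rule continuous_on_compose2[of UNIV G])
      show "continuous_on UNIV G"
        by (intro continuous_at_imp_continuous_on ballI has_vector_derivative_continuous[OF G])
    qed (auto intro!: continuous_intros)
    have "norm (integral {1..2} (\<lambda>s. G (y - s))) \<le> C * theta K 1 2 y"
    proof (rule norm_has_integral_le)
      show "((\<lambda>s. G (y - s)) has_integral integral {1..2} (\<lambda>s. G (y - s))) {1..2}"
        by (intro integrable_integral integrable_continuous_real cG)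
      show "((\<lambda>s. C * (1 / (1 + (K * (y - s))\<^sup>2))) has_integral C * theta K 1 2 y) {1..2}"
        by (intro has_integral_mult_right theta_has_integral K) auto
    qed (rule G_le)
    also have "\<dots> \<le> C * theta K 0 2 y"
      using C K by (intro mult_left_mono theta_mono) auto
    finally have "norm (G (y - z) - integral {1..2} (\<lambda>s. G (y - s))) \<le> C * (1 / (1 + (K * (y - z))\<^sup>2) + theta K 0 2 y)"
      using G_le[of "y - z"] norm_triangle_ineq4[of "G (y - z)" "integral {1..2} (\<lambda>s. G (y - s))"]
      unfolding distrib_left by linarith
    then show ?thesis
      using conv_step_antiderivative[OF kern_dyadic_continuous G, of z y] z by (simp add: K_def)
  qed
  show thesis
    by (rule that[OF C], intro kernel_slice_conv_step C kern_dyadic_continuous kb size) auto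
qed

end

section \<open>The quadrature error of balanced point sets\<close>

text \<open>Inverse to \<open>axis i 1\<close>. It translates between products over coordinates and
  the products over basis vectors by which Lebesgue measure on a Euclidean space is
  described.\<close>

definition axis_index :: "real ^ 'd::finite \<Rightarrow> 'd" where
  "axis_index v = (THE i. v = axis i 1)"

lemma axis_index_axis: "axis_index (axis i 1) = i"
  unfolding axis_index_def by (rule the_equality) (auto simp: axis_eq_axis)

lemma Basis_eq_axis: "(Basis :: (real ^ 'd::finite) set) = (\<lambda>i. axis i 1) ` UNIV"
  by (auto simp: Basis_vec_def)

lemma inj_axis: "inj (\<lambda>i. axis i (1::real) :: real ^ 'd::finite)"
  by (auto intro!: injI simp: axis_eq_axis)

lemma nn_integral_prod_vec:
  fixes g :: "'d::finite \<Rightarrow> real \<Rightarrow> ennreal"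
  assumes [measurable]: "\<And>i. g i \<in> borel_measurable borel"
  shows "(\<integral>\<^sup>+y. (\<Prod>i\<in>UNIV. g i (y $ i)) \<partial>lborel) = (\<Prod>i\<in>UNIV. \<integral>\<^sup>+x. g i x \<partial>lborel)"
proof -
  have "(\<integral>\<^sup>+y. (\<Prod>v\<in>Basis. g (axis_index v) (y \<bullet> v)) \<partial>lborel)
      = (\<Prod>v\<in>(Basis :: (real ^ 'd) set). \<integral>\<^sup>+x. g (axis_index v) x \<partial>lborel)"
    by (rule nn_integral_lborel_prod) auto
  then show ?thesis
    unfolding Basis_eq_axis prod.reindex[OF inj_axis] by (simp add: axis_index_axis inner_axis)
qed

section \<open>Geometric sums over scales\<close>

text \<open>Replacing \<open>\<kappa>\<close> by its floor costs at most a factor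
  \<open>1 / x\<close>. Then either side of the floor is part of a geometric series.\<close>

lemma sum_powr_dist_le:
  fixes x \<kappa> :: real
  assumes x: "0 < x" "x < 1" and \<kappa>: "0 \<le> \<kappa>" and F: "finite F"
  shows "(\<Sum>l\<in>F. x powr \<bar>real l - \<kappa>\<bar>) \<le> 2 / (x * (1 - x))"
proof -
  define n where "n = nat \<lfloor>\<kappa>\<rfloor>"
  have n: "real n \<le> \<kappa>" "\<kappa> < real n + 1"
    using \<kappa> unfolding n_def by linarith+
  have geom: "(\<Sum>l\<in>T. x ^ f l) \<le> 1 / (1 - x)" if "finite T" "inj_on f T" for T :: "nat set" and f
  proof -
    have "(\<Sum>l\<in>T. x ^ f l) = (\<Sum>j\<in>f ` T. x ^ j)"
      by (simp add: sum.reindex[OF that(2)])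
    also have "\<dots> \<le> (\<Sum>j. x ^ j)"
      using x that by (intro sum_le_suminf) auto
    finally show ?thesis using x by (simp add: suminf_geometric)
  qed
  have summand: "x powr \<bar>real l - \<kappa>\<bar> \<le> 1 / x * (if l \<le> n then x ^ (n - l) else x ^ (l - n))" for l
  proof -
    define e where "e = (if l \<le> n then n - l else l - n)"
    have "real e - 1 \<le> \<bar>real l - \<kappa>\<bar>"
      using n by (auto simp: e_def of_nat_diff)
    then have "x powr \<bar>real l - \<kappa>\<bar> \<le> x powr (real e - 1)"
      using x by (intro powr_mono') auto
    also have "\<dots> = 1 / x * x ^ e"
      using x by (simp add: powr_diff powr_realpow)
    finally show ?thesis by (auto simp: e_def)
  qed
  have "(\<Sum>l\<in>F. x powr \<bar>real l - \<kappa>\<bar>) \<le> (\<Sum>l\<in>F. 1 / x * (if l \<le> n then x ^ (n - l) else x ^ (l - n)))"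
    by (intro sum_mono summand)
  also have "\<dots> = 1 / x * ((\<Sum>l\<in>F \<inter> {l. l \<le> n}. x ^ (n - l)) + (\<Sum>l\<in>F \<inter> - {l. l \<le> n}. x ^ (l - n)))"
    unfolding sum_distrib_left[symmetric] using F by (subst sum.If_cases) auto
  also have "\<dots> \<le> 1 / x * (1 / (1 - x) + 1 / (1 - x))"
    using x F by (intro mult_left_mono add_mono geom) (auto intro!: inj_onI)
  also have "\<dots> = 2 / (x * (1 - x))"
    using x by (simp add: field_simps)
  finally show ?thesis .
qed

definition geometric_bound :: "real \<Rightarrow> real" where
  "geometric_bound \<delta> = 2 / (2 powr (- \<delta>) * (1 - 2 powr (- \<delta>)))"

lemma geometric_bound_pos: "0 < \<delta> \<Longrightarrow> 0 < geometric_bound \<delta>"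
  unfolding geometric_bound_def by (simp add: powr_less_one)

lemma sum_two_powr_dist_le:
  assumes "0 < \<delta>" "0 \<le> \<kappa>" "finite F"
  shows "(\<Sum>l\<in>F. 2 powr (- \<delta> * \<bar>real l - \<kappa>\<bar>)) \<le> geometric_bound \<delta>"
  using sum_powr_dist_le[of "2 powr (- \<delta>)" \<kappa> F] assms
  by (simp add: geometric_bound_def powr_powr powr_less_one)

text \<open>The summand peaks where \<open>b ^ l\<close> is about \<open>K\<close>. With
  \<open>\<kappa> = log b K\<close> it decays like
  \<open>b powr (- (1 - \<epsilon>) * (\<kappa> - l))\<close> below and like
  \<open>b powr (- \<epsilon> * (l - \<kappa>))\<close> above. Taking the smaller rate and the base
  2 makes the constant independent of \<open>b\<close> and \<open>K\<close>.\<close>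

lemma sum_levels_le:
  assumes b: "2 \<le> (b::nat)" and K: "1 \<le> K" and \<epsilon>: "0 < \<epsilon>" "\<epsilon> < 1"
  shows "(\<Sum>l\<le>L. (real b ^ l) powr (1 - \<epsilon>) / max (real b ^ l) K)
    \<le> geometric_bound (min \<epsilon> (1 - \<epsilon>)) * K powr (- \<epsilon>)"
proof -
  define \<delta> where "\<delta> = min \<epsilon> (1 - \<epsilon>)"
  define \<kappa> where "\<kappa> = log b K"
  have \<kappa>: "0 \<le> \<kappa>" using b K by (simp add: \<kappa>_def)
  have \<delta>: "0 < \<delta>" "\<delta> \<le> \<epsilon>" "\<delta> \<le> 1 - \<epsilon>" using \<epsilon> by (auto simp: \<delta>_def)
  have b1: "1 < real b" "2 \<le> real b" using b by auto
  have Kp: "K = b powr \<kappa>" using b K by (simp add: \<kappa>_def)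
  have low: "b powr (- e * \<bar>t\<bar>) \<le> 2 powr (- \<delta> * \<bar>t\<bar>)" if "\<delta> \<le> e" for e t :: real
  proof -
    have "b powr (- e * \<bar>t\<bar>) \<le> b powr (- \<delta> * \<bar>t\<bar>)"
      using b1 that by (intro powr_mono) (auto intro: mult_right_mono)
    also have "\<dots> \<le> 2 powr (- \<delta> * \<bar>t\<bar>)"
      using b1 \<delta> by (intro powr_mono2') auto
    finally show ?thesis .
  qed
  have summand: "(real b ^ l) powr (1 - \<epsilon>) / max (real b ^ l) K \<le> K powr (- \<epsilon>) * 2 powr (- \<delta> * \<bar>real l - \<kappa>\<bar>)" for l
  proof -
    have pl: "real b ^ l = b powr real l" using b by (simp add: powr_realpow)
    show ?thesis
    proof (cases "real l \<le> \<kappa>")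
      case True
      then have "max (real b ^ l) K = b powr \<kappa>"
        unfolding pl Kp using b1 by (simp add: max_def)
      then have "(real b ^ l) powr (1 - \<epsilon>) / max (real b ^ l) K = K powr (- \<epsilon>) * b powr (- (1 - \<epsilon>) * \<bar>real l - \<kappa>\<bar>)"
        unfolding pl Kp using True
        by (simp add: powr_powr powr_add[symmetric] powr_diff[symmetric] algebra_simps)
      then show ?thesis
        using low[OF \<delta>(3)] by (simp add: mult_left_mono)
    next
      case False
      then have "max (real b ^ l) K = b powr l"
        unfolding pl Kp using b1 by (simp add: max_def)
      then have "(real b ^ l) powr (1 - \<epsilon>) / max (real b ^ l) K = K powr (- \<epsilon>) * b powr (- \<epsilon> * \<bar>real l - \<kappa>\<bar>)"
        unfolding pl Kp using False
        by (simp add: powr_powr powr_add[symmetric] powr_diff[symmetric] algebra_simps)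
      then show ?thesis
        using low[OF \<delta>(2)] by (simp add: mult_left_mono)
    qed
  qed
  have "(\<Sum>l\<le>L. (real b ^ l) powr (1 - \<epsilon>) / max (real b ^ l) K)
      \<le> (\<Sum>l\<le>L. K powr (- \<epsilon>) * 2 powr (- \<delta> * \<bar>real l - \<kappa>\<bar>))"
    by (intro sum_mono summand)
  also have "\<dots> \<le> K powr (- \<epsilon>) * geometric_bound \<delta>"
    unfolding sum_distrib_left[symmetric] using sum_two_powr_dist_le[OF \<delta>(1) \<kappa>]
    by (intro mult_left_mono) auto
  finally show ?thesis by (simp add: \<delta>_def mult.commute)
qed

section \<open>Splitting the quadrature error over scales\<close>

text \<open>The abstract form of the Halton points: every box of cells, with any choice of levels,
  holds its expected number of points up to an error of 1.\<close>

locale balanced_points =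
  fixes b :: "'d::finite \<Rightarrow> nat" and P :: "(real ^ 'd) set"
  assumes base: "\<And>i. 2 \<le> b i"
    and finite_P: "finite P" and P_ne: "P \<noteq> {}" and P_cube: "P \<subseteq> unit_cube"
    and balanced: "\<And>l j. (\<And>i. j i < b i ^ l i) \<Longrightarrow>
      \<bar>real (card {z \<in> P. \<forall>i. cell_index (b i) (l i) (z $ i) = j i})
         - real (card P) / (\<Prod>i\<in>UNIV. real (b i) ^ l i)\<bar> \<le> 1"
begin

abbreviation N :: real where "N \<equiv> real (card P)"

definition cells :: "('d \<Rightarrow> nat) \<Rightarrow> ('d \<Rightarrow> nat) set" where
  "cells l = (\<Pi>\<^sub>E i\<in>UNIV. {..<b i ^ l i})"

definition cell_points :: "('d \<Rightarrow> nat) \<Rightarrow> ('d \<Rightarrow> nat) \<Rightarrow> nat" where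
  "cell_points l j = card {z \<in> P. \<forall>i. cell_index (b i) (l i) (z $ i) = j i}"

definition volume_inv :: "('d \<Rightarrow> nat) \<Rightarrow> real" where
  "volume_inv l = (\<Prod>i\<in>UNIV. real (b i) ^ l i)"

abbreviation hyperbolic_weight :: "('d \<Rightarrow> real) \<Rightarrow> ('d \<Rightarrow> nat) \<Rightarrow> real" where
  "hyperbolic_weight K l \<equiv> min (volume_inv l) N * (\<Prod>i\<in>UNIV. 1 / max (real (b i) ^ l i) (K i))"

text \<open>The summable extra term in the supremum bound. Each factor decays geometrically in the
  distance of \<open>l i\<close> from the logarithm of \<open>K i\<close> to the base
  \<open>b i\<close>.\<close>

abbreviation ratio_weight :: "('d \<Rightarrow> real) \<Rightarrow> ('d \<Rightarrow> nat) \<Rightarrow> real" where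
  "ratio_weight K l \<equiv> \<Prod>i\<in>UNIV. min (real (b i) ^ l i) (K i) / max (real (b i) ^ l i) (K i)"

abbreviation scales :: "nat \<Rightarrow> ('d \<Rightarrow> nat) set" where
  "scales L \<equiv> \<Pi>\<^sub>E i\<in>UNIV. {..L}"

abbreviation quadrature_error :: "('d \<Rightarrow> real \<Rightarrow> complex) \<Rightarrow> complex" where
  "quadrature_error h \<equiv> (\<Sum>z\<in>P. \<Prod>i\<in>UNIV. h i (z $ i)) - of_real N * (\<Prod>i\<in>UNIV. integral {0..1} (h i))"

lemma base_pos: "0 < b i"
  using base[of i] by simp

lemma volume_inv_pos: "0 < volume_inv l"
  unfolding volume_inv_def using base_pos by (intro prod_pos) auto

lemma N_ge: "1 \<le> N"
  using finite_P P_ne by (simp add: Suc_le_eq card_gt_0_iff)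

lemma cube_coord: "z \<in> P \<Longrightarrow> 0 \<le> z $ i \<and> z $ i < 1"
  using P_cube by (auto simp: unit_cube_def)

lemma finite_cells: "finite (cells l)"
  unfolding cells_def by (intro finite_PiE) auto

lemma cellsD: "j \<in> cells l \<Longrightarrow> j i < b i ^ l i"
  unfolding cells_def by auto

lemma cell_points_close:
  assumes "j \<in> cells l"
  shows "\<bar>real (cell_points l j) - N / volume_inv l\<bar> \<le> 1"
  unfolding cell_points_def volume_inv_def using cellsD[OF assms] by (rule balanced)

lemma sum_cells_prod:
  fixes g :: "'d \<Rightarrow> nat \<Rightarrow> 'a::comm_semiring_1"
  shows "(\<Sum>j\<in>cells l. \<Prod>i\<in>UNIV. g i (j i)) = (\<Prod>i\<in>UNIV. \<Sum>j<b i ^ l i. g i j)"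
  unfolding cells_def by (rule prod_sum_PiE[symmetric]) auto

lemma sum_points_cells:
  fixes g :: "'d \<Rightarrow> nat \<Rightarrow> 'a::comm_semiring_1"
  shows "(\<Sum>z\<in>P. \<Prod>i\<in>UNIV. g i (cell_index (b i) (l i) (z $ i)))
    = (\<Sum>j\<in>cells l. of_nat (cell_points l j) * (\<Prod>i\<in>UNIV. g i (j i)))"
proof -
  define q where "q z = (\<lambda>i. cell_index (b i) (l i) (z $ i))" for z :: "real ^ 'd"
  have sub: "q ` P \<subseteq> cells l"
    unfolding cells_def q_def using cube_coord by (auto intro!: cell_index_less base_pos)
  have "(\<Sum>z\<in>P. \<Prod>i\<in>UNIV. g i (q z i)) = (\<Sum>j\<in>cells l. \<Sum>z\<in>{z \<in> P. q z = j}. \<Prod>i\<in>UNIV. g i (q z i))"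
    by (rule sum.group[OF finite_P finite_cells sub, symmetric])
  also have "\<dots> = (\<Sum>j\<in>cells l. of_nat (cell_points l j) * (\<Prod>i\<in>UNIV. g i (j i)))"
  proof (intro sum.cong refl)
    fix j
    have "(\<Sum>z\<in>{z \<in> P. q z = j}. \<Prod>i\<in>UNIV. g i (q z i)) = (\<Sum>z\<in>{z \<in> P. q z = j}. \<Prod>i\<in>UNIV. g i (j i))"
      by (intro sum.cong) auto
    moreover have "{z \<in> P. q z = j} = {z \<in> P. \<forall>i. cell_index (b i) (l i) (z $ i) = j i}"
      by (auto simp: q_def fun_eq_iff)
    ultimately show "(\<Sum>z\<in>{z \<in> P. q z = j}. \<Prod>i\<in>UNIV. g i (q z i))
        = of_nat (cell_points l j) * (\<Prod>i\<in>UNIV. g i (j i))"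
      by (simp add: cell_points_def)
  qed
  finally show ?thesis
    by (simp add: q_def)
qed

text \<open>For \<open>volume_inv l \<le> N\<close> each box count deviates by at most 1, so every
  cell enters once. Otherwise a box expects less than one point, and the sum runs over the points
  themselves.\<close>

definition scale_majorant :: "('d \<Rightarrow> real) \<Rightarrow> real \<Rightarrow> ('d \<Rightarrow> nat) \<Rightarrow> real ^ 'd \<Rightarrow> real" where
  "scale_majorant K C l y =
     (if volume_inv l \<le> N
      then \<Prod>i\<in>UNIV. \<Sum>j<b i ^ l i. majorant (b i) (K i) C (l i) j (y $ i)
      else \<Sum>z\<in>P. \<Prod>i\<in>UNIV. majorant (b i) (K i) C (l i) (cell_index (b i) (l i) (z $ i)) (y $ i))"

lemma scale_majorant_nonneg:
  assumes "\<And>i. 1 \<le> K i" "0 \<le> C"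
  shows "0 \<le> scale_majorant K C l y"
proof -
  have "0 < K i" for i using assms(1)[of i] by simp
  then show ?thesis
    unfolding scale_majorant_def using assms(2)
    by (auto intro!: prod_nonneg sum_nonneg majorant_nonneg)
qed

text \<open>Multiplying out the details of all coordinates gives one sum \<open>T l\<close> for each
  choice of levels. The choice 0 reproduces exactly the integral term and cancels; each remaining
  \<open>T l\<close> is bounded in the manner that suits its box volume.\<close>

lemma norm_error_le_sum_majorant:
  assumes slice: "\<And>i. kernel_slice (b i) (K i) C (y $ i) (h i)"
    and L: "\<And>i. K i < real (b i) ^ L" "\<And>i. N < real (b i) ^ L"
  shows "norm (quadrature_error h)
    \<le> (\<Sum>l\<in>scales L. scale_majorant K C l y)"
proof -
  define T where "T l = (\<Sum>z\<in>P. \<Prod>i\<in>UNIV. detail (b i) L (h i) (l i) (z $ i))" for l :: "'d \<Rightarrow> nat"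
  let ?LL = "scales L"
  let ?o = "\<lambda>i::'d. 0::nat"
  have K: "1 \<le> K i" for i using slice[of i] by (rule kernel_slice.K)
  have C: "0 \<le> C" using slice by (rule kernel_slice.C)
  have cont: "continuous_on {0..1} (h i)" for i using slice[of i] by (rule kernel_slice.cont)
  have Lpos: "0 < L" using K L(1) by (cases L) (auto simp: not_less[symmetric])
  have "(\<Sum>z\<in>P. \<Prod>i\<in>UNIV. h i (z $ i)) = (\<Sum>z\<in>P. \<Prod>i\<in>UNIV. \<Sum>l\<le>L. detail (b i) L (h i) l (z $ i))"
    using sum_detail[OF Lpos base_pos] cube_coord by (intro sum.cong prod.cong refl) simp
  also have "\<dots> = (\<Sum>z\<in>P. \<Sum>l\<in>?LL. \<Prod>i\<in>UNIV. detail (b i) L (h i) (l i) (z $ i))"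
    by (intro sum.cong refl prod_sum_PiE) auto
  also have "\<dots> = (\<Sum>l\<in>?LL. T l)"
    unfolding T_def by (rule sum.swap)
  finally have sumT: "(\<Sum>z\<in>P. \<Prod>i\<in>UNIV. h i (z $ i)) = (\<Sum>l\<in>?LL. T l)" .
  have "detail (b i) L (h i) 0 (z $ i) = integral {0..1} (h i)" if "z \<in> P" for z i
  proof -
    have "cell_index (b i) 0 (z $ i) = 0"
      using cell_index_less[OF base_pos[of i], of "z $ i" 0] cube_coord[OF that] by simp
    then show ?thesis using Lpos by (simp add: detail_def mean_diff_0)
  qed
  then have T0: "T ?o = of_real N * (\<Prod>i\<in>UNIV. integral {0..1} (h i))"
    by (simp add: T_def)
  have fin: "finite ?LL" by (intro finite_PiE) auto
  have norm_T: "norm (T l) \<le> scale_majorant K C l y" if l: "l \<in> ?LL - {?o}" for l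
  proof (cases "volume_inv l \<le> N")
    case True
    \<comment> \<open>Each factor of \<open>volume_inv l\<close> is at most \<open>N\<close>, hence
      below \<open>b i ^ L\<close>. The pointwise remainder of level \<open>L\<close> does not
      occur, and all details are constant on cells.\<close>
    have lL: "l i < L" for i
    proof -
      have "real (b i) ^ l i \<le> volume_inv l"
        unfolding volume_inv_def using base
        by (subst prod.remove[of _ i]) (auto intro!: mult_le_cancel_left1[THEN iffD2] prod_ge_1 one_le_power
            simp: Suc_leI numeral_2_eq_2 less_imp_le base_pos)
      also have "\<dots> < real (b i) ^ L" using True L(2)[of i] by (rule le_less_trans)
      finally show ?thesis using base[of i] by (intro power_less_imp_less_exp[of "real (b i)"]) auto
    qed
    let ?g = "\<lambda>i. mean_diff (b i) (h i) (l i)"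
    obtain i0 where "l i0 \<noteq> 0" using l by auto
    \<comment> \<open>One coordinate of positive level suffices for the product of sums to vanish.
      The expected count may then be subtracted from every box count.\<close>
    then have "(\<Sum>j<b i0 ^ l i0. ?g i0 j) = 0"
      by (intro sum_mean_diff base_pos cont) simp
    then have zero: "(\<Prod>i\<in>UNIV. \<Sum>j<b i ^ l i. ?g i j) = 0"
      by (intro prod_zero) auto
    have zero': "(\<Sum>j\<in>cells l. \<Prod>i\<in>UNIV. ?g i (j i)) = 0"
      by (rule trans[OF sum_cells_prod[of ?g l] zero])
    have "T l = (\<Sum>z\<in>P. \<Prod>i\<in>UNIV. ?g i (cell_index (b i) (l i) (z $ i)))"
      using lL by (simp add: T_def detail_def)
    also have "\<dots> = (\<Sum>j\<in>cells l. of_nat (cell_points l j) * (\<Prod>i\<in>UNIV. ?g i (j i)))"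
      by (rule sum_points_cells)
    also have "\<dots> = (\<Sum>j\<in>cells l. of_nat (cell_points l j) * (\<Prod>i\<in>UNIV. ?g i (j i)))
        - of_real (N / volume_inv l) * (\<Sum>j\<in>cells l. \<Prod>i\<in>UNIV. ?g i (j i))"
      unfolding zero' by simp
    also have "\<dots> = (\<Sum>j\<in>cells l. of_real (real (cell_points l j) - N / volume_inv l) * (\<Prod>i\<in>UNIV. ?g i (j i)))"
      by (simp add: sum_distrib_left sum_subtractf[symmetric] left_diff_distrib)
    also have "norm \<dots> \<le> (\<Sum>j\<in>cells l. \<Prod>i\<in>UNIV. majorant (b i) (K i) C (l i) (j i) (y $ i))"
    proof (rule sum_norm_le)
      fix j assume j: "j \<in> cells l"
      have "norm (of_real (real (cell_points l j) - N / volume_inv l) * (\<Prod>i\<in>UNIV. ?g i (j i)))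
          = \<bar>real (cell_points l j) - N / volume_inv l\<bar> * (\<Prod>i\<in>UNIV. norm (?g i (j i)))"
        by (simp only: norm_mult norm_of_real prod_norm)
      also have "\<dots> \<le> 1 * (\<Prod>i\<in>UNIV. norm (?g i (j i)))"
        using cell_points_close[OF j] by (intro mult_right_mono prod_nonneg) auto
      also have "\<dots> \<le> (\<Prod>i\<in>UNIV. majorant (b i) (K i) C (l i) (j i) (y $ i))"
        unfolding mult_1_left using slice cellsD[OF j] by (intro prod_mono) (auto intro: kernel_slice.norm_mean_diff_le)
      finally show "norm (of_real (real (cell_points l j) - N / volume_inv l) * (\<Prod>i\<in>UNIV. ?g i (j i)))
          \<le> (\<Prod>i\<in>UNIV. majorant (b i) (K i) C (l i) (j i) (y $ i))" .
    qed
    also have "\<dots> = scale_majorant K C l y"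
      using True sum_cells_prod[of "\<lambda>i j. majorant (b i) (K i) C (l i) j (y $ i)" l]
      by (simp add: scale_majorant_def)
    finally show ?thesis .
  next
    case False
    have lL: "l i \<le> L" for i using l by (auto simp: PiE_def Pi_def)
    have "norm (T l) \<le> (\<Sum>z\<in>P. \<Prod>i\<in>UNIV. majorant (b i) (K i) C (l i) (cell_index (b i) (l i) (z $ i)) (y $ i))"
      unfolding T_def
    proof (rule sum_norm_le)
      fix z assume z: "z \<in> P"
      show "norm (\<Prod>i\<in>UNIV. detail (b i) L (h i) (l i) (z $ i))
          \<le> (\<Prod>i\<in>UNIV. majorant (b i) (K i) C (l i) (cell_index (b i) (l i) (z $ i)) (y $ i))"
        unfolding prod_norm[symmetric] using cube_coord[OF z] L(1) lL
        by (intro prod_mono) (auto intro!: kernel_slice.norm_detail_le[OF slice])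
    qed
    then show ?thesis using False by (simp add: scale_majorant_def)
  qed
  have "(\<Sum>l\<in>?LL. T l) = T ?o + (\<Sum>l\<in>?LL - {?o}. T l)"
    using fin by (subst sum.remove[of _ ?o]) auto
  then have "(\<Sum>z\<in>P. \<Prod>i\<in>UNIV. h i (z $ i)) - of_real N * (\<Prod>i\<in>UNIV. integral {0..1} (h i))
      = (\<Sum>l\<in>?LL - {?o}. T l)"
    unfolding sumT T0 by simp
  also have "norm \<dots> \<le> (\<Sum>l\<in>?LL - {?o}. scale_majorant K C l y)"
    by (intro sum_norm_le norm_T)
  also have "\<dots> \<le> (\<Sum>l\<in>?LL. scale_majorant K C l y)"
    using fin scale_majorant_nonneg[OF K C] by (intro sum_mono2) auto
  finally show ?thesis .
qed

lemma prod_majorant_const: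
  "(\<Prod>i\<in>UNIV. 24 * real (b i) * C * f i) = (\<Prod>i\<in>UNIV. 24 * real (b i) * C) * (\<Prod>i\<in>UNIV. f i)"
  by (simp add: prod.distrib)

text \<open>For small boxes the points are counted in coarse cells of levels \<open>m\<close>, with
  sides about \<open>1 / min (b i ^ l i) (K i)\<close>, where a cell holds at most
  \<open>1 + N / volume_inv m\<close> points. The summand 1 leads to the ratio weight. In the other
  summand \<open>volume_inv m\<close> cancels the numerators of the ratio weight, up to one factor
  \<open>b i\<close> per coordinate.\<close>

lemma scale_majorant_le:
  assumes K: "\<And>i. 1 \<le> K i" and C: "0 \<le> C"
  shows "scale_majorant K C l y \<le> (\<Prod>i\<in>UNIV. real (b i)) * (\<Prod>i\<in>UNIV. 24 * real (b i) * C) *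
    (hyperbolic_weight K l
      + ratio_weight K l)"
proof -
  define Q where "Q = (\<Prod>i\<in>UNIV. 24 * real (b i) * C)"
  define B where "B = (\<Prod>i\<in>UNIV. real (b i))"
  have Q: "0 \<le> Q" using C by (auto simp: Q_def intro!: prod_nonneg)
  have B: "1 \<le> B" unfolding B_def using base_pos by (intro prod_ge_1) (simp add: Suc_leI)
  have pos: "0 < real (b i) ^ n" "0 < K i" for i n using base_pos K[of i] by auto
  define G where "G = (\<Prod>i\<in>UNIV. 1 / max (real (b i) ^ l i) (K i))"
  define H where "H = ratio_weight K l"
  have GH: "0 \<le> G" "0 \<le> H"
    unfolding G_def H_def using pos by (auto intro!: prod_nonneg divide_nonneg_nonneg simp: less_imp_le max_def)
  show ?thesis
  proof (cases "volume_inv l \<le> N")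
    case True
    have "scale_majorant K C l y \<le> (\<Prod>i\<in>UNIV. 24 * real (b i) * C * min 1 (real (b i) ^ l i / K i))"
      using True K C pos(2) base unfolding scale_majorant_def
      by (auto intro!: prod_mono sum_nonneg majorant_nonneg sum_majorant_le)
    also have "\<dots> = Q * (\<Prod>i\<in>UNIV. min 1 (real (b i) ^ l i / K i))"
      unfolding Q_def by (rule prod_majorant_const)
    also have "(\<Prod>i\<in>UNIV. min 1 (real (b i) ^ l i / K i)) = volume_inv l * G"
      unfolding volume_inv_def G_def prod.distrib[symmetric]
    proof (intro prod.cong refl)
      fix i
      show "min 1 (real (b i) ^ l i / K i) = real (b i) ^ l i * (1 / max (real (b i) ^ l i) (K i))"
        using pos(1)[of i "l i"] pos(2)[of i] by (cases "real (b i) ^ l i \<le> K i") (auto simp: min_def max_def)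
    qed
    also have "Q * (volume_inv l * G) \<le> Q * (volume_inv l * G + H)"
      using Q GH by (intro mult_left_mono) auto
    also have "\<dots> \<le> B * (Q * (volume_inv l * G + H))"
      using mult_right_mono[OF B, of "Q * (volume_inv l * G + H)"] Q GH volume_inv_pos[of l] by simp
    finally show ?thesis
      using True by (simp add: Q_def B_def G_def H_def mult.assoc)
  next
    case False
    have "\<exists>m S. m \<le> l i \<and> min (real (b i) ^ l i) (K i) \<le> b i * real (b i) ^ m \<and> (\<forall>k. 0 \<le> S k) \<and>
        (\<forall>j. majorant (b i) (K i) C (l i) j (y $ i) \<le> S (j div b i ^ (l i - m))) \<and>
        (\<Sum>k<b i ^ m. S k) \<le> 24 * real (b i) * C * (min (real (b i) ^ l i) (K i) / max (real (b i) ^ l i) (K i))" for i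
      by (rule majorant_coarse[OF base[of i] K[of i] C, of "l i" "y $ i"]) blast
    then obtain m S where m: "\<And>i. m i \<le> l i"
      and m_le: "\<And>i. min (real (b i) ^ l i) (K i) \<le> b i * real (b i) ^ m i"
      and S0: "\<And>i k. 0 \<le> S i k"
      and S: "\<And>i j. majorant (b i) (K i) C (l i) j (y $ i) \<le> S i (j div b i ^ (l i - m i))"
      and S_sum: "\<And>i. (\<Sum>k<b i ^ m i. S i k)
        \<le> 24 * real (b i) * C * (min (real (b i) ^ l i) (K i) / max (real (b i) ^ l i) (K i))"
      by metis
    have "scale_majorant K C l y \<le> (\<Sum>z\<in>P. \<Prod>i\<in>UNIV. S i (cell_index (b i) (m i) (z $ i)))"
    proof -
      have "majorant (b i) (K i) C (l i) (cell_index (b i) (l i) (z $ i)) (y $ i)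
          \<le> S i (cell_index (b i) (m i) (z $ i))" if "z \<in> P" for z i
        using S[of i "cell_index (b i) (l i) (z $ i)"] cell_index_div[OF base_pos _ m, of "z $ i" i]
          cube_coord[OF that] by simp
      then show ?thesis
        using False pos(2) C by (auto simp: scale_majorant_def intro!: sum_mono prod_mono majorant_nonneg)
    qed
    also have "\<dots> = (\<Sum>j\<in>cells m. real (cell_points m j) * (\<Prod>i\<in>UNIV. S i (j i)))"
      by (rule sum_points_cells)
    also have "\<dots> \<le> (\<Sum>j\<in>cells m. (1 + N / volume_inv m) * (\<Prod>i\<in>UNIV. S i (j i)))"
      using S0 cell_points_close[of _ m] by (intro sum_mono mult_right_mono prod_nonneg) (force simp: abs_le_iff)+
    also have "\<dots> = (1 + N / volume_inv m) * (\<Prod>i\<in>UNIV. \<Sum>k<b i ^ m i. S i k)"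
      by (simp add: sum_cells_prod flip: sum_distrib_left)
    also have "\<dots> \<le> (1 + N / volume_inv m) * (Q * H)"
      unfolding Q_def H_def prod_majorant_const[symmetric] using S0 S_sum volume_inv_pos[of m] N_ge
      by (intro mult_left_mono prod_mono) (auto intro!: sum_nonneg)
    also have "\<dots> = Q * H + Q * N * (H / volume_inv m)"
      by (simp add: algebra_simps)
    also have "H / volume_inv m \<le> B * G"
      unfolding H_def volume_inv_def B_def G_def prod.distrib[symmetric] prod_dividef[symmetric]
    proof (intro prod_mono conjI)
      fix i
      let ?mn = "min (real (b i) ^ l i) (K i)" and ?mx = "max (real (b i) ^ l i) (K i)"
      have mx: "0 < ?mx" "0 \<le> ?mn" using pos[of i] by (auto simp: less_max_iff_disj less_imp_le)
      show "0 \<le> ?mn / ?mx / real (b i) ^ m i" using mx by simp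
      have "?mn / real (b i) ^ m i \<le> real (b i)"
        using m_le[of i] pos(1)[of i "m i"] by (simp add: pos_divide_le_eq)
      then have "?mn / real (b i) ^ m i / ?mx \<le> real (b i) / ?mx"
        using mx by (intro divide_right_mono) auto
      then show "?mn / ?mx / real (b i) ^ m i \<le> real (b i) * (1 / ?mx)"
        by (simp add: field_simps)
    qed
    then have "Q * H + Q * N * (H / volume_inv m) \<le> Q * H + Q * N * (B * G)"
      using Q N_ge by (intro add_left_mono mult_left_mono) auto
    also have "\<dots> \<le> B * Q * H + B * Q * (N * G)"
      using Q GH B mult_right_mono[of 1 B "Q * H"] by (simp add: mult_ac)
    finally show ?thesis
      using False by (simp add: Q_def B_def G_def H_def distrib_left mult.assoc add.commute)
  qed
qed

lemma scale_majorant_measurable [measurable]: "scale_majorant K C l \<in> borel_measurable borel"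
  unfolding scale_majorant_def by (intro measurable_If borel_measurable_prod borel_measurable_sum) measurable

text \<open>The integral of a one-dimensional majorant has the same bound for all cells, so only the
  number of products matters: \<open>volume_inv l\<close> cells or \<open>N\<close> points. How the
  points are distributed is irrelevant here, and no ratio weight appears.\<close>

lemma nn_integral_scale_majorant_le:
  assumes K: "\<And>i. 1 \<le> K i" and C: "0 \<le> C"
  shows "(\<integral>\<^sup>+y. ennreal (scale_majorant K C l y) \<partial>lborel)
    \<le> ennreal ((\<Prod>i\<in>UNIV. 24 * real (b i) * C) * (hyperbolic_weight K l))"
proof -
  let ?c = "\<lambda>i. 24 * real (b i) * C / max (real (b i) ^ l i) (K i)"
  have K0: "0 < K i" for i using K[of i] by simp
  have c0: "0 \<le> ?c i" for i using C K0[of i] by (intro divide_nonneg_nonneg) (auto simp: le_max_iff_disj)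
  have V0: "0 \<le> majorant (b i) (K i) C (l i) j x" for i j x
    using K0 C by (intro majorant_nonneg) auto
  have int: "(\<integral>\<^sup>+x. ennreal (majorant (b i) (K i) C (l i) j x) \<partial>lborel) \<le> ennreal (?c i)" for i j
    by (rule nn_integral_majorant_le[OF base K C])
  have prod_c: "(\<Prod>i\<in>UNIV. ?c i) = (\<Prod>i\<in>UNIV. 24 * real (b i) * C) * (\<Prod>i\<in>UNIV. 1 / max (real (b i) ^ l i) (K i))"
    by (simp flip: prod.distrib)
  show ?thesis
  proof (cases "volume_inv l \<le> N")
    case True
    have "(\<integral>\<^sup>+y. ennreal (scale_majorant K C l y) \<partial>lborel)
        = (\<integral>\<^sup>+y. (\<Prod>i\<in>UNIV. \<Sum>j<b i ^ l i. ennreal (majorant (b i) (K i) C (l i) j (y $ i))) \<partial>lborel)"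
      using True V0 by (simp add: scale_majorant_def sum_nonneg flip: prod_ennreal sum_ennreal)
    also have "\<dots> = (\<Prod>i\<in>UNIV. \<integral>\<^sup>+x. (\<Sum>j<b i ^ l i. ennreal (majorant (b i) (K i) C (l i) j x)) \<partial>lborel)"
      by (rule nn_integral_prod_vec) measurable
    also have "\<dots> = (\<Prod>i\<in>UNIV. \<Sum>j<b i ^ l i. \<integral>\<^sup>+x. ennreal (majorant (b i) (K i) C (l i) j x) \<partial>lborel)"
      by (intro prod.cong refl nn_integral_sum) measurable
    also have "\<dots> \<le> (\<Prod>i\<in>UNIV. \<Sum>j<b i ^ l i. ennreal (?c i))"
      by (intro prod_mono_ennreal sum_mono int)
    also have "\<dots> = (\<Prod>i\<in>UNIV. ennreal (real (b i) ^ l i * ?c i))"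
    proof (intro prod.cong refl)
      fix i
      have "(\<Sum>j<b i ^ l i. ennreal (?c i)) = ennreal (\<Sum>j<b i ^ l i. ?c i)"
        using c0 by (intro sum_ennreal) auto
      then show "(\<Sum>j<b i ^ l i. ennreal (?c i)) = ennreal (real (b i) ^ l i * ?c i)"
        by simp
    qed
    also have "\<dots> = ennreal (\<Prod>i\<in>UNIV. real (b i) ^ l i * ?c i)"
      using c0 by (intro prod_ennreal mult_nonneg_nonneg) auto
    also have "(\<Prod>i\<in>UNIV. real (b i) ^ l i * ?c i) = volume_inv l * (\<Prod>i\<in>UNIV. ?c i)"
      unfolding volume_inv_def by (rule prod.distrib)
    finally show ?thesis
      using True unfolding prod_c by (simp add: mult_ac)
  next
    case False
    have "(\<integral>\<^sup>+y. ennreal (scale_majorant K C l y) \<partial>lborel)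
        = (\<integral>\<^sup>+y. (\<Sum>z\<in>P. \<Prod>i\<in>UNIV. ennreal (majorant (b i) (K i) C (l i) (cell_index (b i) (l i) (z $ i)) (y $ i)))
            \<partial>lborel)"
      using False V0 by (simp add: scale_majorant_def prod_nonneg flip: prod_ennreal sum_ennreal)
    also have "\<dots> = (\<Sum>z\<in>P. \<integral>\<^sup>+y. (\<Prod>i\<in>UNIV. ennreal (majorant (b i) (K i) C (l i) (cell_index (b i) (l i) (z $ i)) (y $ i)))
            \<partial>lborel)"
      by (intro nn_integral_sum borel_measurable_prod) measurable
    also have "\<dots> = (\<Sum>z\<in>P. \<Prod>i\<in>UNIV. \<integral>\<^sup>+x. ennreal (majorant (b i) (K i) C (l i) (cell_index (b i) (l i) (z $ i)) x) \<partial>lborel)"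
      by (intro sum.cong refl nn_integral_prod_vec) measurable
    also have "\<dots> \<le> (\<Sum>z\<in>P. \<Prod>i\<in>UNIV. ennreal (?c i))"
      by (intro sum_mono prod_mono_ennreal int)
    also have "\<dots> = (\<Sum>z\<in>P. ennreal (\<Prod>i\<in>UNIV. ?c i))"
      using c0 by (subst prod_ennreal) auto
    also have "\<dots> = ennreal (\<Sum>z\<in>P. \<Prod>i\<in>UNIV. ?c i)"
      using c0 by (intro sum_ennreal prod_nonneg) auto
    also have "(\<Sum>z\<in>P. \<Prod>i\<in>UNIV. ?c i) = N * (\<Prod>i\<in>UNIV. ?c i)"
      by simp
    finally show ?thesis
      using False unfolding prod_c by (simp add: mult_ac)
  qed
qed

lemma sum_hyperbolic_le:
  assumes K: "\<And>i. 1 \<le> K i" and \<epsilon>: "0 < \<epsilon>" "\<epsilon> < 1"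
  shows "(\<Sum>l\<in>scales L. hyperbolic_weight K l)
    \<le> geometric_bound (min \<epsilon> (1 - \<epsilon>)) ^ CARD('d) * (N / (\<Prod>i\<in>UNIV. K i)) powr \<epsilon>"
proof -
  have K0: "0 < K i" for i using K[of i] by simp
  have mx: "0 < max (real (b i) ^ n) (K i)" for i n using K0[of i] by (simp add: less_max_iff_disj)
  have le: "min v N \<le> v powr (1 - \<epsilon>) * N powr \<epsilon>" if "0 < v" for v
  proof -
    have "min v N = min v N powr (1 - \<epsilon>) * min v N powr \<epsilon>"
      using that N_ge by (simp add: powr_add[symmetric])
    also have "\<dots> \<le> v powr (1 - \<epsilon>) * N powr \<epsilon>"
      using that N_ge \<epsilon> by (intro mult_mono powr_mono2) auto
    finally show ?thesis .
  qed
  have "(\<Sum>l\<in>scales L. hyperbolic_weight K l)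
      \<le> (\<Sum>l\<in>scales L. N powr \<epsilon> * (\<Prod>i\<in>UNIV. (real (b i) ^ l i) powr (1 - \<epsilon>) / max (real (b i) ^ l i) (K i)))"
  proof (rule sum_mono)
    fix l
    have "hyperbolic_weight K l
        \<le> volume_inv l powr (1 - \<epsilon>) * N powr \<epsilon> * (\<Prod>i\<in>UNIV. 1 / max (real (b i) ^ l i) (K i))"
      using mx by (intro mult_right_mono le volume_inv_pos prod_nonneg) (simp add: less_imp_le)
    also have "volume_inv l powr (1 - \<epsilon>) = (\<Prod>i\<in>UNIV. (real (b i) ^ l i) powr (1 - \<epsilon>))"
      unfolding volume_inv_def by (rule prod_powr_distrib)
    finally show "hyperbolic_weight K l
        \<le> N powr \<epsilon> * (\<Prod>i\<in>UNIV. (real (b i) ^ l i) powr (1 - \<epsilon>) / max (real (b i) ^ l i) (K i))"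
      by (simp add: mult_ac prod_dividef)
  qed
  also have "\<dots> = N powr \<epsilon> * (\<Prod>i\<in>UNIV. \<Sum>l\<le>L. (real (b i) ^ l) powr (1 - \<epsilon>) / max (real (b i) ^ l) (K i))"
    unfolding sum_distrib_left[symmetric] by (subst prod_sum_PiE) auto
  also have "\<dots> \<le> N powr \<epsilon> * (\<Prod>i\<in>UNIV. geometric_bound (min \<epsilon> (1 - \<epsilon>)) * K i powr (- \<epsilon>))"
    using mx by (intro mult_left_mono prod_mono conjI sum_levels_le[OF base K \<epsilon>] sum_nonneg)
      (auto simp: less_imp_le)
  also have "\<dots> = geometric_bound (min \<epsilon> (1 - \<epsilon>)) ^ CARD('d) * (N powr \<epsilon> * (\<Prod>i\<in>UNIV. K i) powr (- \<epsilon>))"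
    using K0 by (simp add: prod.distrib prod_powr_distrib less_imp_le)
  also have "N powr \<epsilon> * (\<Prod>i\<in>UNIV. K i) powr (- \<epsilon>) = (N / (\<Prod>i\<in>UNIV. K i)) powr \<epsilon>"
    using K0 by (simp add: powr_divide powr_minus_divide prod_nonneg less_imp_le)
  finally show ?thesis .
qed

text \<open>A minimum is at most the geometric mean, here
  \<open>K i powr (1 / 2) * (b i ^ l) powr (1 / 2)\<close>, which reduces the sum to
  \<open>sum_levels_le\<close> with exponent \<open>1 / 2\<close>.\<close>

lemma sum_ratio_le:
  assumes K: "\<And>i. 1 \<le> K i"
  shows "(\<Sum>l\<in>scales L. ratio_weight K l)
    \<le> geometric_bound (1 / 2) ^ CARD('d)"
proof -
  have K0: "0 < K i" for i using K[of i] by simp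
  have mx: "0 < max (real (b i) ^ n) (K i)" for i n using K0[of i] by (simp add: less_max_iff_disj)
  have "(\<Sum>l\<le>L. min (real (b i) ^ l) (K i) / max (real (b i) ^ l) (K i)) \<le> geometric_bound (1 / 2)" for i
  proof -
    have "(\<Sum>l\<le>L. min (real (b i) ^ l) (K i) / max (real (b i) ^ l) (K i))
        \<le> (\<Sum>l\<le>L. K i powr (1 / 2) * ((real (b i) ^ l) powr (1 - 1 / 2) / max (real (b i) ^ l) (K i)))"
    proof (rule sum_mono)
      fix l
      have p: "0 < real (b i) ^ l" using base_pos by simp
      let ?m = "min (real (b i) ^ l) (K i)"
      have "?m = ?m powr (1 / 2) * ?m powr (1 / 2)"
        using p K0[of i] by (simp add: powr_add[symmetric])
      also have "\<dots> \<le> K i powr (1 / 2) * (real (b i) ^ l) powr (1 / 2)"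
        using p K0[of i] by (intro mult_mono powr_mono2) auto
      finally show "?m / max (real (b i) ^ l) (K i) \<le> K i powr (1 / 2) * ((real (b i) ^ l) powr (1 - 1 / 2) / max (real (b i) ^ l) (K i))"
        using mx[of i l] by (simp add: divide_right_mono)
    qed
    also have "\<dots> \<le> K i powr (1 / 2) * (geometric_bound (1 / 2) * K i powr (- (1 / 2)))"
      unfolding sum_distrib_left[symmetric] using sum_levels_le[OF base[of i] K[of i], of "1 / 2" L]
      by (intro mult_left_mono) auto
    also have "\<dots> = geometric_bound (1 / 2)"
      using K0[of i] by (simp add: powr_minus field_simps)
    finally show ?thesis .
  qed
  then have "(\<Prod>i\<in>UNIV. \<Sum>l\<le>L. min (real (b i) ^ l) (K i) / max (real (b i) ^ l) (K i)) \<le> (\<Prod>i\<in>(UNIV::'d set). geometric_bound (1 / 2))"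
    using mx K0 by (intro prod_mono conjI sum_nonneg divide_nonneg_nonneg) (auto simp: less_imp_le)
  then show ?thesis
    by (subst (asm) prod_sum_PiE) auto
qed

end

section \<open>Fourier multipliers of regular distributions\<close>

lemma borel_measurable_vec_nth [measurable]: "(\<lambda>x::real ^ 'd. x $ i) \<in> borel_measurable borel"
  by (intro borel_measurable_continuous_onI continuous_intros)

lemma integrable_prod_vec:
  fixes g :: "'d::finite \<Rightarrow> real \<Rightarrow> complex"
  assumes g: "\<And>i. integrable lborel (g i)"
  shows "integrable lborel (\<lambda>x. \<Prod>i\<in>UNIV. g i (x $ i))"
    and "(LINT x|lborel. (\<Prod>i\<in>UNIV. g i (x $ i))) = (\<Prod>i\<in>UNIV. (LINT x|lborel. g i x))"
proof -
  have m [measurable]: "g i \<in> borel_measurable borel" for i using g[of i] by simp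
  have "(\<integral>\<^sup>+x. ennreal (norm (\<Prod>i\<in>UNIV. g i (x $ i))) \<partial>lborel)
      = (\<Prod>i\<in>UNIV. \<integral>\<^sup>+x. ennreal (norm (g i x)) \<partial>lborel)"
    using nn_integral_prod_vec[of "\<lambda>i x. ennreal (norm (g i x))"] by (simp flip: prod_norm prod_ennreal)
  also have "\<dots> < \<infinity>"
    using g by (simp add: integrable_iff_bounded less_top[symmetric] ennreal_prod_eq_top)
  finally show "integrable lborel (\<lambda>x. \<Prod>i\<in>UNIV. g i (x $ i))"
    by (intro integrableI_bounded) auto
  interpret product_sigma_finite "\<lambda>_::real ^ 'd. lborel :: real measure"
    by standard
  have nth: "(\<Sum>b\<in>Basis. f b *\<^sub>R b) $ i = f (axis i 1)" for f :: "real ^ 'd \<Rightarrow> real" and i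
    unfolding Basis_eq_axis sum.reindex[OF inj_axis] by (simp add: axis_def if_distrib[of "\<lambda>x. _ * x"] cong: if_cong)
  have "(LINT x|lborel. (\<Prod>i\<in>UNIV. g i (x $ i)))
      = (LINT f|(\<Pi>\<^sub>M b\<in>(Basis :: (real ^ 'd) set). lborel). (\<Prod>i\<in>UNIV. g i (f (axis i 1))))"
    unfolding lborel_eq[where 'a = "real ^ 'd"]
    by (subst integral_distr) (measurable, simp only: nth)
  also have "\<dots> = (LINT f|(\<Pi>\<^sub>M b\<in>(Basis :: (real ^ 'd) set). lborel). (\<Prod>v\<in>(Basis :: (real ^ 'd) set). g (axis_index v) (f v)))"
    unfolding Basis_eq_axis prod.reindex[OF inj_axis] by (simp add: axis_index_axis)
  also have "\<dots> = (\<Prod>v\<in>(Basis :: (real ^ 'd) set). (LINT x|lborel. g (axis_index v) x))"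
    using g by (intro product_integral_prod) auto
  also have "\<dots> = (\<Prod>i\<in>UNIV. (LINT x|lborel. g i x))"
    unfolding Basis_eq_axis prod.reindex[OF inj_axis] by (simp add: axis_index_axis)
  finally show "(LINT x|lborel. (\<Prod>i\<in>UNIV. g i (x $ i))) = (\<Prod>i\<in>UNIV. (LINT x|lborel. g i x))" .
qed

lemma integrable_bounded_kernel:
  fixes f :: "'a::euclidean_space \<Rightarrow> complex" and g :: "'b::euclidean_space \<Rightarrow> complex"
  assumes f: "integrable lborel f" and g: "integrable lborel g"
    and [measurable]: "case_prod k \<in> borel_measurable (lborel \<Otimes>\<^sub>M lborel)"
    and B: "\<And>x y. norm (k x y) \<le> B"
  shows "integrable (lborel \<Otimes>\<^sub>M lborel) (\<lambda>(x, y). f x * g y * k x y)"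
proof -
  have [measurable]: "f \<in> borel_measurable borel" "g \<in> borel_measurable borel"
    using f g by simp_all
  have "integrable (lborel \<Otimes>\<^sub>M lborel) (\<lambda>p. f (fst p) * g (snd p))"
    using f g by (intro lborel_pair.Fubini_integrable) (auto simp: norm_mult integrable_norm)
  then have I: "integrable (lborel \<Otimes>\<^sub>M lborel) (\<lambda>p. of_real B * (f (fst p) * g (snd p)))"
    by (rule integrable_mult_right)
  have B0: "0 \<le> B" using B[of undefined undefined] norm_ge_zero order_trans by blast
  show ?thesis
  proof (rule Bochner_Integration.integrable_bound[OF I])
    show "(\<lambda>(x, y). f x * g y * k x y) \<in> borel_measurable (lborel \<Otimes>\<^sub>M lborel)"
      by measurable
    have "norm (f x * g y * k x y) \<le> norm (of_real B * (f x * g y))" for x y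
      using mult_left_mono[OF B[of x y], of "norm (f x * g y)"] B0 by (simp add: norm_mult mult_ac)
    then show "AE p in lborel \<Otimes>\<^sub>M lborel. norm (case p of (x, y) \<Rightarrow> f x * g y * k x y) \<le> norm (of_real B * (f (fst p) * g (snd p)))"
      by (intro AE_I2) (auto simp: split_beta)
  qed
qed

lemma integral_swap_bounded_kernel:
  fixes f :: "'a::euclidean_space \<Rightarrow> complex" and g :: "'b::euclidean_space \<Rightarrow> complex"
  assumes "integrable lborel f" "integrable lborel g"
    and "case_prod k \<in> borel_measurable (lborel \<Otimes>\<^sub>M lborel)"
    and "\<And>x y. norm (k x y) \<le> B"
  shows "(LINT x|lborel. f x * (LINT y|lborel. g y * k x y)) = (LINT y|lborel. g y * (LINT x|lborel. f x * k x y))"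
proof -
  have "(LINT x|lborel. f x * (LINT y|lborel. g y * k x y)) = (LINT x|lborel. (LINT y|lborel. f x * g y * k x y))"
    by (simp add: mult.assoc)
  also have "\<dots> = (LINT y|lborel. (LINT x|lborel. f x * g y * k x y))"
    by (rule lborel_pair.Fubini_integral[OF integrable_bounded_kernel[OF assms], symmetric])
  also have "\<dots> = (LINT y|lborel. g y * (LINT x|lborel. f x * k x y))"
    by (simp add: mult.assoc mult.left_commute[of "f _"])
  finally show ?thesis .
qed

section \<open>Schwartz functions and regular distributions\<close>

lemma schwartz_continuous:
  assumes "\<eta> \<in> schwartz_space"
  shows "continuous_on UNIV \<eta>"
proof -
  have "smooth \<eta>" using assms by (simp add: schwartz_space_def)
  then have "\<eta> differentiable (at x)" for x
    unfolding smooth_def by (metis dir_derivs.simps(1) empty_set empty_subsetI)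
  then show ?thesis
    by (intro continuous_at_imp_continuous_on) (auto intro: differentiable_imp_continuous_within)
qed

lemma schwartz_measurable [measurable_dest]:
  "\<eta> \<in> schwartz_space \<Longrightarrow> \<eta> \<in> borel_measurable borel"
  by (intro borel_measurable_continuous_onI schwartz_continuous)

lemma schwartz_bound: "\<eta> \<in> schwartz_space \<Longrightarrow> \<exists>C. \<forall>x. (1 + norm x) ^ n * norm (\<eta> x) \<le> C"
  unfolding schwartz_space_def by (drule CollectD, drule conjunct2, drule spec[of _ "[]"]) simp

text \<open>A Schwartz function is dominated by a multiple of the integrable product of the
  \<open>1 / (1 + (x $ i)\<^sup>2)\<close>. Each \<open>1 + (x $ i)\<^sup>2\<close> is at most
  \<open>(1 + norm x)\<^sup>2\<close>, whence the exponent \<open>2 * CARD('d)\<close>.\<close>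

lemma schwartz_integrable:
  fixes \<eta> :: "real ^ 'd::finite \<Rightarrow> complex"
  assumes \<eta>: "\<eta> \<in> schwartz_space"
  shows "integrable lborel \<eta>"
proof -
  have [measurable]: "\<eta> \<in> borel_measurable borel" using \<eta> by measurable
  obtain C where C: "\<And>x. (1 + norm x) ^ (2 * CARD('d)) * norm (\<eta> x) \<le> C"
    using schwartz_bound[OF \<eta>] by blast
  define w :: "real \<Rightarrow> real" where "w x = 1 / (1 + (1 * (x - 0))\<^sup>2)" for x
  have w: "0 \<le> w x" "w x = 1 / (1 + x\<^sup>2)" for x by (auto simp: w_def)
  have [measurable]: "w \<in> borel_measurable borel" unfolding w_def by measurable
  let ?w = "\<lambda>x. complex_of_real (w x)"
  have "integrable lborel ?w"
  proof (rule integrableI_bounded)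
    have "norm (?w x) = 1 / (1 + (1 * (x - 0))\<^sup>2)" for x
      using w(1)[of x] by (simp only: norm_of_real abs_of_nonneg w_def)
    then have "(\<integral>\<^sup>+x. ennreal (norm (?w x)) \<partial>lborel) \<le> ennreal (4 / 1)"
      using nn_integral_cauchy_kernel[of 1 0] by (simp only:)
    then show "(\<integral>\<^sup>+x. ennreal (norm (?w x)) \<partial>lborel) < \<infinity>"
      by (rule le_less_trans) simp
  qed measurable
  then have I: "integrable lborel (\<lambda>x::real ^ 'd. of_real C * (\<Prod>i\<in>UNIV. ?w (x $ i)))"
    by (intro integrable_mult_right integrable_prod_vec)
  have "norm (\<eta> x) \<le> norm (of_real C * (\<Prod>i\<in>UNIV. ?w (x $ i)))" for x
  proof -
    have "(\<Prod>i\<in>UNIV. 1 + (x $ i)\<^sup>2) \<le> (\<Prod>i\<in>(UNIV::'d set). (1 + norm x)\<^sup>2)"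
    proof (intro prod_mono conjI)
      fix i
      have "(x $ i)\<^sup>2 \<le> (norm x)\<^sup>2"
        using power_mono[OF component_le_norm_cart abs_ge_zero, of x i 2] by simp
      then show "1 + (x $ i)\<^sup>2 \<le> (1 + norm x)\<^sup>2"
        by (simp add: power2_sum add_increasing2)
    qed (auto simp: add_nonneg_nonneg)
    also have "\<dots> = (1 + norm x) ^ (2 * CARD('d))"
      by (simp add: power_mult)
    finally have "(\<Prod>i\<in>UNIV. 1 + (x $ i)\<^sup>2) * norm (\<eta> x) \<le> C"
      using C[of x] mult_right_mono[of _ _ "norm (\<eta> x)"] by (meson norm_ge_zero order_trans)
    moreover have pos: "0 < (\<Prod>i\<in>UNIV. 1 + (x $ i)\<^sup>2)"
      by (intro prod_pos) (simp add: add_pos_nonneg)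
    ultimately have "norm (\<eta> x) \<le> C / (\<Prod>i\<in>UNIV. 1 + (x $ i)\<^sup>2)"
      by (simp add: pos_le_divide_eq mult.commute)
    also have "\<dots> = C * (\<Prod>i\<in>UNIV. w (x $ i))"
      by (simp add: prod_dividef w(2))
    also have "\<dots> \<le> \<bar>C * (\<Prod>i\<in>UNIV. w (x $ i))\<bar>"
      by simp
    also have "\<dots> = norm (of_real C * (\<Prod>i\<in>UNIV. ?w (x $ i)))"
      by (simp add: norm_mult abs_mult flip: of_real_prod)
    finally show ?thesis .
  qed
  then show ?thesis
    by (intro Bochner_Integration.integrable_bound[OF I]) auto
qed

text \<open>Only the empty list of directions has length 0, so this seminorm is the supremum norm.
  The assumed bound makes the real supremum meaningful.\<close>

lemma norm_le_deriv_seminorm: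
  assumes "\<And>y. norm (\<phi> y) \<le> B"
  shows "norm (\<phi> x) \<le> deriv_seminorm 0 0 \<phi>"
proof -
  have "{vs::'a list. set vs \<subseteq> Basis \<and> length vs \<le> 0} = {[]}" by auto
  then have "deriv_seminorm 0 0 \<phi> = (SUP x. norm (\<phi> x))"
    by (simp add: deriv_seminorm_def)
  moreover have "norm (\<phi> x) \<le> (SUP x. norm (\<phi> x))"
    using assms by (intro cSUP_upper bdd_aboveI2) auto
  ultimately show ?thesis by simp
qed

lemma regular_distribution_UNIV: "regular_distribution UNIV h \<eta> = (LINT x|lborel. h x * \<eta> x)"
  by (simp add: regular_distribution_def set_lebesgue_integral_def)

lemma integrable_mult_bounded:
  fixes f g :: "'a::euclidean_space \<Rightarrow> complex"
  assumes f: "integrable lborel f" and [measurable]: "g \<in> borel_measurable borel" and B: "\<And>x. norm (g x) \<le> B"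
  shows "integrable lborel (\<lambda>x. f x * g x)"
proof -
  have [measurable]: "f \<in> borel_measurable borel" using f by simp
  have I: "integrable lborel (\<lambda>x. of_real B * f x)" using f by simp
  have le: "norm (f x * g x) \<le> norm (of_real B * f x)" for x
    using mult_left_mono[OF B[of x], of "norm (f x)"] order_trans[OF norm_ge_zero B[of x]]
    by (simp add: norm_mult mult.commute)
  show ?thesis
    by (rule Bochner_Integration.integrable_bound[OF I _ AE_I2[OF le]]) measurable
qed

lemma norm_integral_mult_le_deriv_seminorm:
  fixes f \<phi> :: "'a::euclidean_space \<Rightarrow> complex"
  assumes f: "integrable lborel f" and [measurable]: "\<phi> \<in> borel_measurable borel" and B: "\<And>x. norm (\<phi> x) \<le> B"
  shows "norm (LINT x|lborel. f x * \<phi> x) \<le> (LINT x|lborel. norm (f x)) * deriv_seminorm 0 0 \<phi>"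
proof -
  have "norm (LINT x|lborel. f x * \<phi> x) \<le> (LINT x|lborel. norm (f x) * deriv_seminorm 0 0 \<phi>)"
    using f norm_le_deriv_seminorm[of \<phi>, OF B]
    by (intro Bochner_Integration.integral_norm_bound_integral integrable_mult_bounded[OF f _ B])
       (auto simp: norm_mult intro!: mult_left_mono)
  then show ?thesis by simp
qed

lemma regular_distribution_tempered:
  fixes f :: "real ^ 'd::finite \<Rightarrow> complex"
  assumes f: "integrable lborel f"
  shows "regular_distribution UNIV f \<in> tempered_distributions"
proof -
  have bd: "\<exists>B. \<forall>x. norm (\<eta> x) \<le> B" if "\<eta> \<in> schwartz_space" for \<eta> :: "real ^ 'd \<Rightarrow> complex"
    using schwartz_bound[OF that, of 0] by simp
  have I: "integrable lborel (\<lambda>x. f x * \<eta> x)" if "\<eta> \<in> schwartz_space" for \<eta>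
    using bd[OF that] that by (blast intro: integrable_mult_bounded[OF f] schwartz_measurable)
  have "linear_functional_on schwartz_space (regular_distribution UNIV f)"
    unfolding linear_functional_on_def regular_distribution_UNIV using I
    by (auto simp: distrib_left mult.left_commute[of "f _"])
  moreover have "\<forall>\<phi>\<in>schwartz_space. norm (regular_distribution UNIV f \<phi>)
      \<le> (LINT x|lborel. norm (f x)) * deriv_seminorm 0 0 \<phi>"
    unfolding regular_distribution_UNIV using bd
    by (blast intro: norm_integral_mult_le_deriv_seminorm[OF f] schwartz_measurable)
  ultimately show ?thesis
    unfolding tempered_distributions_def by blast
qed

section \<open>Dyadic blocks as convolutions\<close>

context lp_generator
begin

lemma integrable_dyadic: "integrable lborel (dyadic \<phi>0 k)"
proof -
  have "integrable lborel (\<lambda>t. \<phi>0 (t / c))" if "0 < c" for c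
    using integrable_cis_mult[OF that, of 0] by (simp add: cis_zero)
  from this[of 1] this[of "2 ^ k"] this[of "2 ^ (k - 1)"] show ?thesis
    by (cases k) auto
qed

definition block_kernel :: "nat ^ 'd::finite \<Rightarrow> real ^ 'd \<Rightarrow> complex" where
  "block_kernel k u = (\<Prod>i\<in>UNIV. kern (dyadic \<phi>0 (k $ i)) (u $ i))"

lemma dyadic_prod_integrable: "integrable lborel (dyadic_prod \<phi>0 (k :: nat ^ 'd::finite))"
  unfolding dyadic_prod_def[abs_def] by (intro integrable_prod_vec integrable_dyadic)

lemma block_kernel_eq:
  fixes k :: "nat ^ 'd::finite"
  shows "of_real ((1 / (2 * pi)) ^ CARD('d)) * (LINT \<xi>|lborel. dyadic_prod \<phi>0 k \<xi> * cis (u \<bullet> \<xi>)) = block_kernel k u"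
proof -
  have m: "integrable lborel (\<lambda>\<xi>. cis (u $ i * \<xi>) * dyadic \<phi>0 (k $ i) \<xi>)" for i
    using integrable_mult_bounded[OF integrable_dyadic, of "\<lambda>\<xi>. cis (u $ i * \<xi>)" 1 "k $ i"]
    by (simp add: mult.commute borel_measurable_continuous_onI continuous_intros)
  have "cis (\<Sum>i\<in>S. f i) = (\<Prod>i\<in>S. cis (f i))" if "finite S" for f :: "'d \<Rightarrow> real" and S
    using that by (induction S) (simp_all add: cis_mult[symmetric])
  then have c: "cis (u \<bullet> \<xi>) = (\<Prod>i\<in>UNIV. cis (u $ i * \<xi> $ i))" for \<xi>
    by (simp add: inner_vec_def)
  have "(LINT \<xi>|lborel. dyadic_prod \<phi>0 k \<xi> * cis (u \<bullet> \<xi>))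
      = (LINT \<xi>|lborel. (\<Prod>i\<in>UNIV. cis (u $ i * \<xi> $ i) * dyadic \<phi>0 (k $ i) (\<xi> $ i)))"
    by (simp add: dyadic_prod_def c prod.distrib mult.commute)
  also have "\<dots> = (\<Prod>i\<in>UNIV. (LINT \<xi>|lborel. cis (u $ i * \<xi>) * dyadic \<phi>0 (k $ i) \<xi>))"
    by (rule integrable_prod_vec(2)[OF m])
  finally show ?thesis
    unfolding block_kernel_def kern_def prod.distrib prod_constant by simp
qed

lemma block_kernel_bounded: "\<exists>B. \<forall>u. norm (block_kernel (k :: nat ^ 'd::finite) u) \<le> B"
proof -
  have "norm (block_kernel k u) \<le> of_real ((1 / (2 * pi)) ^ CARD('d)) * (LINT \<xi>|lborel. norm (dyadic_prod \<phi>0 k \<xi>))" for u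
    unfolding block_kernel_eq[symmetric] norm_mult using integral_norm_bound[of lborel "\<lambda>\<xi>. dyadic_prod \<phi>0 k \<xi> * cis (u \<bullet> \<xi>)"]
    by (intro mult_mono) (auto simp: norm_mult norm_power norm_divide)
  then show ?thesis by blast
qed

lemma block_kernel_measurable [measurable]: "block_kernel (k :: nat ^ 'd::finite) \<in> borel_measurable borel"
proof -
  have [measurable]: "kern (dyadic \<phi>0 n) \<in> borel_measurable borel" for n
    by (intro borel_measurable_continuous_onI kern_dyadic_continuous)
  show ?thesis unfolding block_kernel_def[abs_def] by measurable
qed

text \<open>The Fourier transforms fall on the test function and are removed by Fubini's theorem alone;
  no inversion theorem is needed.\<close>

lemma dyadic_block_regular:
  fixes f :: "real ^ 'd::finite \<Rightarrow> complex"
  assumes f: "integrable lborel f" and \<eta>: "\<eta> \<in> schwartz_space"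
  shows "dyadic_block \<phi>0 k (regular_distribution UNIV f) \<eta>
    = (LINT y|lborel. (LINT x|lborel. f x * block_kernel k (y - x)) * \<eta> y)"
proof -
  define c where "c = complex_of_real ((2 * pi) powr (- real CARD('d) / 2))"
  have cc: "c * c = of_real ((1 / (2 * pi)) ^ CARD('d))"
  proof -
    have "(2 * pi) powr (- real CARD('d) / 2) * (2 * pi) powr (- real CARD('d) / 2) = (2 * pi) powr (- real CARD('d))"
      by (subst powr_add[symmetric]) simp
    also have "\<dots> = (1 / (2 * pi)) ^ CARD('d)"
      by (simp add: powr_minus powr_realpow power_one_over inverse_eq_divide)
    finally show ?thesis unfolding c_def by (metis of_real_mult)
  qed
  have \<eta>i: "integrable lborel \<eta>" by (rule schwartz_integrable[OF \<eta>])
  have [measurable]: "\<eta> \<in> borel_measurable borel" using \<eta> by measurable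
  have cis_m [measurable]: "cis \<in> borel_measurable borel"
    by (intro borel_measurable_continuous_onI continuous_intros)
  let ?\<phi> = "dyadic_prod \<phi>0 k"
  \<comment> \<open>The exponentials of the two transforms combine to
    \<open>cis ((y - x) \<bullet> \<xi>)\<close>. Swapping the integrals leaves the transform of the
    multiplier, which is the block kernel.\<close>
  have inner: "fourier (\<lambda>\<xi>. ?\<phi> \<xi> * inv_fourier \<eta> \<xi>) x = (LINT y|lborel. \<eta> y * block_kernel k (y - x))" for x
  proof -
    have "fourier (\<lambda>\<xi>. ?\<phi> \<xi> * inv_fourier \<eta> \<xi>) x
        = c * (LINT \<xi>|lborel. cis (- (\<xi> \<bullet> x)) * (?\<phi> \<xi> * (c * (LINT y|lborel. cis (y \<bullet> \<xi>) * \<eta> y))))"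
      by (simp add: fourier_def inv_fourier_def c_def)
    also have "\<dots> = c * c * (LINT \<xi>|lborel. ?\<phi> \<xi> * (LINT y|lborel. \<eta> y * cis ((y - x) \<bullet> \<xi>)))"
    proof -
      have "cis (- (\<xi> \<bullet> x)) * (?\<phi> \<xi> * (c * (LINT y|lborel. cis (y \<bullet> \<xi>) * \<eta> y)))
          = c * (?\<phi> \<xi> * (LINT y|lborel. \<eta> y * cis ((y - x) \<bullet> \<xi>)))" for \<xi>
      proof -
        have "(LINT y|lborel. \<eta> y * cis ((y - x) \<bullet> \<xi>)) = (LINT y|lborel. cis (- (\<xi> \<bullet> x)) * (cis (y \<bullet> \<xi>) * \<eta> y))"
        proof (intro Bochner_Integration.integral_cong refl)
          fix y
          have "cis ((y - x) \<bullet> \<xi>) = cis (- (\<xi> \<bullet> x)) * cis (y \<bullet> \<xi>)"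
            by (simp add: cis_mult inner_diff_left inner_diff_right inner_commute)
          then show "\<eta> y * cis ((y - x) \<bullet> \<xi>) = cis (- (\<xi> \<bullet> x)) * (cis (y \<bullet> \<xi>) * \<eta> y)"
            by (simp only: mult_ac)
        qed
        also have "\<dots> = cis (- (\<xi> \<bullet> x)) * (LINT y|lborel. cis (y \<bullet> \<xi>) * \<eta> y)"
          by (rule integral_mult_right_zero)
        finally show ?thesis by (simp add: mult_ac)
      qed
      then show ?thesis by (simp only: mult.assoc integral_mult_right_zero)
    qed
    also have "(LINT \<xi>|lborel. ?\<phi> \<xi> * (LINT y|lborel. \<eta> y * cis ((y - x) \<bullet> \<xi>)))
        = (LINT y|lborel. \<eta> y * (LINT \<xi>|lborel. ?\<phi> \<xi> * cis ((y - x) \<bullet> \<xi>)))"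
    proof (rule integral_swap_bounded_kernel[OF dyadic_prod_integrable \<eta>i])
      have "(\<lambda>(\<xi>, y). cis ((y - x) \<bullet> \<xi>)) \<in> borel_measurable borel"
        by (intro borel_measurable_continuous_onI) (auto intro!: continuous_intros simp: split_beta)
      then show "(\<lambda>(\<xi>, y). cis ((y - x) \<bullet> \<xi>)) \<in> borel_measurable (lborel \<Otimes>\<^sub>M lborel)"
        by (simp only: lborel_prod measurable_lborel2)
      show "norm (cis ((y - x) \<bullet> \<xi>)) \<le> 1" for \<xi> y by simp
    qed
    also have "c * c * \<dots> = (LINT y|lborel. \<eta> y * block_kernel k (y - x))"
      unfolding block_kernel_eq[symmetric] cc integral_mult_right_zero[symmetric]
      by (simp add: mult.left_commute)
    finally show ?thesis .
  qed
  obtain B where B: "\<And>u. norm (block_kernel k u) \<le> B" using block_kernel_bounded by blast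
  have "dyadic_block \<phi>0 k (regular_distribution UNIV f) \<eta> = (LINT x|lborel. f x * (LINT y|lborel. \<eta> y * block_kernel k (y - x)))"
    by (simp add: dyadic_block_def dist_inv_fourier_def dist_mult_def dist_fourier_def regular_distribution_UNIV inner)
  also have "\<dots> = (LINT y|lborel. \<eta> y * (LINT x|lborel. f x * block_kernel k (y - x)))"
    by (rule integral_swap_bounded_kernel[OF f \<eta>i, where B = B]) (measurable, rule B)
  finally show ?thesis by (simp add: mult.commute)
qed

text \<open>The convolution is one of the functions over which the infimum in
  \<open>dist_Lp_norm\<close> is taken. It is bounded because \<open>f\<close> is integrable and the
  kernel bounded, so its products with Schwartz functions are integrable.\<close>

lemma dist_Lp_norm_dyadic_block_le:
  fixes f :: "real ^ 'd::finite \<Rightarrow> complex"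
  assumes f: "integrable lborel f"
  shows "dist_Lp_norm p (dyadic_block \<phi>0 k (regular_distribution UNIV f))
    \<le> Lp_norm p (\<lambda>y. LINT x|lborel. f x * block_kernel k (y - x))"
proof -
  let ?h = "\<lambda>y. LINT x|lborel. f x * block_kernel k (y - x)"
  obtain B where B: "\<And>u. norm (block_kernel k u) \<le> B" using block_kernel_bounded by blast
  have [measurable]: "f \<in> borel_measurable borel" using f by simp
  have m [measurable]: "?h \<in> borel_measurable borel" by measurable
  have h_le: "norm (?h y) \<le> (LINT x|lborel. norm (f x) * B)" for y
    using f B by (intro Bochner_Integration.integral_norm_bound_integral integrable_mult_bounded[OF f, where B = B])
      (auto simp: norm_mult intro!: mult_left_mono)
  have "integrable lborel (\<lambda>y. ?h y * \<eta> y)" if "\<eta> \<in> schwartz_space" for \<eta>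
    using integrable_mult_bounded[OF schwartz_integrable[OF that] m h_le] by (simp add: mult.commute)
  then show ?thesis
    unfolding dist_Lp_norm_def using dyadic_block_regular[OF f, of _ k] m
    by (intro Inf_lower CollectI exI[of _ ?h] conjI ballI) (auto simp: regular_distribution_UNIV)
qed

end

section \<open>An extension of the discrepancy function\<close>

text \<open>The integral of \<open>step z x\<close> over \<open>z\<close> from 0 to 1. On the unit
  interval it equals \<open>x\<close>.\<close>

definition ramp :: "real \<Rightarrow> real" where
  "ramp x = cutoff x * max 0 (min 1 x)"

lemma step_bounds: "0 \<le> step z x" "step z x \<le> 1"
  using cutoff_bounds[of x] by (auto simp: step_def)

lemma ramp_bounds: "0 \<le> ramp x" "ramp x \<le> 1"
  unfolding ramp_def using cutoff_bounds[of x] by (auto intro!: mult_le_one)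

lemma step_measurable [measurable]: "step z \<in> borel_measurable borel"
  unfolding step_def cutoff_def by measurable

lemma ramp_measurable [measurable]: "ramp \<in> borel_measurable borel"
  unfolding ramp_def cutoff_def by measurable

lemma integrable_bounded_support:
  fixes f :: "real \<Rightarrow> complex"
  assumes [measurable]: "f \<in> borel_measurable borel" and f: "\<And>x. norm (f x) \<le> B * indicator {0..2} x"
  shows "integrable lborel f"
proof (rule Bochner_Integration.integrable_bound)
  show "integrable lborel (\<lambda>x. B * indicator {0..2::real} x)"
    by simp
  show "AE x in lborel. norm (f x) \<le> norm (B * indicator {0..2} x)"
  proof (rule AE_I2)
    fix x
    show "norm (f x) \<le> norm (B * indicator {0..2} x)"
      using f[of x] abs_ge_self[of "B * indicator {0..2} x"] unfolding real_norm_def by linarith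
  qed
qed measurable

lemma integrable_weight_mult:
  fixes g :: "real \<Rightarrow> complex"
  assumes [measurable]: "e \<in> borel_measurable borel" "g \<in> borel_measurable borel"
    and e: "\<And>x. 0 \<le> e x" "\<And>x. e x \<le> 1" "\<And>x. x \<notin> {0..2} \<Longrightarrow> e x = 0"
    and B: "\<And>x. norm (g x) \<le> B"
  shows "integrable lborel (\<lambda>x. of_real (e x) * g x)"
proof (rule integrable_bounded_support)
  fix x
  have "norm (of_real (e x) * g x) \<le> 1 * norm (g x)"
    unfolding norm_mult using e(1,2)[of x] by (intro mult_right_mono) auto
  then show "norm (of_real (e x) * g x) \<le> B * indicator {0..2} x"
    using B[of x] e(3)[of x] by (cases "x \<in> {0..2}") auto
qed measurable

lemma integrable_step_mult:
  fixes g :: "real \<Rightarrow> complex"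
  assumes "0 \<le> z" "g \<in> borel_measurable borel" "\<And>x. norm (g x) \<le> B"
  shows "integrable lborel (\<lambda>x. of_real (step z x) * g x)"
  using assms step_bounds by (intro integrable_weight_mult[where B = B] step_measurable) (auto simp: step_def cutoff_def)

lemma integrable_ramp_mult:
  fixes g :: "real \<Rightarrow> complex"
  assumes "g \<in> borel_measurable borel" "\<And>x. norm (g x) \<le> B"
  shows "integrable lborel (\<lambda>x. of_real (ramp x) * g x)"
  using assms ramp_bounds by (intro integrable_weight_mult[where B = B] ramp_measurable) (auto simp: ramp_def cutoff_def)

lemma integral_step_eq_ramp:
  "(LINT z|lborel. indicator {0..1} z * of_real (step z x)) = (of_real (ramp x) :: complex)"
proof -
  have eq: "(indicator {0..1} z * of_real (step z x) :: complex) = of_real (cutoff x * indicator ({0..1} \<inter> {..<x}) z)" for z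
    by (auto simp: step_def indicator_def)
  have "measure lborel ({0..1} \<inter> {..<x}) = max 0 (min 1 x)"
  proof -
    consider "x \<le> 0" | "0 < x" "x \<le> 1" | "1 < x" by linarith
    then show ?thesis
    proof cases
      case 1
      then have "{0..1} \<inter> {..<x} = {}" by auto
      then show ?thesis using 1 by simp
    next
      case 2
      then have "{0..1} \<inter> {..<x} = {0..<x}" by auto
      then show ?thesis using 2 by simp
    next
      case 3
      then have "{0..1} \<inter> {..<x} = {0..1}" by auto
      then show ?thesis using 3 by simp
    qed
  qed
  moreover have "emeasure lborel ({0..1} \<inter> {..<x}) < \<infinity>"
  proof -
    have "emeasure lborel ({0..1} \<inter> {..<x}) \<le> emeasure lborel {0..1::real}"
      by (intro emeasure_mono) auto
    also have "\<dots> < \<infinity>" by simp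
    finally show ?thesis .
  qed
  ultimately have "(LINT z|lborel. cutoff x * indicator ({0..1} \<inter> {..<x}) z) = ramp x"
    by (simp add: ramp_def)
  then show ?thesis
    unfolding eq integral_complex_of_real by simp
qed

lemma integral_ramp_conv:
  fixes g :: "real \<Rightarrow> complex"
  assumes g: "continuous_on UNIV g" and B: "\<And>x. norm (g x) \<le> B"
    and cont: "continuous_on {0..1} (\<lambda>z. conv_step g z y)"
  shows "(LINT x|lborel. of_real (ramp x) * g (y - x)) = integral {0..1} (\<lambda>z. conv_step g z y)"
proof -
  have [measurable]: "g \<in> borel_measurable borel"
    using g by (rule borel_measurable_continuous_onI)
  \<comment> \<open>For \<open>z\<close> in the unit interval \<open>step z\<close> vanishes outside
    \<open>{0..2}\<close>. Inserting the indicator \<open>?v\<close> therefore changes nothing, and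
    it supplies the integrable factor for Fubini's theorem.\<close>
  let ?u = "\<lambda>z::real. indicator {0..1} z :: complex" and ?v = "\<lambda>x::real. indicator {0..2} x :: complex"
  let ?k = "\<lambda>z x. of_real (step z x) * g (y - x)"
  have u: "integrable lborel ?u" and v: "integrable lborel ?v"
    by (auto intro!: integrable_bounded_support[where B = 1] simp: indicator_def)
  have "(\<lambda>(z, x). step z x) \<in> borel_measurable (lborel \<Otimes>\<^sub>M lborel)"
    unfolding step_def cutoff_def by measurable
  then have k: "case_prod ?k \<in> borel_measurable (lborel \<Otimes>\<^sub>M lborel)"
    by (simp add: split_beta')
  have k_le: "norm (?k z x) \<le> B" for z x
  proof -
    have "norm (?k z x) \<le> 1 * norm (g (y - x))"
      unfolding norm_mult using step_bounds[of z x] by (intro mult_right_mono) auto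
    then show ?thesis using B[of "y - x"] by simp
  qed
  have "integral {0..1} (\<lambda>z. conv_step g z y) = (LINT z|lborel. ?u z * conv_step g z y)"
    unfolding lborel_integral_eq_integral_Icc(1)[OF cont, symmetric]
    by (intro Bochner_Integration.integral_cong) (auto simp: indicator_def)
  also have "\<dots> = (LINT z|lborel. ?u z * (LINT x|lborel. ?v x * ?k z x))"
  proof (intro Bochner_Integration.integral_cong refl)
    fix z
    have "(LINT x|lborel. ?v x * ?k z x) = conv_step g z y" if "z \<in> {0..1}"
      unfolding conv_step_def using that
      by (intro Bochner_Integration.integral_cong) (auto simp: indicator_def step_def cutoff_def)
    then show "?u z * conv_step g z y = ?u z * (LINT x|lborel. ?v x * ?k z x)"
      by (auto simp: indicator_def)
  qed
  also have "\<dots> = (LINT x|lborel. ?v x * (LINT z|lborel. ?u z * ?k z x))"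
    by (rule integral_swap_bounded_kernel[OF u v k k_le])
  also have "\<dots> = (LINT x|lborel. of_real (ramp x) * g (y - x))"
  proof (intro Bochner_Integration.integral_cong refl)
    fix x
    have "(LINT z|lborel. ?u z * ?k z x) = of_real (ramp x) * g (y - x)"
      unfolding mult.assoc[symmetric] integral_mult_left_zero integral_step_eq_ramp ..
    moreover have "x \<notin> {0..2} \<Longrightarrow> ramp x = 0"
      by (auto simp: ramp_def cutoff_def)
    ultimately show "?v x * (LINT z|lborel. ?u z * ?k z x) = of_real (ramp x) * g (y - x)"
      by (auto simp: indicator_def)
  qed
  finally show ?thesis ..
qed

text \<open>The function \<open>f\<close> of the introduction. The cutoff acts on each coordinate
  separately, so all terms remain tensor products and their convolutions with tensor kernels
  factorise.\<close>

definition extension :: "(real ^ 'd::finite) set \<Rightarrow> real ^ 'd \<Rightarrow> complex" where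
  "extension P x = of_real (1 / real (card P)) * (\<Sum>z\<in>P. \<Prod>i\<in>UNIV. of_real (step (z $ i) (x $ i)))
     - (\<Prod>i\<in>UNIV. of_real (ramp (x $ i)))"

lemma extension_integrable:
  assumes "P \<subseteq> unit_cube"
  shows "integrable lborel (extension P)"
proof -
  have "integrable lborel (\<lambda>x. \<Prod>i\<in>UNIV. complex_of_real (step (z $ i) (x $ i)))" if "z \<in> P" for z
    using integrable_step_mult[of _ "\<lambda>_. 1" 1] that assms
    by (intro integrable_prod_vec) (auto simp: unit_cube_def)
  moreover have "integrable lborel (\<lambda>x::real ^ 'a. \<Prod>i\<in>UNIV. complex_of_real (ramp (x $ i)))"
    using integrable_ramp_mult[of "\<lambda>_. 1" 1] by (intro integrable_prod_vec) auto
  ultimately show ?thesis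
    unfolding extension_def[abs_def] by (intro Bochner_Integration.integrable_diff integrable_mult_right Bochner_Integration.integrable_sum)
qed

lemma extension_eq_discrepancy:
  assumes P: "P \<subseteq> unit_cube" and x: "x \<in> unit_cube"
  shows "extension P x = of_real (discrepancy P x)"
proof -
  have "(\<Prod>i\<in>UNIV. step (z $ i) (x $ i)) = indicator {y. \<forall>i. 0 \<le> y $ i \<and> y $ i < x $ i} z" if "z \<in> P" for z
  proof (cases "\<forall>i. z $ i < x $ i")
    case True
    have "x $ i < 1" "0 \<le> z $ i" for i
      using x P that by (auto simp: unit_cube_def)
    then show ?thesis
      using True by (simp add: step_def cutoff_def less_imp_le)
  next
    case False
    then obtain i where "\<not> z $ i < x $ i" by blast
    then have "(\<Prod>i\<in>UNIV. step (z $ i) (x $ i)) = 0"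
      by (intro prod_zero) (auto simp: step_def)
    then show ?thesis using False by (auto simp: indicator_def)
  qed
  moreover have "ramp (x $ i) = x $ i" for i
  proof -
    have "0 \<le> x $ i" "x $ i < 1" using x by (auto simp: unit_cube_def)
    then show ?thesis by (simp add: ramp_def cutoff_def)
  qed
  ultimately show ?thesis
    by (simp add: extension_def discrepancy_def flip: of_real_prod of_real_sum)
qed

lemma discrepancy_mult_test_function:
  assumes P: "P \<subseteq> unit_cube" and \<phi>: "\<phi> \<in> test_functions (interior unit_cube)"
  shows "indicator unit_cube x *\<^sub>R of_real (discrepancy P x) * \<phi> x = extension P x * \<phi> x"
proof (cases "x \<in> unit_cube")
  case True
  then show ?thesis by (simp add: extension_eq_discrepancy[OF P])
next
  case False
  then have "x \<notin> closure {x. \<phi> x \<noteq> 0}"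
    using \<phi> interior_subset by (fastforce simp: test_functions_def)
  then have "\<phi> x = 0" using closure_subset[of "{x. \<phi> x \<noteq> 0}"] by auto
  then show ?thesis by simp
qed

lemma discrepancy_distribution_eq:
  assumes P: "P \<subseteq> unit_cube" and \<phi>: "\<phi> \<in> test_functions (interior unit_cube)"
  shows "discrepancy_distribution P \<phi> = regular_distribution UNIV (extension P) \<phi>"
  using discrepancy_mult_test_function[OF assms]
  by (simp add: discrepancy_distribution_def regular_distribution_def set_lebesgue_integral_def)

lemma test_function_measurable_bounded:
  fixes \<phi> :: "'a::euclidean_space \<Rightarrow> complex"
  assumes \<phi>: "\<phi> \<in> test_functions U"
  shows "\<phi> \<in> borel_measurable borel" "\<exists>B. \<forall>x. norm (\<phi> x) \<le> B"
proof -
  have "smooth \<phi>" using \<phi> by (simp add: test_functions_def)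
  then have "\<phi> differentiable (at x)" for x
    unfolding smooth_def by (metis dir_derivs.simps(1) empty_set empty_subsetI)
  then have cont: "continuous_on S \<phi>" for S
    by (intro continuous_at_imp_continuous_on) (auto intro: differentiable_imp_continuous_within)
  then show "\<phi> \<in> borel_measurable borel"
    by (rule borel_measurable_continuous_onI)
  have "compact (\<phi> ` closure {x. \<phi> x \<noteq> 0})"
    using \<phi> by (intro compact_continuous_image cont) (simp add: test_functions_def)
  then obtain B where B: "\<forall>v\<in>\<phi> ` closure {x. \<phi> x \<noteq> 0}. norm v \<le> B"
    using compact_imp_bounded bounded_iff by metis
  have "norm (\<phi> x) \<le> max B 0" for x
  proof (cases "\<phi> x = 0")
    case False
    then have "x \<in> closure {x. \<phi> x \<noteq> 0}" using closure_subset[of "{x. \<phi> x \<noteq> 0}"] by auto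
    then show ?thesis using B by (simp add: le_max_iff_disj)
  qed simp
  then show "\<exists>B. \<forall>x. norm (\<phi> x) \<le> B" by blast
qed

text \<open>Test functions supported in the cube do not distinguish the discrepancy from its
  integrable extension, which yields integrability and a bound by the supremum norm.\<close>

lemma discrepancy_distribution_is_distribution:
  fixes P :: "(real ^ 'd::finite) set"
  assumes P: "P \<subseteq> unit_cube"
  shows "discrepancy_distribution P \<in> distributions (interior unit_cube)"
proof -
  note f = extension_integrable[OF P]
  let ?V = "test_functions (interior unit_cube) :: (real ^ 'd \<Rightarrow> complex) set"
  define F where "F x = indicator unit_cube x *\<^sub>R complex_of_real (discrepancy P x)" for x
  have unfold: "discrepancy_distribution P \<phi> = (LINT x|lborel. F x * \<phi> x)" for \<phi>
    by (simp add: F_def discrepancy_distribution_def regular_distribution_def set_lebesgue_integral_def)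
  have I: "integrable lborel (\<lambda>x. F x * \<phi> x)" if "\<phi> \<in> ?V" for \<phi>
  proof -
    have "integrable lborel (\<lambda>x. extension P x * \<phi> x)"
      using test_function_measurable_bounded[OF that] by (blast intro: integrable_mult_bounded[OF f])
    moreover have "F x * \<phi> x = extension P x * \<phi> x" for x
      unfolding F_def by (rule discrepancy_mult_test_function[OF P that])
    ultimately show ?thesis by (simp only:)
  qed
  have "linear_functional_on ?V (discrepancy_distribution P)"
    unfolding linear_functional_on_def unfold using I
    by (auto simp: distrib_left mult.left_commute[of "F _"])
  moreover have "norm (discrepancy_distribution P \<phi>) \<le> (LINT x|lborel. norm (extension P x)) * deriv_seminorm 0 0 \<phi>"
    if \<phi>: "\<phi> \<in> ?V" for \<phi>
  proof -
    obtain B where "\<And>x. norm (\<phi> x) \<le> B"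
      using test_function_measurable_bounded(2)[OF \<phi>] by blast
    then show ?thesis
      unfolding discrepancy_distribution_eq[OF P \<phi>] regular_distribution_UNIV
      by (intro norm_integral_mult_le_deriv_seminorm f test_function_measurable_bounded(1)[OF \<phi>])
  qed
  ultimately show ?thesis
    unfolding distributions_def by blast
qed

context lp_generator
begin

lemma kern_dyadic_bounded: "\<exists>B. \<forall>u. norm (kern (dyadic \<phi>0 k) u) \<le> B"
proof -
  have "norm (kern (dyadic \<phi>0 k) u) \<le> norm (complex_of_real (1 / (2 * pi))) * (LINT \<xi>|lborel. norm (dyadic \<phi>0 k \<xi>))" for u
    unfolding kern_def norm_mult using integral_norm_bound[of lborel "\<lambda>\<xi>. cis (u * \<xi>) * dyadic \<phi>0 k \<xi>"]
    by (intro mult_left_mono) (auto simp: norm_mult)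
  then show ?thesis by blast
qed

text \<open>The convolution factorises over the coordinates. Since \<open>ramp\<close> averages
  \<open>step\<close>, the volume term becomes a product of integrals of the functions that are
  evaluated at the points, and a quadrature error results.\<close>

lemma extension_conv_block_kernel:
  fixes P :: "(real ^ 'd::finite) set"
  assumes P: "P \<subseteq> unit_cube" "finite P" "P \<noteq> {}"
  shows "(LINT x|lborel. extension P x * block_kernel k (y - x)) = of_real (1 / real (card P)) *
    ((\<Sum>z\<in>P. \<Prod>i\<in>UNIV. conv_step (kern (dyadic \<phi>0 (k $ i))) (z $ i) (y $ i))
      - of_real (real (card P)) * (\<Prod>i\<in>UNIV. integral {0..1} (\<lambda>z. conv_step (kern (dyadic \<phi>0 (k $ i))) z (y $ i))))"
proof -
  let ?g = "\<lambda>i. kern (dyadic \<phi>0 (k $ i))"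
  have gc: "continuous_on S (?g i)" for i S by (rule kern_dyadic_continuous)
  have [measurable]: "?g i \<in> borel_measurable borel" for i
    by (intro borel_measurable_continuous_onI gc)
  have "\<exists>B. \<forall>u. norm (?g i u) \<le> B" for i by (rule kern_dyadic_bounded)
  then obtain B where B: "\<And>i u. norm (?g i u) \<le> B i" by metis
  have st: "integrable lborel (\<lambda>x. of_real (step z x) * ?g i (y $ i - x))" if "0 \<le> z" for z i
    using that B by (intro integrable_step_mult[where B = "B i"]) auto
  have rm: "integrable lborel (\<lambda>x. of_real (ramp x) * ?g i (y $ i - x))" for i
    using B by (intro integrable_ramp_mult[where B = "B i"]) auto
  have z0: "0 \<le> z $ i" if "z \<in> P" for z i using P that by (auto simp: unit_cube_def)
  obtain C where "0 \<le> C"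
    and C: "\<And>b k y. 2 \<le> b \<Longrightarrow> kernel_slice b (2 ^ k) C y (\<lambda>z. conv_step (kern (dyadic \<phi>0 k)) z y)"
    using kernel_slices by metis
  have cont: "continuous_on {0..1} (\<lambda>z. conv_step (?g i) z (y $ i))" for i
    \<comment> \<open>Continuity does not involve the base, so any admissible base serves.\<close>
    by (rule kernel_slice.cont[OF C[of 2]]) simp
  have e: "extension P x * block_kernel k (y - x) =
      of_real (1 / real (card P)) * (\<Sum>z\<in>P. \<Prod>i\<in>UNIV. of_real (step (z $ i) (x $ i)) * ?g i (y $ i - x $ i))
      - (\<Prod>i\<in>UNIV. of_real (ramp (x $ i)) * ?g i (y $ i - x $ i))" for x
    by (simp only: extension_def block_kernel_def left_diff_distrib mult.assoc sum_distrib_right prod.distrib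
        vector_minus_component)
  have I1: "integrable lborel (\<lambda>x. \<Prod>i\<in>UNIV. of_real (step (z $ i) (x $ i)) * ?g i (y $ i - x $ i))" if "z \<in> P" for z
    by (intro integrable_prod_vec(1)[of "\<lambda>i x. of_real (step (z $ i) x) * ?g i (y $ i - x)"] st z0 that)
  have I2: "integrable lborel (\<lambda>x. \<Prod>i\<in>UNIV. of_real (ramp (x $ i)) * ?g i (y $ i - x $ i))"
    by (intro integrable_prod_vec(1)[of "\<lambda>i x. of_real (ramp x) * ?g i (y $ i - x)"] rm)
  have v1: "(LINT x|lborel. (\<Prod>i\<in>UNIV. of_real (step (z $ i) (x $ i)) * ?g i (y $ i - x $ i)))
      = (\<Prod>i\<in>UNIV. conv_step (?g i) (z $ i) (y $ i))" if "z \<in> P" for z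
    using integrable_prod_vec(2)[of "\<lambda>i x. of_real (step (z $ i) x) * ?g i (y $ i - x)", OF st[OF z0[OF that]]]
    by (simp add: conv_step_def)
  have v2: "(LINT x|lborel. (\<Prod>i\<in>UNIV. of_real (ramp (x $ i)) * ?g i (y $ i - x $ i)))
      = (\<Prod>i\<in>UNIV. integral {0..1} (\<lambda>z. conv_step (?g i) z (y $ i)))"
    using integrable_prod_vec(2)[of "\<lambda>i x. of_real (ramp x) * ?g i (y $ i - x)", OF rm]
      integral_ramp_conv[OF gc B cont] by simp
  have "(LINT x|lborel. extension P x * block_kernel k (y - x)) = of_real (1 / real (card P)) *
      (\<Sum>z\<in>P. \<Prod>i\<in>UNIV. conv_step (?g i) (z $ i) (y $ i))
      - (\<Prod>i\<in>UNIV. integral {0..1} (\<lambda>z. conv_step (?g i) z (y $ i)))"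
    unfolding e using I1 I2 v1 v2
    by (subst Bochner_Integration.integral_diff)
       (auto simp: Bochner_Integration.integral_sum intro!: integrable_mult_right Bochner_Integration.integrable_sum)
  then show ?thesis
    using P by (simp add: right_diff_distrib)
qed

end

section \<open>Norms of the dyadic blocks\<close>

abbreviation level :: "nat ^ 'd::finite \<Rightarrow> nat" where
  "level k \<equiv> \<Sum>i\<in>UNIV. k $ i"

abbreviation concentrated_blocks ::
  "(real \<Rightarrow> complex) \<Rightarrow> ennreal \<Rightarrow> real \<Rightarrow> real \<Rightarrow> real \<Rightarrow> real
     \<Rightarrow> ((real ^ 'd::finite \<Rightarrow> complex) \<Rightarrow> complex) \<Rightarrow> bool" where
  "concentrated_blocks \<phi>0 p r \<delta> A \<nu> T \<equiv>
     \<forall>k. ennreal (2 powr (r * real (level k))) * dist_Lp_norm p (dyadic_block \<phi>0 k T)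
       \<le> ennreal (A * 2 powr (- \<delta> * \<bar>real (level k) - \<nu>\<bar>))"

lemma balanced_points_halton:
  fixes b :: "'d::finite \<Rightarrow> nat"
  assumes b: "\<And>i. 2 \<le> b i" and cop: "\<And>i j. i \<noteq> j \<Longrightarrow> coprime (b i) (b j)" and N: "1 \<le> N"
  shows "balanced_points b (halton b ` {..<N})" "card (halton b ` {..<N}) = N"
proof -
  show card: "card (halton b ` {..<N}) = N"
    using inj_halton[of b] b by (subst card_image) (auto intro: inj_on_subset)
  have cube: "halton b ` {..<N} \<subseteq> unit_cube"
    using radical_inverse_bounds[OF b] by (auto simp: halton_def unit_cube_def)
  show "balanced_points b (halton b ` {..<N})"
  proof
    fix l j assume j: "\<And>i. j i < b i ^ l i"
    have "{z \<in> halton b ` {..<N}. \<forall>i. cell_index (b i) (l i) (z $ i) = j i}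
        = {z \<in> halton b ` {..<N}. \<forall>i. \<lfloor>real (b i) ^ l i * z $ i\<rfloor> = int (j i)}"
    proof -
      have "cell_index (b i) (l i) (z $ i) = j i \<longleftrightarrow> \<lfloor>real (b i) ^ l i * z $ i\<rfloor> = int (j i)"
        if "z \<in> halton b ` {..<N}" for z i
      proof -
        have "0 \<le> z $ i" using cube that by (auto simp: unit_cube_def)
        then have "0 \<le> \<lfloor>real (b i) ^ l i * z $ i\<rfloor>" by simp
        then show ?thesis by (simp add: cell_index_def nat_eq_iff)
      qed
      then show ?thesis by blast
    qed
    then show "\<bar>real (card {z \<in> halton b ` {..<N}. \<forall>i. cell_index (b i) (l i) (z $ i) = j i})
        - real (card (halton b ` {..<N})) / (\<Prod>i\<in>UNIV. real (b i) ^ l i)\<bar> \<le> 1"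
      using card_halton_box[of b j l N, OF b cop j] card by simp
  next
    show "halton b ` {..<N} \<noteq> {}" using N by (auto simp: lessThan_empty_iff)
  qed (use b cube in auto)
qed

section \<open>Interpolation between integral and supremum bounds\<close>

lemma ennpowr_ennreal: "0 \<le> t \<Longrightarrow> ennpowr (ennreal t) a = ennreal (t powr a)"
  by (simp add: ennpowr_def)

lemma ennpowr_mono:
  assumes "x \<le> y" "0 \<le> a"
  shows "ennpowr x a \<le> ennpowr y a"
proof (cases "y = \<infinity>")
  case False
  then have "x \<noteq> \<infinity>" using assms by (auto simp: top_unique)
  then show ?thesis
    using False assms by (auto simp: ennpowr_def less_top intro!: ennreal_leI powr_mono2 enn2real_mono)
qed (simp add: ennpowr_def)

text \<open>From \<open>M x \<le> s\<close> follows
  \<open>M x powr p \<le> s powr (p - 1) * M x\<close>, and the remaining first power is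
  integrated.\<close>

lemma Lp_norm_le_interpolation:
  fixes h :: "'a::euclidean_space \<Rightarrow> complex"
  assumes p: "1 \<le> p" and a: "0 \<le> a" and [measurable]: "M \<in> borel_measurable borel"
    and h: "\<And>x. norm (h x) \<le> a * M x" and M: "\<And>x. 0 \<le> M x" "\<And>x. M x \<le> s"
    and t: "0 \<le> t" "(\<integral>\<^sup>+x. ennreal (M x) \<partial>lborel) \<le> ennreal t"
  shows "Lp_norm (ennreal p) h \<le> ennreal (a * (s powr (p - 1) * t) powr (1 / p))"
proof -
  have "0 \<le> s" using M[of undefined] by simp
  have "norm (h x) powr p \<le> a powr p * s powr (p - 1) * M x" for x
  proof -
    have "norm (h x) powr p \<le> (a * M x) powr p"
      using h p by (intro powr_mono2) auto
    also have "\<dots> = a powr p * (M x powr (p - 1) * M x)"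
    proof (cases "M x = 0")
      case False
      then have "M x powr p = M x powr (p - 1) * M x"
        using powr_add[of "M x" "p - 1" 1] M(1)[of x] by simp
      then show ?thesis using a M(1)[of x] by (simp add: powr_mult)
    qed (use p in simp)
    also have "\<dots> \<le> a powr p * (s powr (p - 1) * M x)"
      using M p by (intro mult_left_mono mult_right_mono powr_mono2) auto
    finally show ?thesis by (simp add: mult.assoc)
  qed
  then have "(\<integral>\<^sup>+x. ennreal (norm (h x) powr p) \<partial>lborel) \<le> (\<integral>\<^sup>+x. ennreal (a powr p * s powr (p - 1)) * ennreal (M x) \<partial>lborel)"
    by (intro nn_integral_mono) (simp flip: ennreal_mult' add: ennreal_leI)
  also have "\<dots> = ennreal (a powr p * s powr (p - 1)) * (\<integral>\<^sup>+x. ennreal (M x) \<partial>lborel)"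
    by (rule nn_integral_cmult) measurable
  also have "\<dots> \<le> ennreal (a powr p * s powr (p - 1)) * ennreal t"
    by (intro mult_left_mono t) simp
  also have "\<dots> = ennreal (a powr p * (s powr (p - 1) * t))"
    using t by (simp add: mult.assoc flip: ennreal_mult)
  finally have "ennpowr (\<integral>\<^sup>+x. ennreal (norm (h x) powr p) \<partial>lborel) (1 / p)
      \<le> ennpowr (ennreal (a powr p * (s powr (p - 1) * t))) (1 / p)"
    using p by (intro ennpowr_mono) auto
  also have "\<dots> = ennreal ((a powr p * (s powr (p - 1) * t)) powr (1 / p))"
    using t by (intro ennpowr_ennreal) auto
  also have "(a powr p * (s powr (p - 1) * t)) powr (1 / p) = a * (s powr (p - 1) * t) powr (1 / p)"
    using a t p by (simp add: powr_mult powr_powr)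
  finally show ?thesis
    using p by (simp add: Lp_norm_def)
qed

text \<open>For \<open>1 \<le> X\<close> also \<open>1 \<le> m\<close>, so both bounds are of order
  \<open>R * m\<close>, and \<open>m \<le> X powr \<epsilon>\<close>. For \<open>X < 1\<close> the
  supremum bound is merely \<open>2 * R\<close>; the smallness
  \<open>m \<le> X powr (1 - \<epsilon>)\<close> of the integral bound survives under the
  \<open>p\<close>-th root.\<close>

lemma interpolation_factor_le:
  fixes X :: real
  assumes X: "0 < X" and p: "1 \<le> p" and \<epsilon>: "0 < \<epsilon>" "\<epsilon> \<le> 1 / 2"
    and R: "0 \<le> R" and m: "m = min (X powr \<epsilon>) (X powr (1 - \<epsilon>))"
  shows "((R * (m + 1)) powr (p - 1) * (R * m)) powr (1 / p)
    \<le> 2 * R * (if 1 \<le> X then X powr \<epsilon> else X powr ((1 - \<epsilon>) / p))"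
proof -
  have m0: "0 < m" using X by (simp add: m)
  define w where "w = (if 1 \<le> X then m powr p else m)"
  have w: "(m + 1) powr (p - 1) * m \<le> 2 powr p * w"
  proof (cases "1 \<le> X")
    case True
    then have m1: "1 \<le> m" using \<epsilon> by (simp add: m ge_one_powr_ge_zero)
    then have "(m + 1) powr (p - 1) * m \<le> (2 * m) powr (p - 1) * (2 * m)"
      using p by (intro mult_mono powr_mono2) auto
    also have "\<dots> = (2 * m) powr p"
      using powr_add[of "2 * m" "p - 1" 1] m0 by simp
    also have "\<dots> = 2 powr p * w"
      using m0 True by (simp add: w_def powr_mult)
    finally show ?thesis .
  next
    case False
    then have "X powr (1 - \<epsilon>) \<le> 1"
      using X \<epsilon> by (intro powr_le1) auto
    then have "m \<le> 1" by (simp add: m)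
    then have "(m + 1) powr (p - 1) * m \<le> 2 powr p * m"
      using m0 p by (intro mult_right_mono order_trans[OF powr_mono2[of "p - 1" "m + 1" 2] powr_mono]) auto
    then show ?thesis using False by (simp add: w_def)
  qed
  have "(R * (m + 1)) powr (p - 1) * (R * m) = R powr p * ((m + 1) powr (p - 1) * m)"
  proof (cases "R = 0")
    case False
    then have "R powr p = R powr (p - 1) * R"
      using powr_add[of R "p - 1" 1] R by simp
    then show ?thesis using R m0 by (simp add: powr_mult)
  qed (use p in simp)
  also have "\<dots> \<le> R powr p * (2 powr p * w)"
    by (intro mult_left_mono w) simp
  finally have "((R * (m + 1)) powr (p - 1) * (R * m)) powr (1 / p) \<le> (R powr p * (2 powr p * w)) powr (1 / p)"
    using R m0 p by (intro powr_mono2) auto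
  also have "\<dots> = 2 * R * w powr (1 / p)"
    using R p m0 by (simp add: powr_mult powr_powr w_def)
  also have "w powr (1 / p) \<le> (if 1 \<le> X then X powr \<epsilon> else X powr ((1 - \<epsilon>) / p))"
  proof (cases "1 \<le> X")
    case True
    then show ?thesis using p m0 by (simp add: w_def powr_powr) (simp add: m)
  next
    case False
    have "m powr (1 / p) \<le> (X powr (1 - \<epsilon>)) powr (1 / p)"
      using m0 p by (intro powr_mono2) (auto simp: m)
    then show ?thesis using False by (simp add: w_def powr_powr)
  qed
  finally show ?thesis using R by (simp add: mult_left_mono)
qed

section \<open>Decay of the block norms away from the critical level\<close>

context lp_generator
begin

lemma block_norm_le:
  fixes b :: "'d::finite \<Rightarrow> nat"
  assumes b: "\<And>i. 2 \<le> b i" and cop: "\<And>i j. i \<noteq> j \<Longrightarrow> coprime (b i) (b j)"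
    and p: "1 \<le> p" and r: "0 < r" "r * p < 1"
  shows "\<exists>c \<delta>. 0 \<le> c \<and> 0 < \<delta> \<and> (\<forall>N\<ge>1. concentrated_blocks \<phi>0 (ennreal p) r \<delta>
    (c * real N powr (r - 1)) (log 2 (real N)) (regular_distribution UNIV (extension (halton b ` {..<N}))))"
proof -
  obtain C where C0: "0 \<le> C"
    and C: "\<And>b k y. 2 \<le> b \<Longrightarrow> kernel_slice b (2 ^ k) C y (\<lambda>z. conv_step (kern (dyadic \<phi>0 k)) z y)"
    using kernel_slices by metis
  \<comment> \<open>The choice \<open>\<epsilon> < r\<close> lets the weighted bounds grow up to the
    critical level \<open>log 2 N\<close>; \<open>\<epsilon> < 1 - r * p\<close>, that is
    \<open>r < (1 - \<epsilon>) / p\<close>, lets them decay beyond it. The margin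
    \<open>\<delta>\<close> below is the smaller of the two rates.\<close>
  define \<epsilon> where "\<epsilon> = min (r / 2) ((1 - r * p) / 2)"
  have rp: "r \<le> r * p" using p r by simp
  have \<epsilon>: "0 < \<epsilon>" "\<epsilon> < r" "\<epsilon> \<le> 1 / 2" "\<epsilon> < 1 - r * p"
  proof -
    have "\<epsilon> \<le> r / 2" "\<epsilon> \<le> (1 - r * p) / 2" unfolding \<epsilon>_def by (rule min.cobounded1, rule min.cobounded2)
    moreover have "e < 1 - t \<and> e \<le> 1 / 2" if "e \<le> (1 - t) / 2" "0 \<le> t" "t < 1" for e t :: real
      using that by (simp add: field_simps)
    from this[of \<epsilon> "r * p"] have "\<epsilon> \<le> (1 - r * p) / 2 \<Longrightarrow> \<epsilon> < 1 - r * p \<and> \<epsilon> \<le> 1 / 2"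
      using r(2) order_trans[OF less_imp_le[OF r(1)] rp] by blast
    ultimately show "\<epsilon> < r" "\<epsilon> \<le> 1 / 2" "\<epsilon> < 1 - r * p"
      using r(1) by auto
    show "0 < \<epsilon>" using r by (simp add: \<epsilon>_def)
  qed
  define \<delta> where "\<delta> = min (r - \<epsilon>) ((1 - \<epsilon>) / p - r)"
  have "r < (1 - \<epsilon>) / p" using \<epsilon>(4) p by (simp add: pos_less_divide_eq)
  then have \<delta>: "0 < \<delta>" "\<delta> \<le> r - \<epsilon>" "\<delta> \<le> (1 - \<epsilon>) / p - r" using \<epsilon> by (auto simp: \<delta>_def)
  define g where "g = geometric_bound (min \<epsilon> (1 - \<epsilon>)) ^ CARD('d)"
  define g' where "g' = geometric_bound (1 / 2) ^ CARD('d)"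
  define Q where "Q = (\<Prod>i\<in>UNIV. 24 * real (b i) * C)"
  define Q' where "Q' = (\<Prod>i\<in>UNIV. real (b i))"
  have g0: "0 \<le> g" "0 \<le> g'"
    using geometric_bound_pos[of "min \<epsilon> (1 - \<epsilon>)"] geometric_bound_pos[of "1 / 2"] \<epsilon>
    by (auto simp: g_def g'_def intro!: zero_le_power)
  have Q: "0 \<le> Q" using C0 by (auto simp: Q_def intro!: prod_nonneg)
  have b1: "1 \<le> real (b i)" for i using b[of i] by simp
  have Q': "1 \<le> Q'" unfolding Q'_def using b1 by (intro prod_ge_1) auto
  define R where "R = Q' * Q * (g + g')"
  have R: "0 \<le> R" using Q Q' g0 by (simp add: R_def)
  let ?decay = "\<lambda>N s. 2 powr (- \<delta> * \<bar>real s - log 2 (real N)\<bar>)"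
  have "ennreal (2 powr (r * real s))
        * dist_Lp_norm (ennreal p) (dyadic_block \<phi>0 k (regular_distribution UNIV (extension (halton b ` {..<N}))))
      \<le> ennreal (2 * R * real N powr (r - 1) * ?decay N s)"
    if N: "1 \<le> N" and s: "s = (level k)" for N s and k :: "nat ^ 'd"
  proof -
    define P where "P = halton b ` {..<N}"
    interpret balanced_points b P
      unfolding P_def by (rule balanced_points_halton[OF b cop N])
    have cardP: "card P = N"
      unfolding P_def by (rule balanced_points_halton[OF b cop N])
    define K where "K i = (2::real) ^ (k $ i)" for i
    have K: "1 \<le> K i" for i by (simp add: K_def)
    \<comment> \<open>Large enough for \<open>2 ^ L\<close> to exceed \<open>N\<close> and every
      \<open>2 ^ (k $ i)\<close>. The later bounds do not depend on \<open>L\<close>.\<close>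
    define L where "L = N + s"
    have L: "K i < real (b i) ^ L" "real (card P) < real (b i) ^ L" for i
    proof -
      have "k $ i \<le> s" unfolding s by (intro member_le_sum) auto
      then have "k $ i < L" using N by (simp add: L_def)
      then have "K i < 2 ^ L" by (simp add: K_def)
      also have le: "(2::real) ^ L \<le> real (b i) ^ L" using b[of i] by (intro power_mono) auto
      finally show "K i < real (b i) ^ L" .
      have "N < 2 ^ N" by (rule less_exp)
      also have "(2::nat) ^ N \<le> 2 ^ L" by (intro power_increasing) (auto simp: L_def)
      finally have "real N < 2 ^ L" by (metis of_nat_less_iff of_nat_numeral of_nat_power)
      then show "real (card P) < real (b i) ^ L" using le cardP by linarith
    qed
    define M where "M y = (\<Sum>l\<in>scales L. scale_majorant K C l y)" for y
    define X where "X = real N / (\<Prod>i\<in>UNIV. K i)"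
    define m where "m = min (X powr \<epsilon>) (X powr (1 - \<epsilon>))"
    have Kprod: "(\<Prod>i\<in>UNIV. K i) = 2 powr real s"
      by (simp add: K_def s power_sum powr_realpow flip: of_nat_sum)
    have X: "0 < X" using N by (simp add: X_def Kprod)
    have m0: "0 \<le> m" by (simp add: m_def)
    define S where "S = (\<Sum>l\<in>scales L. hyperbolic_weight K l)"
    have S: "S \<le> g * m"
    proof -
      have "S \<le> g * X powr \<epsilon>"
        using sum_hyperbolic_le[OF K, where \<epsilon> = \<epsilon> and L = L] \<epsilon> cardP by (simp add: S_def g_def X_def)
      \<comment> \<open>The constant \<open>g\<close> is symmetric in \<open>\<epsilon>\<close> and
        \<open>1 - \<epsilon>\<close>, so both exponents may be used and the better bound
        kept.\<close>
      moreover have "S \<le> g * X powr (1 - \<epsilon>)"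
        using sum_hyperbolic_le[OF K, where \<epsilon> = "1 - \<epsilon>" and L = L] \<epsilon> cardP by (simp add: S_def g_def X_def min.commute)
      ultimately show ?thesis by (simp add: m_def min_def)
    qed
    have M0: "0 \<le> M y" for y
      unfolding M_def by (intro sum_nonneg scale_majorant_nonneg K C0)
    have M_sup: "M y \<le> R * (m + 1)" for y
    proof -
      have "M y \<le> (\<Sum>l\<in>scales L. Q' * Q *
          (hyperbolic_weight K l
            + ratio_weight K l))"
        unfolding M_def Q_def Q'_def by (intro sum_mono scale_majorant_le K C0)
      also have "\<dots> \<le> Q' * Q * (g * m + g')"
        unfolding sum_distrib_left[symmetric] sum.distrib S_def[symmetric]
        using S sum_ratio_le[OF K, where L = L] Q Q' by (intro mult_left_mono add_mono) (auto simp: g'_def)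
      also have "\<dots> \<le> Q' * Q * ((g + g') * (m + 1))"
        using g0 m0 Q Q' by (intro mult_left_mono) (auto simp: algebra_simps)
      finally show ?thesis by (simp add: R_def mult.assoc)
    qed
    have [measurable]: "M \<in> borel_measurable borel"
      unfolding M_def by measurable
    have M_int: "(\<integral>\<^sup>+y. ennreal (M y) \<partial>lborel) \<le> ennreal (R * m)"
    proof -
      have "(\<integral>\<^sup>+y. ennreal (M y) \<partial>lborel) = (\<Sum>l\<in>scales L. \<integral>\<^sup>+y. ennreal (scale_majorant K C l y) \<partial>lborel)"
        unfolding M_def using scale_majorant_nonneg[OF K C0]
        by (subst nn_integral_sum[symmetric]) (auto simp: sum_ennreal)
      also have "\<dots> \<le> (\<Sum>l\<in>scales L.
          ennreal (Q * (hyperbolic_weight K l)))"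
        unfolding Q_def by (intro sum_mono nn_integral_scale_majorant_le K C0)
      also have "\<dots> = ennreal (\<Sum>l\<in>scales L.
          Q * (hyperbolic_weight K l))"
        using Q volume_inv_pos K
        by (intro sum_ennreal mult_nonneg_nonneg prod_nonneg) (auto simp: less_imp_le le_max_iff_disj intro: order_trans[of 0 1])
      also have "\<dots> = ennreal (Q * S)"
        by (simp add: S_def sum_distrib_left)
      also have "\<dots> \<le> ennreal (R * m)"
      proof (rule ennreal_leI)
        have "Q * S \<le> Q * (g * m)" using S Q by (rule mult_left_mono)
        also have "\<dots> \<le> Q' * (Q * ((g + g') * m))"
          using mult_right_mono[OF Q', of "Q * ((g + g') * m)"] Q g0 m0
            mult_left_mono[of "g * m" "(g + g') * m" Q] by (simp add: distrib_right)
        finally show "Q * S \<le> R * m" by (simp add: R_def mult.assoc)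
      qed
      finally show ?thesis .
    qed
    define h where "h y = (LINT x|lborel. extension P x * block_kernel k (y - x))" for y
    have h_le: "norm (h y) \<le> 1 / real N * M y" for y
    proof -
      have "norm (quadrature_error (\<lambda>i z. conv_step (kern (dyadic \<phi>0 (k $ i))) z (y $ i))) \<le> M y"
        unfolding M_def using C[OF b] L
        by (intro norm_error_le_sum_majorant) (auto simp: K_def)
      from mult_left_mono[OF this, of "1 / real N"] show ?thesis
        unfolding h_def extension_conv_block_kernel[OF P_cube finite_P P_ne] norm_mult norm_of_real cardP by simp
    qed
    define \<rho> where "\<rho> = (if 1 \<le> X then X powr \<epsilon> else X powr ((1 - \<epsilon>) / p))"
    have "dist_Lp_norm (ennreal p) (dyadic_block \<phi>0 k (regular_distribution UNIV (extension P))) \<le> Lp_norm (ennreal p) h"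
      unfolding h_def by (intro dist_Lp_norm_dyadic_block_le extension_integrable P_cube)
    also have "\<dots> \<le> ennreal (1 / real N * ((R * (m + 1)) powr (p - 1) * (R * m)) powr (1 / p))"
      using R m0 by (intro Lp_norm_le_interpolation[OF p _ _ h_le M0 M_sup _ M_int]) auto
    also have "\<dots> \<le> ennreal (1 / real N * (2 * R * \<rho>))"
      unfolding \<rho>_def by (intro ennreal_leI mult_left_mono interpolation_factor_le X p \<epsilon> R m_def) simp
    finally have "ennreal (2 powr (r * real s)) * dist_Lp_norm (ennreal p) (dyadic_block \<phi>0 k (regular_distribution UNIV (extension P)))
        \<le> ennreal (2 powr (r * real s)) * ennreal (1 / real N * (2 * R * \<rho>))"
      by (rule mult_left_mono) simp
    also have "\<dots> = ennreal (2 * R * (1 / real N) * (2 powr (r * real s) * \<rho>))"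
      by (subst ennreal_mult'[symmetric]) (auto simp: mult_ac)
    also have "\<dots> \<le> ennreal (2 * R * (1 / real N) * (real N powr r * ?decay N s))"
    proof (intro ennreal_leI mult_left_mono)
      define \<nu> where "\<nu> = log 2 (real N)"
      have N\<nu>: "real N = 2 powr \<nu>" using N by (simp add: \<nu>_def)
      have X\<nu>: "X = 2 powr (\<nu> - real s)" unfolding X_def Kprod N\<nu> by (simp add: powr_diff)
      have iff: "1 \<le> X \<longleftrightarrow> real s \<le> \<nu>"
        unfolding X\<nu> using powr_le_cancel_iff[of 2 0 "\<nu> - real s"] by simp
      have "r * real s + e * (\<nu> - real s) \<le> r * \<nu> + - \<delta> * \<bar>real s - \<nu>\<bar>"
        if "real s \<le> \<nu> \<and> e = \<epsilon> \<or> \<nu> < real s \<and> e = (1 - \<epsilon>) / p" for e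
        using that
      proof
        assume a: "real s \<le> \<nu> \<and> e = \<epsilon>"
        then have "\<delta> * (\<nu> - real s) \<le> (r - \<epsilon>) * (\<nu> - real s)"
          using \<delta>(2) by (intro mult_right_mono) auto
        moreover have "\<bar>real s - \<nu>\<bar> = \<nu> - real s" using a by simp
        ultimately show ?thesis using a by (simp add: algebra_simps)
      next
        assume a: "\<nu> < real s \<and> e = (1 - \<epsilon>) / p"
        then have "\<delta> * (real s - \<nu>) \<le> (e - r) * (real s - \<nu>)"
          using \<delta>(3) by (intro mult_right_mono) auto
        moreover have "\<bar>real s - \<nu>\<bar> = real s - \<nu>" using a by simp
        ultimately show ?thesis by (simp add: algebra_simps)
      qed
      then have le: "2 powr (r * real s + e * (\<nu> - real s)) \<le> 2 powr (r * \<nu> + - \<delta> * \<bar>real s - \<nu>\<bar>)"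
        if "real s \<le> \<nu> \<and> e = \<epsilon> \<or> \<nu> < real s \<and> e = (1 - \<epsilon>) / p" for e
        using that by (intro powr_mono) auto
      \<comment> \<open>Both branches of \<open>\<rho>\<close> are \<open>X powr e\<close>, and
        \<open>1 \<le> X\<close> means that the level is at most \<open>\<nu>\<close>.\<close>
      define e where "e = (if 1 \<le> X then \<epsilon> else (1 - \<epsilon>) / p)"
      have "2 powr (r * real s) * \<rho> = 2 powr (r * real s + e * (\<nu> - real s))"
        by (simp add: \<rho>_def e_def X\<nu> powr_powr powr_add mult.commute)
      also have "\<dots> \<le> 2 powr (r * \<nu> + - \<delta> * \<bar>real s - \<nu>\<bar>)"
        by (rule le) (auto simp: e_def iff not_le)
      also have "\<dots> = real N powr r * 2 powr (- \<delta> * \<bar>real s - \<nu>\<bar>)"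
        unfolding powr_add N\<nu> powr_powr by (simp add: mult.commute)
      finally show "2 powr (r * real s) * \<rho> \<le> real N powr r * ?decay N s"
        by (simp add: \<nu>_def)
    qed (use R in auto)
    also have "2 * R * (1 / real N) * (real N powr r * ?decay N s)
        = 2 * R * real N powr (r - 1) * ?decay N s"
      using N by (simp add: powr_diff)
    finally show ?thesis by (simp add: P_def)
  qed
  then show ?thesis
    using R \<delta>(1) by (intro exI[of _ "2 * R"] exI[of _ \<delta>]) auto
qed

end

section \<open>Summation over the dyadic blocks\<close>

text \<open>All coordinates but one determine the vector, because the last one is recovered from the
  level. Each of these \<open>CARD('d) - 1\<close> coordinates has at most \<open>s + 1\<close>
  values.\<close>

lemma card_vec_sum_eq_le:
  "finite {k :: nat ^ 'd::finite. (level k) = s}"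
  "card {k :: nat ^ 'd::finite. (level k) = s} \<le> (s + 1) ^ (CARD('d) - 1)"
proof -
  let ?A = "{k :: nat ^ 'd. (level k) = s}"
  fix i0 :: 'd
  define I where "I = UNIV - {i0}"
  let ?f = "\<lambda>k :: nat ^ 'd. restrict (($) k) I"
  have split: "(level k) = k $ i0 + (\<Sum>i\<in>I. k $ i)" for k :: "nat ^ 'd"
    unfolding I_def by (rule sum.remove) auto
  have inj: "inj_on ?f ?A"
  proof (rule inj_onI)
    fix k l assume kl: "k \<in> ?A" "l \<in> ?A" and eq: "?f k = ?f l"
    have I: "k $ i = l $ i" if "i \<in> I" for i
      using fun_cong[OF eq, of i] that by simp
    then have "(\<Sum>i\<in>I. k $ i) = (\<Sum>i\<in>I. l $ i)" by simp
    then have "k $ i0 = l $ i0" using kl by (simp add: split)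
    then show "k = l"
      unfolding vec_eq_iff using I by (metis DiffI I_def UNIV_I singletonD)
  qed
  have sub: "?f ` ?A \<subseteq> (\<Pi>\<^sub>E i\<in>I. {..s})"
  proof
    fix u assume "u \<in> ?f ` ?A"
    then obtain k where k: "(level k) = s" and u: "u = ?f k" by auto
    have "k $ i \<le> s" for i
      unfolding k[symmetric] by (intro member_le_sum) auto
    then show "u \<in> (\<Pi>\<^sub>E i\<in>I. {..s})" by (auto simp: u)
  qed
  have finI: "finite (\<Pi>\<^sub>E i\<in>I. {..s})" by (intro finite_PiE) auto
  show "finite ?A"
    using finite_subset[OF sub finI] inj by (rule finite_imageD)
  have "card ?A = card (?f ` ?A)"
    by (rule card_image[OF inj, symmetric])
  also have "\<dots> \<le> card (\<Pi>\<^sub>E i\<in>I. {..s})"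
    by (rule card_mono[OF finI sub])
  also have "\<dots> = (s + 1) ^ (CARD('d) - 1)"
    by (simp add: card_PiE I_def)
  finally show "card ?A \<le> (s + 1) ^ (CARD('d) - 1)" .
qed

lemma sum_by_level_le:
  fixes \<phi> :: "nat \<Rightarrow> real" and F :: "(nat ^ 'd::finite) set"
  assumes F: "finite F" and \<phi>: "\<And>s. 0 \<le> \<phi> s"
  shows "(\<Sum>k\<in>F. \<phi> (level k))
    \<le> (\<Sum>s\<in>(\<lambda>k. \<Sum>i\<in>UNIV. k $ i) ` F. (real s + 1) ^ (CARD('d) - 1) * \<phi> s)"
proof -
  let ?n = "\<lambda>k :: nat ^ 'd. \<Sum>i\<in>UNIV. k $ i"
  have "(\<Sum>k\<in>F. \<phi> (?n k)) = (\<Sum>s\<in>?n ` F. \<Sum>k\<in>{k \<in> F. ?n k = s}. \<phi> (?n k))"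
    by (rule sum.group[OF F _ order_refl, symmetric]) (use F in auto)
  also have "\<dots> = (\<Sum>s\<in>?n ` F. real (card {k \<in> F. ?n k = s}) * \<phi> s)"
    by (intro sum.cong refl) simp
  also have "\<dots> \<le> (\<Sum>s\<in>?n ` F. (real s + 1) ^ (CARD('d) - 1) * \<phi> s)"
  proof (intro sum_mono mult_right_mono \<phi>)
    fix s
    have "card {k \<in> F. ?n k = s} \<le> card {k. ?n k = s}"
      by (intro card_mono card_vec_sum_eq_le) auto
    also have "\<dots> \<le> (s + 1) ^ (CARD('d) - 1)"
      by (rule card_vec_sum_eq_le)
    finally have "real (card {k \<in> F. ?n k = s}) \<le> real ((s + 1) ^ (CARD('d) - 1))"
      by (simp only: of_nat_le_iff)
    then show "real (card {k \<in> F. ?n k = s}) \<le> (real s + 1) ^ (CARD('d) - 1)"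
      by (simp only: of_nat_power of_nat_add of_nat_1)
  qed
  finally show ?thesis .
qed

lemma power_le_exponential:
  fixes \<sigma> :: real
  assumes \<sigma>: "0 < \<sigma>"
  shows "\<exists>c>0. \<forall>x\<ge>0. (1 + x) ^ n \<le> c * 2 powr (\<sigma> * x)"
proof -
  \<comment> \<open>With \<open>m\<close> below,
    \<open>1 + x \<le> m * (1 + a * x) \<le> m * exp (a * x)\<close>, and \<open>a\<close> is scaled
    so that \<open>(n + 1) * a = \<sigma> * ln 2\<close>. Dividing by \<open>n + 1\<close> also
    covers \<open>n = 0\<close>.\<close>
  define a where "a = \<sigma> * ln 2 / (real n + 1)"
  have a: "0 < a" using \<sigma> by (simp add: a_def)
  define m where "m = max 1 (1 / a)"
  have m: "1 \<le> m" "1 / a \<le> m" by (auto simp: m_def)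
  have "(1 + x) ^ n \<le> m ^ n * 2 powr (\<sigma> * x)" if x: "0 \<le> x" for x
  proof -
    have "1 + x = 1 * 1 + 1 / a * (a * x)" using a by simp
    also have "\<dots> \<le> m * 1 + m * (a * x)"
      using m a x by (intro add_mono mult_right_mono) auto
    also have "\<dots> = m * (1 + a * x)" by (simp add: distrib_left)
    also have "\<dots> \<le> m * exp (a * x)"
      using m by (intro mult_left_mono exp_ge_add_one_self) auto
    finally have "(1 + x) ^ n \<le> (m * exp (a * x)) ^ n"
      using x by (intro power_mono) auto
    also have "\<dots> = m ^ n * exp (real n * (a * x))"
      by (simp add: power_mult_distrib exp_of_nat_mult)
    also have "\<dots> \<le> m ^ n * exp ((real n + 1) * (a * x))"
      using m a x by (intro mult_left_mono) (auto simp: distrib_right)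
    also have "(real n + 1) * (a * x) = \<sigma> * x * ln 2"
      by (simp add: a_def)
    also have "exp (\<sigma> * x * ln 2) = 2 powr (\<sigma> * x)"
      by (simp add: powr_def)
    finally show ?thesis .
  qed
  then show ?thesis using m by (intro exI[of _ "m ^ n"]) auto
qed

text \<open>Level \<open>s\<close> holds at most \<open>(s + 1) ^ (CARD('d) - 1)\<close> blocks, and
  \<open>s + 1 \<le> 2 * \<nu> * (1 + \<bar>s - \<nu>\<bar>)\<close> for
  \<open>1 \<le> \<nu>\<close>. Half of the exponential decay absorbs the power of
  \<open>1 + \<bar>s - \<nu>\<bar>\<close>; the other half is summed.\<close>

lemma sum_concentrated_le:
  fixes \<tau> :: real
  assumes \<tau>: "0 < \<tau>"
  shows "\<exists>c>0. \<forall>\<nu>\<ge>1. \<forall>F :: (nat ^ 'd::finite) set. finite F \<longrightarrow>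
    (\<Sum>k\<in>F. 2 powr (- \<tau> * \<bar>real (level k) - \<nu>\<bar>)) \<le> c * \<nu> ^ (CARD('d) - 1)"
proof -
  let ?n = "CARD('d) - 1"
  obtain c where c: "0 < c" "\<And>x. 0 \<le> x \<Longrightarrow> (1 + x) ^ ?n \<le> c * 2 powr (\<tau> / 2 * x)"
    using power_le_exponential[of "\<tau> / 2" ?n] \<tau> by auto
  have "(\<Sum>k\<in>F. 2 powr (- \<tau> * \<bar>real (level k) - \<nu>\<bar>)) \<le> 2 ^ ?n * c * geometric_bound (\<tau> / 2) * \<nu> ^ ?n"
    if \<nu>: "1 \<le> \<nu>" and F: "finite F" for \<nu> and F :: "(nat ^ 'd) set"
  proof -
    let ?S = "(\<lambda>k. \<Sum>i\<in>UNIV. k $ i) ` F"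
    have "(\<Sum>k\<in>F. 2 powr (- \<tau> * \<bar>real (level k) - \<nu>\<bar>))
        \<le> (\<Sum>s\<in>?S. (real s + 1) ^ ?n * 2 powr (- \<tau> * \<bar>real s - \<nu>\<bar>))"
      by (rule sum_by_level_le[OF F, of "\<lambda>s. 2 powr (- \<tau> * \<bar>real s - \<nu>\<bar>)"]) simp
    also have "\<dots> \<le> (\<Sum>s\<in>?S. 2 ^ ?n * \<nu> ^ ?n * c * 2 powr (- (\<tau> / 2) * \<bar>real s - \<nu>\<bar>))"
    proof (rule sum_mono)
      fix s
      let ?x = "\<bar>real s - \<nu>\<bar>"
      have "0 \<le> (\<nu> - 1) * ?x" using \<nu> by simp
      then have "real s + 1 \<le> 2 * \<nu> * (1 + ?x)"
        using \<nu> abs_ge_self[of "real s - \<nu>"] by (simp add: algebra_simps)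
      then have "(real s + 1) ^ ?n \<le> (2 * \<nu> * (1 + ?x)) ^ ?n"
        by (intro power_mono) auto
      also have "\<dots> = 2 ^ ?n * \<nu> ^ ?n * (1 + ?x) ^ ?n"
        by (simp only: power_mult_distrib)
      also have "\<dots> \<le> 2 ^ ?n * \<nu> ^ ?n * (c * 2 powr (\<tau> / 2 * ?x))"
        using \<nu> by (intro mult_left_mono c) auto
      finally have "(real s + 1) ^ ?n * 2 powr (- \<tau> * ?x)
          \<le> 2 ^ ?n * \<nu> ^ ?n * (c * 2 powr (\<tau> / 2 * ?x)) * 2 powr (- \<tau> * ?x)"
        by (rule mult_right_mono) simp
      also have "\<dots> = 2 ^ ?n * \<nu> ^ ?n * c * (2 powr (\<tau> / 2 * ?x) * 2 powr (- \<tau> * ?x))"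
        by (simp only: mult.assoc)
      also have "2 powr (\<tau> / 2 * ?x) * 2 powr (- \<tau> * ?x) = 2 powr (- (\<tau> / 2) * ?x)"
        unfolding powr_add[symmetric] by (simp add: field_simps)
      finally show "(real s + 1) ^ ?n * 2 powr (- \<tau> * ?x) \<le> 2 ^ ?n * \<nu> ^ ?n * c * 2 powr (- (\<tau> / 2) * ?x)" .
    qed
    also have "\<dots> \<le> 2 ^ ?n * \<nu> ^ ?n * c * geometric_bound (\<tau> / 2)"
      unfolding sum_distrib_left[symmetric] using \<nu> c(1) \<tau> F
      by (intro mult_left_mono sum_two_powr_dist_le) auto
    finally show ?thesis by (simp add: mult_ac)
  qed
  then show ?thesis
    using c(1) geometric_bound_pos[of "\<tau> / 2"] \<tau>
    by (intro exI[of _ "2 ^ ?n * c * geometric_bound (\<tau> / 2)"]) auto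
qed

text \<open>For \<open>q = \<infinity>\<close> the peak value \<open>A\<close> bounds the supremum,
  and the exponent of \<open>\<nu>\<close> is 0. For finite \<open>q\<close> the powers of the block
  norms decay at rate \<open>\<delta> * q\<close>, and the root of the number of blocks near the
  peak gives the power of \<open>\<nu>\<close>.\<close>

lemma besov_norm_le_of_block_bounds:
  fixes q :: ennreal and \<delta> :: real
  assumes q: "1 \<le> q" and \<delta>: "0 < \<delta>"
  shows "\<exists>c>0. \<forall>\<nu>\<ge>1. \<forall>A\<ge>0. \<forall>T :: (real ^ 'd::finite \<Rightarrow> complex) \<Rightarrow> complex.
    concentrated_blocks \<phi>0 p r \<delta> A \<nu> T \<longrightarrow>
    besov_norm \<phi>0 p q r T \<le> ennreal (c * A * \<nu> powr ((real CARD('d) - 1) * enn2real (1 / q)))"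
proof (cases "q = \<infinity>")
  case True
  have bound: "besov_norm \<phi>0 p q r T \<le> ennreal (1 * A * \<nu> powr ((real CARD('d) - 1) * enn2real (1 / q)))"
    if \<nu>: "1 \<le> \<nu>" and A: "0 \<le> A"
      and T: "concentrated_blocks \<phi>0 p r \<delta> A \<nu> T"
    for \<nu> A and T :: "(real ^ 'd \<Rightarrow> complex) \<Rightarrow> complex"
  proof -
    have "besov_norm \<phi>0 p q r T = (SUP k :: nat ^ 'd. ennreal (2 powr (r * real (level k)))
        * dist_Lp_norm p (dyadic_block \<phi>0 k T))"
      using True by (simp add: besov_norm_def)
    also have "\<dots> \<le> ennreal A"
    proof (rule SUP_least)
      fix k :: "nat ^ 'd"
      have "2 powr (- \<delta> * \<bar>real (level k) - \<nu>\<bar>) \<le> 2 powr 0"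
        using \<delta> by (intro powr_mono) auto
      then have "A * 2 powr (- \<delta> * \<bar>real (level k) - \<nu>\<bar>) \<le> A"
        using mult_left_mono[OF _ A] by fastforce
      then show "ennreal (2 powr (r * real (level k))) * dist_Lp_norm p (dyadic_block \<phi>0 k T) \<le> ennreal A"
        using T[rule_format, of k] ennreal_leI order_trans by blast
    qed
    finally show ?thesis using True \<nu> by simp
  qed
  show ?thesis
    by (intro exI[of _ 1] conjI allI impI, simp, rule bound, assumption+)
next
  case False
  define Q where "Q = enn2real q"
  have qQ: "q = ennreal Q" using False by (simp add: Q_def less_top)
  have Q: "1 \<le> Q" using q unfolding qQ by simp
  have iq: "enn2real (1 / q) = 1 / Q"
    using Q unfolding qQ by (simp add: divide_ennreal flip: ennreal_1)
  let ?n = "CARD('d) - 1"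
  obtain c where c: "0 < c" "\<And>\<nu> F. \<lbrakk>1 \<le> \<nu>; finite F\<rbrakk> \<Longrightarrow>
      (\<Sum>k\<in>(F :: (nat ^ 'd) set). 2 powr (- (\<delta> * Q) * \<bar>real (level k) - \<nu>\<bar>)) \<le> c * \<nu> ^ ?n"
    using sum_concentrated_le[of "\<delta> * Q", where 'd = 'd] \<delta> Q by auto
  have bound: "besov_norm \<phi>0 p q r T \<le> ennreal (c powr (1 / Q) * A * \<nu> powr ((real CARD('d) - 1) * enn2real (1 / q)))"
    if \<nu>: "1 \<le> \<nu>" and A: "0 \<le> A"
      and T: "concentrated_blocks \<phi>0 p r \<delta> A \<nu> T"
    for \<nu> A and T :: "(real ^ 'd \<Rightarrow> complex) \<Rightarrow> complex"
  proof -
    let ?t = "\<lambda>k :: nat ^ 'd. ennreal (2 powr (r * real (level k) * Q)) * ennpowr (dist_Lp_norm p (dyadic_block \<phi>0 k T)) Q"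
    have t_le: "?t k \<le> ennreal (A powr Q * 2 powr (- (\<delta> * Q) * \<bar>real (level k) - \<nu>\<bar>))" for k
    proof -
      define s where "s = real (level k)"
      define N where "N = dist_Lp_norm p (dyadic_block \<phi>0 k T)"
      have T': "ennreal (2 powr (r * s)) * N \<le> ennreal (A * 2 powr (- \<delta> * \<bar>s - \<nu>\<bar>))"
        using T[rule_format, of k] by (simp add: s_def N_def)
      have "N \<noteq> \<infinity>"
        \<comment> \<open>The weight is positive, so an infinite norm would make the left-hand side
          infinite. From here on the estimate is one between real numbers.\<close>
        using T' by (auto simp: ennreal_mult_top top_unique)
      then obtain v where v: "0 \<le> v" "N = ennreal v" by (cases N) auto
      have "ennreal (2 powr (r * s) * v) \<le> ennreal (A * 2 powr (- \<delta> * \<bar>s - \<nu>\<bar>))"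
        using T' v by (simp add: ennreal_mult')
      then have "2 powr (r * s) * v \<le> A * 2 powr (- \<delta> * \<bar>s - \<nu>\<bar>)"
        using A by (subst (asm) ennreal_le_iff) auto
      then have "(2 powr (r * s) * v) powr Q \<le> (A * 2 powr (- \<delta> * \<bar>s - \<nu>\<bar>)) powr Q"
        using v Q by (intro powr_mono2) auto
      then have "2 powr (r * s * Q) * v powr Q \<le> A powr Q * 2 powr (- (\<delta> * Q) * \<bar>s - \<nu>\<bar>)"
        using v A by (simp add: powr_mult powr_powr mult_ac)
      then have "ennreal (2 powr (r * s * Q)) * ennreal (v powr Q) \<le> ennreal (A powr Q * 2 powr (- (\<delta> * Q) * \<bar>s - \<nu>\<bar>))"
        by (subst ennreal_mult[symmetric]) (auto intro: ennreal_leI)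
      then show ?thesis
        unfolding s_def[symmetric] N_def[symmetric] v(2) ennpowr_ennreal[OF v(1)] .
    qed
    have "(\<Sum>\<^sub>\<infinity>k. ?t k) \<le> ennreal (A powr Q * (c * \<nu> ^ ?n))"
    proof (rule infsum_le_finite_sums)
      show "?t summable_on UNIV" by (rule nonneg_summable_on_complete) simp
      fix F :: "(nat ^ 'd) set" assume F: "finite F"
      have "(\<Sum>k\<in>F. ?t k) \<le> (\<Sum>k\<in>F. ennreal (A powr Q * 2 powr (- (\<delta> * Q) * \<bar>real (level k) - \<nu>\<bar>)))"
        by (intro sum_mono t_le)
      also have "\<dots> = ennreal (\<Sum>k\<in>F. A powr Q * 2 powr (- (\<delta> * Q) * \<bar>real (level k) - \<nu>\<bar>))"
        by (intro sum_ennreal) auto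
      also have "\<dots> \<le> ennreal (A powr Q * (c * \<nu> ^ ?n))"
        unfolding sum_distrib_left[symmetric] by (intro ennreal_leI mult_left_mono c \<nu> F) auto
      finally show "(\<Sum>k\<in>F. ?t k) \<le> ennreal (A powr Q * (c * \<nu> ^ ?n))" .
    qed
    then have "ennpowr (\<Sum>\<^sub>\<infinity>k. ?t k) (1 / Q) \<le> ennpowr (ennreal (A powr Q * (c * \<nu> ^ ?n))) (1 / Q)"
      using Q by (intro ennpowr_mono) auto
    also have "\<dots> = ennreal ((A powr Q * (c * \<nu> ^ ?n)) powr (1 / Q))"
      using \<nu> c(1) by (intro ennpowr_ennreal) auto
    also have "(A powr Q * (c * \<nu> ^ ?n)) powr (1 / Q) = c powr (1 / Q) * A * \<nu> powr ((real CARD('d) - 1) * enn2real (1 / q))"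
    proof -
      have "\<nu> ^ ?n = \<nu> powr (real CARD('d) - 1)"
        using \<nu> by (simp add: powr_realpow[symmetric] of_nat_diff Suc_leI)
      then show ?thesis
        using A c(1) Q by (simp add: powr_mult powr_powr iq)
    qed
    finally show ?thesis
      using False by (simp add: besov_norm_def Q_def)
  qed
  have pos: "0 < c powr (1 / Q)" using c(1) by simp
  show ?thesis
    by (intro exI[of _ "c powr (1 / Q)"] conjI allI impI, rule pos, rule bound, assumption+)
qed

theorem theorem1p1:
  fixes \<phi>0 :: "real \<Rightarrow> complex" and p q :: ennreal and r :: real
  assumes "dyadic_generator \<phi>0"
    and "1 \<le> p" and "1 \<le> q"
    and "0 < r" and "ennreal r < 1 / p"
  shows "\<exists>c::real. c > 0 \<and> (\<forall>N::nat. N \<ge> 2 \<longrightarrow>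
           (\<exists>P :: (real ^ 'd::finite) set. P \<subseteq> unit_cube \<and> finite P \<and> card P = N \<and>
              discrepancy_distribution P \<in> besov_space_cube \<phi>0 p q r \<and>
              besov_norm_cube \<phi>0 p q r (discrepancy_distribution P)
                \<le> ennreal (c * real N powr (r - 1)
                             * ln (real N) powr ((real CARD('d) - 1) * enn2real (1 / q)))))"
proof -
  interpret lp_generator \<phi>0 by standard (rule assms(1))
  \<comment> \<open>Otherwise \<open>1 / p\<close> would be 0, which contradicts
    \<open>0 < r\<close>.\<close>
  have "p \<noteq> \<infinity>" using assms(4,5) by auto
  then obtain p' where p: "p = ennreal p'" "0 \<le> p'" by (cases p) auto
  have p1: "1 \<le> p'" using assms(2) p by simp
  have "ennreal r < ennreal (1 / p')"
    using assms(5) p1 unfolding p by (simp add: divide_ennreal flip: ennreal_1)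
  then have rp: "r * p' < 1"
    using assms(4) p1 by (simp add: ennreal_less_iff pos_less_divide_eq)
  obtain b :: "'d \<Rightarrow> nat" where b: "\<And>i. 2 \<le> b i" "\<And>i j. i \<noteq> j \<Longrightarrow> coprime (b i) (b j)"
    using exists_coprime_bases by metis
  obtain c1 \<delta> where c1: "0 \<le> c1" and \<delta>: "0 < \<delta>"
    and blocks: "\<And>N. 1 \<le> N \<Longrightarrow> concentrated_blocks \<phi>0 p r \<delta> (c1 * real N powr (r - 1)) (log 2 (real N))
      (regular_distribution UNIV (extension (halton b ` {..<N})))"
    using block_norm_le[of b p' r, OF b p1 assms(4) rp] unfolding p by blast
  obtain c2 where c2: "0 < c2"
    and norm_le: "\<forall>\<nu>\<ge>1. \<forall>A\<ge>0. \<forall>T :: (real ^ 'd \<Rightarrow> complex) \<Rightarrow> complex.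
      concentrated_blocks \<phi>0 p r \<delta> A \<nu> T \<longrightarrow>
      besov_norm \<phi>0 p q r T \<le> ennreal (c2 * A * \<nu> powr ((real CARD('d) - 1) * enn2real (1 / q)))"
    using besov_norm_le_of_block_bounds[OF assms(3) \<delta>, where 'd = 'd and r = r and p = p and ?\<phi>0.0 = \<phi>0]
    by (elim exE conjE) (rule that)
  define e where "e = (real CARD('d) - 1) * enn2real (1 / q)"
  \<comment> \<open>The summand 1 keeps \<open>c\<close> positive when \<open>c1 = 0\<close>; the
    last factor converts the binary into the natural logarithm.\<close>
  define c where "c = c2 * (c1 + 1) * (1 / ln 2) powr e"
  have c: "0 < c" using c1 c2 by (simp add: c_def)
  have main: "\<exists>P :: (real ^ 'd) set. P \<subseteq> unit_cube \<and> finite P \<and> card P = N \<and>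
      discrepancy_distribution P \<in> besov_space_cube \<phi>0 p q r \<and>
      besov_norm_cube \<phi>0 p q r (discrepancy_distribution P) \<le> ennreal (c * real N powr (r - 1) * ln (real N) powr e)"
    if N: "2 \<le> N" for N
  proof -
    define P where "P = halton b ` {..<N}"
    have N1: "1 \<le> N" using N by simp
    interpret balanced_points b P
      unfolding P_def by (rule balanced_points_halton[OF b N1])
    define T where "T = regular_distribution UNIV (extension P)"
    \<comment> \<open>Here \<open>2 \<le> N\<close> enters: the critical level must be at least 1
      for its power to dominate the number of blocks.\<close>
    have \<nu>: "1 \<le> log 2 (real N)" using N by simp
    have "besov_norm \<phi>0 p q r T \<le> ennreal (c2 * (c1 * real N powr (r - 1)) * log 2 (real N) powr e)"
      unfolding e_def T_def P_def using c1
      by (intro norm_le[rule_format] \<nu> blocks[rule_format] N1) auto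
    also have "\<dots> \<le> ennreal (c * real N powr (r - 1) * ln (real N) powr e)"
    proof (rule ennreal_leI)
      have "log 2 (real N) powr e = (1 / ln 2) powr e * ln (real N) powr e"
        using N by (simp add: log_def powr_divide)
      then have "c2 * (c1 * real N powr (r - 1)) * log 2 (real N) powr e
          = c2 * c1 * ((1 / ln 2) powr e * real N powr (r - 1) * ln (real N) powr e)"
        by simp
      also have "\<dots> \<le> c2 * (c1 + 1) * ((1 / ln 2) powr e * real N powr (r - 1) * ln (real N) powr e)"
        using c2 by (intro mult_right_mono mult_left_mono) auto
      finally show "c2 * (c1 * real N powr (r - 1)) * log 2 (real N) powr e \<le> c * real N powr (r - 1) * ln (real N) powr e"
        by (simp add: c_def mult.assoc)
    qed
    finally have T_le: "besov_norm \<phi>0 p q r T \<le> ennreal (c * real N powr (r - 1) * ln (real N) powr e)" .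
    then have "besov_norm \<phi>0 p q r T < \<infinity>"
      by (rule le_less_trans) simp
    then have "T \<in> besov_space \<phi>0 p q r"
      unfolding besov_space_def T_def
      by (simp add: regular_distribution_tempered extension_integrable[OF P_cube])
    then have "besov_norm_cube \<phi>0 p q r (discrepancy_distribution P) \<le> besov_norm \<phi>0 p q r T"
      unfolding besov_norm_cube_def T_def using discrepancy_distribution_eq[OF P_cube]
      by (intro Inf_lower) auto
    then have le: "besov_norm_cube \<phi>0 p q r (discrepancy_distribution P) \<le> ennreal (c * real N powr (r - 1) * ln (real N) powr e)"
      using T_le by (rule order_trans)
    have "discrepancy_distribution P \<in> besov_space_cube \<phi>0 p q r"
      unfolding besov_space_cube_def using discrepancy_distribution_is_distribution[OF P_cube] le_less_trans[OF le]
      by simp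
    moreover have "card P = N"
      unfolding P_def by (rule balanced_points_halton[OF b N1])
    ultimately show ?thesis
      using P_cube finite_P le by blast
  qed
  show ?thesis
    unfolding e_def[symmetric] using c main by blast
qed

end
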